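(* Let $k\ge3$ be an odd integer and $s>\frac52$. Let $(u^\omega,v^\omega)$ be the random pair of functions on $\mathbb{T}^3$ \[u^\omega(x)=\sum_{n\in\mathbb{Z}^3}\frac{g_n}{\langle n\rangle^{s+1}}e^{in\cdot x},\qquad v^\omega(x)=\sum_{n\in\mathbb{Z}^3}\frac{h_n}{\langle n\rangle^{s}}e^{in\cdot x},\] and for $t>0$ let $(\tilde u(t),\tilde v(t))$ be the solution at time $t$ of the dispersionless system \[\partial_t u=v,\qquad \partial_t v=-u^k,\] solved pointwise in $x\in\mathbb{T}^3$, with initial data $(u(0),v(0))=(u^\omega,v^\omega)$. Then, for every $t>0$, the law of $(\tilde u(t),\tilde v(t))$ is not absolutely continuous with respect to the law of $(u^\omega,v^\omega)$.
   Context: $\langle n\rangle=(1+|n|^2)^{1/2}$; $g_n,h_n$ ($n\in\mathbb{Z}^3$) are standard complex Gaussian random variables, independent except for $g_{-n}=\overline{g_n}$, $h_{-n}=\overline{h_n}$ ($n\ne0$), with $g_0,h_0$ real. The ODE is global in time since it conserves $\frac12 v^2+\frac1{k+1}u^{k+1}$ at each point $x$. *)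

theory Defs
  imports "HOL-Probability.Probability"
begin

definition jbr :: "int^3 \<Rightarrow> real" where
  "jbr n = sqrt (1 + (\<Sum>i\<in>UNIV. (real_of_int (n$i))^2))"

text \<open>The pairing n . x for n in Z^3 and x in R^3 (points of T^3 = R^3 / 2 pi Z^3).\<close>
definition lat_ip :: "int^3 \<Rightarrow> real^3 \<Rightarrow> real" where
  "lat_ip n x = (\<Sum>i\<in>UNIV. real_of_int (n$i) * x$i)"

definition cube :: "nat \<Rightarrow> (int^3) set" where
  "cube N = {n. \<forall>i. \<bar>n$i\<bar> \<le> int N}"

definition fourier_sum :: "(int^3 \<Rightarrow> complex) \<Rightarrow> real^3 \<Rightarrow> real" where
  "fourier_sum c x = Re (lim (\<lambda>N. \<Sum>n\<in>cube N. c n * cis (lat_ip n x)))"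

text \<open>A half-lattice: exactly one of n, -n lies in it for n \<noteq> 0 (lexicographic positivity).\<close>
definition lex_pos :: "int^3 \<Rightarrow> bool" where
  "lex_pos n \<longleftrightarrow> n$1 > 0 \<or> (n$1 = 0 \<and> (n$2 > 0 \<or> (n$2 = 0 \<and> n$3 > 0)))"

text \<open>Standard complex Gaussian (E |g|^2 = 1): density exp(-|z|^2)/pi w.r.t. Lebesgue measure on C.\<close>
definition std_complex_gaussian :: "'w measure \<Rightarrow> ('w \<Rightarrow> complex) \<Rightarrow> bool" where
  "std_complex_gaussian M X \<longleftrightarrow>
     distributed M lborel X (\<lambda>z. ennreal (exp (- ((cmod z)^2)) / pi))"

definition std_real_gaussian :: "'w measure \<Rightarrow> ('w \<Rightarrow> complex) \<Rightarrow> bool" where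
  "std_real_gaussian M X \<longleftrightarrow> (\<forall>\<omega>. X \<omega> \<in> \<real>) \<and>
     distributed M lborel (\<lambda>\<omega>. Re (X \<omega>)) (\<lambda>x. ennreal (std_normal_density x))"

definition ode_flow :: "nat \<Rightarrow> real \<times> real \<Rightarrow> real \<Rightarrow> real \<times> real" where
  "ode_flow k p = (THE \<phi>. \<phi> 0 = p \<and>
     (\<forall>\<tau>. (\<phi> has_vector_derivative (snd (\<phi> \<tau>), - ((fst (\<phi> \<tau>))^k))) (at \<tau>)))"

definition rand_u :: "real \<Rightarrow> (int^3 \<Rightarrow> 'w \<Rightarrow> complex) \<Rightarrow> 'w \<Rightarrow> real^3 \<Rightarrow> real" where
  "rand_u s g \<omega> = fourier_sum (\<lambda>n. g n \<omega> / complex_of_real (jbr n powr (s + 1)))"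

definition rand_v :: "real \<Rightarrow> (int^3 \<Rightarrow> 'w \<Rightarrow> complex) \<Rightarrow> 'w \<Rightarrow> real^3 \<Rightarrow> real" where
  "rand_v s h \<omega> = fourier_sum (\<lambda>n. h n \<omega> / complex_of_real (jbr n powr s))"

definition fun_pair_space :: "((real^3 \<Rightarrow> real) \<times> (real^3 \<Rightarrow> real)) measure" where
  "fun_pair_space = (\<Pi>\<^sub>M x\<in>UNIV. (borel :: real measure)) \<Otimes>\<^sub>M (\<Pi>\<^sub>M x\<in>UNIV. (borel :: real measure))"

end

theory Submission
  imports Defs "HOL-Library.Landau_Symbols" "HOL-Computational_Algebra.Polynomial"
begin

text \<open>
  Almost surely \<open>u\<close> is one derivative smoother than \<open>v\<close>, whereas the position at time \<open>t\<close> depends on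
  the initial velocity and is only as smooth as \<open>v\<close>. Smoothness is tested at the points
  \<open>2^-j e_1\<close> only: a sequence \<open>w_j\<close> is regular of order \<open>\<theta>\<close> if \<open>w_j = P (2^-j) + O (2^(-j \<theta>))\<close> for
  some polynomial \<open>P\<close>, which for noninteger \<open>\<theta>\<close> is equivalent to a bound on a dyadic difference of
  \<open>w\<close> and hence to a measurable condition on countably many values. Fix a noninteger \<open>\<theta>\<close> strictly between
  \<open>s - 3/2\<close> and \<open>s - 1/2\<close>. Second moments show that \<open>u\<close> is regular almost surely, and
  anticoncentration of Gaussian sums shows that \<open>v\<close> almost surely is not.

  If the law at time \<open>t\<close> were absolutely continuous, the position at time \<open>t\<close> would be regular as
  well. On the event, of positive probability, that \<open>(u, v)(0)\<close> lies in a region where the velocity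
  stays positive up to time \<open>t\<close>, the amplitude \<open>A\<close> given by the conserved energy satisfies
  \<open>a (u(t) / A) - a (u(0) / A) = t A^((k-1)/2)\<close> with an explicit smooth function \<open>a\<close>. This equation
  is nondegenerate in \<open>A\<close>, so \<open>A\<close> and then \<open>v\<close> inherit the regularity of \<open>u(0)\<close> and \<open>u(t)\<close>, a contradiction.
\<close>

section \<open>Global solutions of the pointwise equation\<close>

text \<open>The exponents come from one computation. For a field with coefficients of size
  \<open>jbr n powr (- \<sigma>)\<close>, a dyadic difference of high order at scale
  \<open>2^-j\<close> has variance of order \<open>2^(-j (2 \<sigma> - 3))\<close>, the share of the
  \<open>2^(3j)\<close> frequencies of size \<open>2^j\<close>. The threshold is thus
  \<open>\<sigma> - 3/2\<close>, which is \<open>s - 1/2\<close> for \<open>u\<close> and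
  \<open>s - 3/2\<close> for \<open>v\<close>. Integer orders are excluded because inverting a
  dyadic difference there loses a logarithm. Smoothness is tested on a sequence because events of
  the product sigma-algebra involve only countably many points. The obstacle is that
  \<open>A\<close> contains \<open>v\<close> and is a priori no smoother. The travel time equation
  yields its regularity by a bootstrap: after linearization the errors are products of two factors
  of size \<open>2^(-j/2)\<close>, so each pass gains half a power. Rising trajectories keep both
  endpoints away from the turning point \<open>u = A\<close>, where \<open>a\<close> is singular,
  and give the terms of the derivative with respect to \<open>1 / A\<close> a common sign.\<close>

lemma antiderivative_real_line:
  fixes g :: "real \<Rightarrow> 'a::banach"
  assumes "continuous_on UNIV g"
  obtains G where "G 0 = 0" "\<And>\<tau>. (G has_vector_derivative g \<tau>) (at \<tau>)"
proof -
  \<comment> \<open>For \<open>\<tau> \<noteq> 0\<close> exactly one of the two integrals runs over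
    an empty interval and is 0.\<close>
  define G where "G \<tau> = integral {0..\<tau>} g - integral {\<tau>..0} g" for \<tau>
  have G0: "G 0 = 0" by (simp add: G_def)
  have "(G has_vector_derivative g \<tau>) (at \<tau>)" for \<tau> :: real
  proof -
    define n where "n = \<bar>\<tau>\<bar> + 1"
    have int: "g integrable_on {a..b}" for a b
      using assms by (intro integrable_continuous_real continuous_on_subset[OF assms]) auto
    have eq: "G x = integral {-n..x} g - integral {-n..0} g" if "x \<in> {-n<..<n}" for x
    proof (cases "x \<ge> 0")
      case True
      then have "integral {-n..0} g + integral {0..x} g = integral {-n..x} g"
        using that by (intro Henstock_Kurzweil_Integration.integral_combine int) auto
      moreover have "integral {x..0} g = 0"
        using True by (cases "x = 0") auto
      ultimately show ?thesis by (simp add: G_def algebra_simps)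
    next
      case False
      then have "integral {-n..x} g + integral {x..0} g = integral {-n..0} g"
        using that by (intro Henstock_Kurzweil_Integration.integral_combine int) auto
      then show ?thesis using False by (simp add: G_def algebra_simps)
    qed
    have "((\<lambda>u. integral {-n..u} g) has_vector_derivative g \<tau>) (at \<tau> within {-n..n})"
      by (rule integral_has_vector_derivative) (auto simp: n_def intro: continuous_on_subset[OF assms])
    then have "((\<lambda>u. integral {-n..u} g) has_vector_derivative g \<tau>) (at \<tau>)"
      by (subst (asm) at_within_interior) (auto simp: n_def)
    then have "((\<lambda>u. integral {-n..u} g - integral {-n..0} g) has_vector_derivative g \<tau>) (at \<tau>)"
      by (auto intro!: derivative_eq_intros)
    then show "(G has_vector_derivative g \<tau>) (at \<tau>)"
      by (rule has_vector_derivative_transform_within_open[of _ _ _ "{-n<..<n}"])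
        (auto simp: eq n_def)
  qed
  with G0 show thesis by (rule that)
qed

text \<open>Integrating \<open>K * exp (c * |\<tau>|)\<close> costs a factor \<open>1 / c\<close>;
  with \<open>c = 2 * L\<close> this beats the Lipschitz constant \<open>L\<close> and makes the
  Picard map contract by 1/2.\<close>

lemma norm_le_exp_if_vector_derivative_le_exp:
  fixes G :: "real \<Rightarrow> 'a::real_normed_vector"
  assumes "G 0 = 0" and D: "\<And>\<tau>. (G has_vector_derivative g \<tau>) (at \<tau>)"
    and b: "\<And>\<tau>. norm (g \<tau>) \<le> K * exp (c * \<bar>\<tau>\<bar>)" and c: "c > 0" and K: "K \<ge> 0"
  shows "norm (G \<tau>) \<le> K / c * exp (c * \<bar>\<tau>\<bar>)"
proof -
  have pos: "norm (H x) \<le> K / c * exp (c * x)"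
    if "x > 0" "H 0 = 0" "\<And>\<tau>. (H has_vector_derivative h \<tau>) (at \<tau>)"
      "\<And>\<tau>. norm (h \<tau>) \<le> K * exp (c * \<bar>\<tau>\<bar>)" for H :: "real \<Rightarrow> 'a" and h x
  proof -
    have "norm (H x - H 0) \<le> K / c * exp (c * x) - K / c * exp (c * 0)"
    proof (rule differentiable_bound_general[where \<phi>' = "\<lambda>x. K * exp (c * x)" and f' = h])
      show "continuous_on {0..x} H"
        using that(3) by (blast intro: continuous_on_vector_derivative has_vector_derivative_at_within)
      show "((\<lambda>x. K / c * exp (c * x)) has_vector_derivative K * exp (c * y)) (at y)" for y
        using c by (auto intro!: derivative_eq_intros simp: has_real_derivative_iff_has_vector_derivative[symmetric])
      show "norm (h y) \<le> K * exp (c * y)" if "0 < y" for y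
        using \<open>\<And>\<tau>. norm (h \<tau>) \<le> K * exp (c * \<bar>\<tau>\<bar>)\<close>[of y] that by simp
    qed (use that c in \<open>auto intro!: continuous_intros\<close>)
    also have "\<dots> \<le> K / c * exp (c * x)" using c K by simp
    finally show ?thesis using that by simp
  qed
  consider "\<tau> = 0" | "\<tau> > 0" | "\<tau> < 0" by linarith
  then show ?thesis
  proof cases
    case 1 then show ?thesis using assms by simp
  next
    case 2 then show ?thesis using pos[of \<tau> G g] assms by simp
  next
    case 3
    have "((\<lambda>x. G (- x)) has_vector_derivative - g (- x)) (at x)" for x
    proof -
      have "((G \<circ> uminus) has_vector_derivative (-1) *\<^sub>R g (- x)) (at x)"
        by (rule vector_diff_chain_at) (auto intro!: derivative_eq_intros D)
      then show ?thesis by (simp add: o_def)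
    qed
    then show ?thesis using pos[of "-\<tau>" "\<lambda>x. G (- x)" "\<lambda>x. - g (- x)"] 3 assms
      by (simp) (metis abs_minus_cancel)
  qed
qed

text \<open>In the norm weighted by \<open>exp (- 2 L |\<tau>|)\<close> the Picard map is a contraction on the whole
  real line, so one application of the fixed point theorem gives a global solution.\<close>

lemma lipschitz_ode_solution_exists:
  fixes f :: "'a::banach \<Rightarrow> 'a"
  assumes L: "L > 0" and lip: "\<And>x y. norm (f x - f y) \<le> L * norm (x - y)"
  shows "\<exists>\<phi>. \<phi> 0 = p \<and> (\<forall>\<tau>. (\<phi> has_vector_derivative f (\<phi> \<tau>)) (at \<tau>))"
proof -
  have contf: "continuous_on UNIV f"
  proof -
    have "L-lipschitz_on UNIV f"
      using lip L by (auto simp: lipschitz_on_def dist_norm)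
    then show ?thesis by (rule lipschitz_on_continuous_on)
  qed
  define e where "e \<tau> = exp (2 * L * \<bar>\<tau>\<bar>)" for \<tau> :: real
  have e_pos: "e \<tau> > 0" for \<tau> by (simp add: e_def)
  have e_ge1: "e \<tau> \<ge> 1" for \<tau> using L by (simp add: e_def)
  have conte: "continuous_on UNIV e" unfolding e_def by (intro continuous_intros)
  \<comment> \<open>The unknown is the bounded function \<open>\<psi> = \<phi> / e\<close>:
    \<open>g \<psi>\<close> is the field along the candidate \<open>e * \<psi>\<close>, and
    \<open>T \<psi>\<close> below is the Picard iterate divided by \<open>e\<close> again.\<close>
  define g where "g \<psi> \<tau> = f (e \<tau> *\<^sub>R apply_bcontfun \<psi> \<tau>)" for \<psi> :: "real \<Rightarrow>\<^sub>C 'a" and \<tau>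
  have contg: "continuous_on UNIV (g \<psi>)" for \<psi>
    unfolding g_def
    by (intro continuous_on_compose2[OF contf] continuous_intros conte
        continuous_on_apply_bcontfun) auto
  have "\<exists>G. G 0 = 0 \<and> (\<forall>\<tau>. (G has_vector_derivative g \<psi> \<tau>) (at \<tau>))" for \<psi>
    using antiderivative_real_line[OF contg] by blast
  then obtain G where G0: "\<And>\<psi>. G \<psi> 0 = 0"
    and GD: "\<And>\<psi> \<tau>. (G \<psi> has_vector_derivative g \<psi> \<tau>) (at \<tau>)"
    by metis
  have contG: "continuous_on UNIV (G \<psi>)" for \<psi>
    using GD by (blast intro: continuous_on_vector_derivative has_vector_derivative_at_within)
  define T where "T \<psi> \<tau> = (1 / e \<tau>) *\<^sub>R (p + G \<psi> \<tau>)" for \<psi> \<tau>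
  have gb: "norm (g \<psi> \<tau>) \<le> (norm (f 0) + L * norm \<psi>) * exp ((2 * L) * \<bar>\<tau>\<bar>)" for \<psi> \<tau>
  proof -
    have "norm (g \<psi> \<tau>) \<le> norm (f 0) + norm (g \<psi> \<tau> - f 0)" by norm
    also have "norm (g \<psi> \<tau> - f 0) \<le> L * (e \<tau> * norm (apply_bcontfun \<psi> \<tau>))"
      using lip[of "e \<tau> *\<^sub>R apply_bcontfun \<psi> \<tau>" 0] e_pos[of \<tau>] by (simp add: g_def)
    also have "\<dots> \<le> L * (e \<tau> * norm \<psi>)"
      using L e_pos[of \<tau>] by (intro mult_left_mono norm_bounded) auto
    also have "norm (f 0) + L * (e \<tau> * norm \<psi>) \<le> (norm (f 0) + L * norm \<psi>) * e \<tau>"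
      using e_ge1[of \<tau>] mult_left_mono[of 1 "e \<tau>" "norm (f 0)"] by (simp add: algebra_simps)
    finally show ?thesis by (simp add: e_def)
  qed
  have TB: "T \<psi> \<in> bcontfun" for \<psi>
  proof (rule bcontfun_normI)
    show "continuous_on UNIV (T \<psi>)"
      unfolding T_def using e_pos by (intro continuous_intros conte contG) (auto simp: less_le)
    fix \<tau>
    have "norm (G \<psi> \<tau>) \<le> (norm (f 0) + L * norm \<psi>) / (2 * L) * e \<tau>"
      unfolding e_def using L
      by (intro norm_le_exp_if_vector_derivative_le_exp[OF G0 GD gb]) (auto intro!: add_nonneg_nonneg)
    then have "norm (p + G \<psi> \<tau>) \<le> norm p * 1 + (norm (f 0) + L * norm \<psi>) / (2 * L) * e \<tau>"
      using norm_triangle_ineq[of p "G \<psi> \<tau>"] by linarith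
    also have "\<dots> \<le> norm p * e \<tau> + (norm (f 0) + L * norm \<psi>) / (2 * L) * e \<tau>"
      using e_ge1[of \<tau>] by (intro add_right_mono mult_left_mono) auto
    finally have "norm (p + G \<psi> \<tau>) \<le> (norm p + (norm (f 0) + L * norm \<psi>) / (2 * L)) * e \<tau>"
      by (simp only: distrib_right)
    moreover have "norm (T \<psi> \<tau>) = norm (p + G \<psi> \<tau>) / e \<tau>"
      using e_pos[of \<tau>] by (simp only: T_def norm_scaleR) simp
    ultimately show "norm (T \<psi> \<tau>) \<le> norm p + (norm (f 0) + L * norm \<psi>) / (2 * L)"
      using e_pos[of \<tau>] by (simp only: pos_divide_le_eq)
  qed
  define F where "F \<psi> = Bcontfun (T \<psi>)" for \<psi>
  have F_apply: "apply_bcontfun (F \<psi>) \<tau> = T \<psi> \<tau>" for \<psi> \<tau>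
    unfolding F_def using TB by (simp add: Bcontfun_inverse)
  have "\<exists>!\<psi>. F \<psi> = \<psi>"
  proof (rule banach_fix_type[of "1/2"]; (intro allI)?)
    fix \<psi> \<eta>
    show "dist (F \<psi>) (F \<eta>) \<le> 1 / 2 * dist \<psi> \<eta>"
    proof (rule dist_bound)
      fix \<tau>
      have "norm (G \<psi> \<tau> - G \<eta> \<tau>) \<le> L * dist \<psi> \<eta> / (2 * L) * exp ((2 * L) * \<bar>\<tau>\<bar>)"
      proof (rule norm_le_exp_if_vector_derivative_le_exp)
        show "((\<lambda>\<tau>. G \<psi> \<tau> - G \<eta> \<tau>) has_vector_derivative (g \<psi> \<tau> - g \<eta> \<tau>)) (at \<tau>)" for \<tau>
          by (intro derivative_intros GD)
        show "norm (g \<psi> \<tau> - g \<eta> \<tau>) \<le> L * dist \<psi> \<eta> * exp ((2 * L) * \<bar>\<tau>\<bar>)" for \<tau>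
        proof -
          have "norm (g \<psi> \<tau> - g \<eta> \<tau>) \<le> L * norm (e \<tau> *\<^sub>R apply_bcontfun \<psi> \<tau> - e \<tau> *\<^sub>R apply_bcontfun \<eta> \<tau>)"
            unfolding g_def by (rule lip)
          also have "\<dots> = L * (e \<tau> * dist (apply_bcontfun \<psi> \<tau>) (apply_bcontfun \<eta> \<tau>))"
            using e_pos[of \<tau>] by (simp add: dist_norm flip: scaleR_diff_right)
          also have "\<dots> \<le> L * (e \<tau> * dist \<psi> \<eta>)"
            using L e_pos[of \<tau>] by (intro mult_left_mono dist_bounded) auto
          finally show ?thesis by (simp add: e_def algebra_simps)
        qed
      qed (use L G0 in auto)
      then have "norm (G \<psi> \<tau> - G \<eta> \<tau>) \<le> dist \<psi> \<eta> / 2 * e \<tau>"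
        using L by (simp add: e_def)
      moreover have "dist (T \<psi> \<tau>) (T \<eta> \<tau>) = norm (G \<psi> \<tau> - G \<eta> \<tau>) / e \<tau>"
        using e_pos[of \<tau>] by (simp add: T_def dist_norm flip: scaleR_diff_right)
      ultimately show "dist (apply_bcontfun (F \<psi>) \<tau>) (apply_bcontfun (F \<eta>) \<tau>) \<le> 1 / 2 * dist \<psi> \<eta>"
        using e_pos[of \<tau>] by (simp add: F_apply pos_divide_le_eq)
    qed
  qed auto
  then obtain \<psi> where \<psi>: "F \<psi> = \<psi>" by blast
  define \<phi> where "\<phi> \<tau> = e \<tau> *\<^sub>R apply_bcontfun \<psi> \<tau>" for \<tau>
  have eq: "\<phi> = (\<lambda>\<tau>. p + G \<psi> \<tau>)"
  proof
    fix \<tau>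
    have "apply_bcontfun \<psi> \<tau> = T \<psi> \<tau>" using F_apply[of \<psi> \<tau>] \<psi> by simp
    then show "\<phi> \<tau> = p + G \<psi> \<tau>" using e_pos[of \<tau>] by (simp add: \<phi>_def T_def)
  qed
  have "(\<phi> has_vector_derivative f (\<phi> \<tau>)) (at \<tau>)" for \<tau>
  proof -
    have "(\<phi> has_vector_derivative g \<psi> \<tau>) (at \<tau>)"
      unfolding eq by (auto intro!: derivative_eq_intros GD)
    then show ?thesis by (simp add: g_def \<phi>_def)
  qed
  moreover have "\<phi> 0 = p" by (simp add: eq G0)
  ultimately show ?thesis by blast
qed

text \<open>The weighted squared distance \<open>exp (- 2 L \<tau>) * |\<phi> - \<psi>|^2\<close> is
  nonincreasing by Cauchy-Schwarz; squaring avoids differentiating the norm at 0.\<close>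

lemma lipschitz_ode_gronwall:
  fixes f :: "'a::real_inner \<Rightarrow> 'a"
  assumes lip: "\<And>x y. norm (f x - f y) \<le> L * norm (x - y)"
    and \<phi>: "\<And>\<tau>. (\<phi> has_vector_derivative f (\<phi> \<tau>)) (at \<tau>)"
    and \<psi>: "\<And>\<tau>. (\<psi> has_vector_derivative f (\<psi> \<tau>)) (at \<tau>)" and "\<tau> \<ge> 0"
  shows "norm (\<phi> \<tau> - \<psi> \<tau>) \<le> exp (L * \<tau>) * norm (\<phi> 0 - \<psi> 0)"
proof -
  define q where "q \<tau> = exp (- (2 * L) * \<tau>) * ((\<phi> \<tau> - \<psi> \<tau>) \<bullet> (\<phi> \<tau> - \<psi> \<tau>))" for \<tau>
  define q' where "q' \<tau> = exp (- (2 * L) * \<tau>) *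
      (2 * ((\<phi> \<tau> - \<psi> \<tau>) \<bullet> (f (\<phi> \<tau>) - f (\<psi> \<tau>))) - 2 * L * ((\<phi> \<tau> - \<psi> \<tau>) \<bullet> (\<phi> \<tau> - \<psi> \<tau>)))" for \<tau>
  have qd: "(q has_real_derivative q' \<tau>) (at \<tau>)" for \<tau>
  proof -
    have d: "((\<lambda>\<tau>. \<phi> \<tau> - \<psi> \<tau>) has_vector_derivative (f (\<phi> \<tau>) - f (\<psi> \<tau>))) (at \<tau>)"
      by (intro derivative_intros \<phi> \<psi>)
    have "((\<lambda>\<tau>. (\<phi> \<tau> - \<psi> \<tau>) \<bullet> (\<phi> \<tau> - \<psi> \<tau>)) has_real_derivative
        2 * ((\<phi> \<tau> - \<psi> \<tau>) \<bullet> (f (\<phi> \<tau>) - f (\<psi> \<tau>)))) (at \<tau>)"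
      using has_derivative_inner[OF d[unfolded has_vector_derivative_def] d[unfolded has_vector_derivative_def]]
      by (rule has_derivative_imp_has_field_derivative) (simp add: inner_commute algebra_simps)
    note I = this
    show ?thesis
      unfolding q_def q'_def
      by (rule DERIV_cong[OF DERIV_mult[OF _ I]], (rule derivative_intros)+, simp add: algebra_simps)
  qed
  have "q' \<tau> \<le> 0" for \<tau>
  proof -
    have "(\<phi> \<tau> - \<psi> \<tau>) \<bullet> (f (\<phi> \<tau>) - f (\<psi> \<tau>)) \<le> norm (\<phi> \<tau> - \<psi> \<tau>) * norm (f (\<phi> \<tau>) - f (\<psi> \<tau>))"
      by (rule norm_cauchy_schwarz)
    also have "\<dots> \<le> norm (\<phi> \<tau> - \<psi> \<tau>) * (L * norm (\<phi> \<tau> - \<psi> \<tau>))"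
      by (intro mult_left_mono lip) auto
    also have "\<dots> = L * ((\<phi> \<tau> - \<psi> \<tau>) \<bullet> (\<phi> \<tau> - \<psi> \<tau>))"
      by (simp add: power2_norm_eq_inner[symmetric] power2_eq_square)
    finally show ?thesis unfolding q'_def by (intro mult_nonneg_nonpos) auto
  qed
  with qd have "q \<tau> \<le> q 0"
    by (intro DERIV_nonpos_imp_nonincreasing[OF \<open>\<tau> \<ge> 0\<close>]) blast
  then have "(norm (\<phi> \<tau> - \<psi> \<tau>))\<^sup>2 \<le> (exp (L * \<tau>) * norm (\<phi> 0 - \<psi> 0))\<^sup>2"
    by (simp add: q_def power2_norm_eq_inner power_mult_distrib exp_minus field_simps
        exp_double[symmetric] power2_eq_square[symmetric])
  then show ?thesis by (rule power2_le_imp_le) auto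
qed


section \<open>Conserved energy and global well-posedness by truncation\<close>

definition energy :: "nat \<Rightarrow> real \<times> real \<Rightarrow> real" where
  "energy k p = fst p ^ (k + 1) + (real k + 1) / 2 * (snd p)\<^sup>2"

definition solves_ode :: "nat \<Rightarrow> (real \<Rightarrow> real \<times> real) \<Rightarrow> bool" where
  "solves_ode k \<phi> \<longleftrightarrow>
     (\<forall>\<tau>. (\<phi> has_vector_derivative (snd (\<phi> \<tau>), - ((fst (\<phi> \<tau>))^k))) (at \<tau>))"

text \<open>Clamping the position makes the field globally Lipschitz without changing it where
  \<open>|u| \<le> R\<close>; conservation of energy keeps solutions in that region if
  \<open>R ^ (k + 1)\<close> exceeds the energy.\<close>

definition cut_field :: "nat \<Rightarrow> real \<Rightarrow> real \<times> real \<Rightarrow> real \<times> real" where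
  "cut_field k R p = (snd p, - ((max (-R) (min R (fst p)))^k))"

lemma cut_field_eq: "\<bar>fst p\<bar> \<le> R \<Longrightarrow> cut_field k R p = (snd p, - ((fst p)^k))"
  by (auto simp: cut_field_def)

lemma cut_field_lipschitz:
  assumes "R > 0"
  shows "\<exists>L>0. \<forall>p q. norm (cut_field k R p - cut_field k R q) \<le> L * norm (p - q)"
proof -
  define c where "c x = max (-R) (min R x)" for x
  define B where "B = real k * R ^ (k - 1)"
  have B: "B \<ge> 0" using assms by (simp add: B_def)
  have c: "c x \<in> {-R..R}" for x using assms by (auto simp: c_def)
  have cc: "\<bar>c x - c y\<bar> \<le> \<bar>x - y\<bar>" for x y using assms unfolding c_def by linarith
  have pow: "\<bar>c x ^ k - c y ^ k\<bar> \<le> B * \<bar>x - y\<bar>" for x y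
  proof -
    have "norm (c x ^ k - c y ^ k) \<le> B * norm (c x - c y)"
    proof (rule field_differentiable_bound[of "{-R..R}" "\<lambda>x. x ^ k" "\<lambda>x. real k * x ^ (k - 1)"])
      show "norm (real k * z ^ (k - 1)) \<le> B" if "z \<in> {-R..R}" for z
        using that unfolding B_def
        by (auto simp: abs_mult power_abs intro!: mult_left_mono power_mono)
    qed (use c in \<open>auto intro!: derivative_eq_intros\<close>)
    also have "\<dots> \<le> B * \<bar>x - y\<bar>" using cc B by (intro mult_left_mono) auto
    finally show ?thesis by simp
  qed
  have "norm (cut_field k R p - cut_field k R q) \<le> (1 + B) * norm (p - q)" for p q
  proof -
    obtain a b where p: "p = (a, b)" by force
    obtain a' b' where q: "q = (a', b')" by force
    have "norm (cut_field k R p - cut_field k R q) = norm (b - b', c a' ^ k - c a ^ k)"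
      by (simp add: cut_field_def p q c_def)
    also have "\<dots> \<le> \<bar>b - b'\<bar> + \<bar>c a' ^ k - c a ^ k\<bar>"
      by (rule order_trans[OF norm_Pair_le]) auto
    also have "\<dots> \<le> norm (p - q) + B * norm (p - q)"
    proof (intro add_mono)
      show "\<bar>b - b'\<bar> \<le> norm (p - q)" using norm_snd_le[of "b - b'" "a - a'"] by (simp add: p q)
      have "\<bar>c a' ^ k - c a ^ k\<bar> \<le> B * \<bar>a' - a\<bar>" by (rule pow)
      also have "\<dots> \<le> B * norm (p - q)"
        using norm_fst_le[of "a - a'" "b - b'"] B by (intro mult_left_mono) (auto simp: p q)
      finally show "\<bar>c a' ^ k - c a ^ k\<bar> \<le> B * norm (p - q)" .
    qed
    finally show ?thesis by (simp add: algebra_simps)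
  qed
  then show ?thesis using B by (intro exI[of _ "1 + B"]) auto
qed

lemma fst_derivative: 
  assumes "(\<phi> has_vector_derivative (a, b)) F"
  shows "((\<lambda>\<tau>. fst (\<phi> \<tau>)) has_vector_derivative a) F"
  using bounded_linear.has_vector_derivative[OF bounded_linear_fst assms] by simp

lemma snd_derivative: 
  assumes "(\<phi> has_vector_derivative (a, b)) F"
  shows "((\<lambda>\<tau>. snd (\<phi> \<tau>)) has_vector_derivative b) F"
  using bounded_linear.has_vector_derivative[OF bounded_linear_snd assms] by simp

lemma energy_derivative:
  assumes "((\<phi> :: real \<Rightarrow> real \<times> real) has_vector_derivative (snd (\<phi> \<tau>), b)) (at \<tau>)"
  shows "((\<lambda>\<tau>. energy k (\<phi> \<tau>)) has_real_derivative (real k + 1) * snd (\<phi> \<tau>) * (fst (\<phi> \<tau>) ^ k + b)) (at \<tau>)"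
proof -
  have 1: "((\<lambda>\<tau>. fst (\<phi> \<tau>)) has_real_derivative snd (\<phi> \<tau>)) (at \<tau>)"
    using fst_derivative[OF assms] by (simp add: has_real_derivative_iff_has_vector_derivative)
  have 2: "((\<lambda>\<tau>. snd (\<phi> \<tau>)) has_real_derivative b) (at \<tau>)"
    using snd_derivative[OF assms] by (simp add: has_real_derivative_iff_has_vector_derivative)
  show ?thesis unfolding energy_def
    by (rule derivative_eq_intros 1 2 refl)+ (simp add: algebra_simps)
qed

lemma energy_conserved:
  assumes "solves_ode k \<phi>"
  shows "energy k (\<phi> \<tau>) = energy k (\<phi> 0)"
proof -
  have "((\<lambda>\<tau>. energy k (\<phi> \<tau>)) has_real_derivative 0) (at \<tau>)" for \<tau>
    using energy_derivative[of \<phi> \<tau> "- (fst (\<phi> \<tau>) ^ k)" k] assms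
    by (simp add: solves_ode_def)
  then show ?thesis by (metis DERIV_isconst_all)
qed

lemma abs_fst_less_if_energy_less:
  assumes "odd k" "energy k p < R ^ (k + 1)" "R > 0"
  shows "\<bar>fst p\<bar> < R"
proof -
  have "\<bar>fst p\<bar> ^ (k + 1) = fst p ^ (k + 1)" using assms by (intro power_even_abs) simp
  also have "\<dots> \<le> energy k p" by (simp add: energy_def)
  finally have "\<bar>fst p\<bar> ^ (k + 1) < R ^ (k + 1)" using assms by simp
  then show ?thesis using assms by (meson power_less_imp_less_base less_imp_le)
qed

lemma solves_ode_cut_field:
  assumes "odd k" "solves_ode k \<phi>" "energy k (\<phi> 0) < R ^ (k + 1)" "R > 0"
  shows "(\<phi> has_vector_derivative cut_field k R (\<phi> \<tau>)) (at \<tau>)"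
proof -
  have "\<bar>fst (\<phi> \<tau>)\<bar> < R"
    using energy_conserved[OF assms(2), of \<tau>] assms
    by (intro abs_fst_less_if_energy_less[OF assms(1)]) (simp_all only:)
  then show ?thesis using assms(2) by (simp add: cut_field_eq solves_ode_def)
qed

text \<open>The equation is invariant under reversing time and velocity together, so negative times
  reduce to positive ones.\<close>

lemma time_reversal_derivative:
  fixes \<phi> :: "real \<Rightarrow> real \<times> real"
  assumes "(\<phi> has_vector_derivative (a, b)) (at (- \<tau>))"
  shows "((\<lambda>\<tau>. (fst (\<phi> (- \<tau>)), - snd (\<phi> (- \<tau>)))) has_vector_derivative (- a, b)) (at \<tau>)"
proof -
  have "((\<phi> \<circ> uminus) has_vector_derivative (-1) *\<^sub>R (a, b)) (at \<tau>)"
    by (rule vector_diff_chain_at[where f = uminus]) (use assms in \<open>auto intro!: derivative_eq_intros\<close>)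
  then have "((\<phi> \<circ> uminus) has_vector_derivative (- a, - b)) (at \<tau>)" by simp
  note D = fst_derivative[OF this] snd_derivative[OF this]
  show ?thesis
    using has_vector_derivative_Pair[OF D(1) has_vector_derivative_minus[OF D(2)]] by (simp add: o_def)
qed

lemma solves_ode_reverse:
  assumes "solves_ode k \<phi>"
  shows "solves_ode k (\<lambda>\<tau>. (fst (\<phi> (-\<tau>)), - snd (\<phi> (-\<tau>))))"
  using time_reversal_derivative assms unfolding solves_ode_def by simp

text \<open>At the first time \<open>T\<close> with \<open>|u| \<ge> R\<close> the clamp has been
  inactive on \<open>[0, T)\<close>, so the energy is unchanged at \<open>T\<close> and still below
  \<open>R ^ (k + 1)\<close>. This forces \<open>|u| < R\<close> at \<open>T\<close>, a
  contradiction.\<close>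

lemma cut_field_solution_bounded:
  assumes k: "odd k" and \<phi>: "\<And>\<tau>. (\<phi> has_vector_derivative cut_field k R (\<phi> \<tau>)) (at \<tau>)"
    and E: "energy k (\<phi> 0) < R ^ (k + 1)" and R: "R > 0" and "\<tau> \<ge> 0"
  shows "\<bar>fst (\<phi> \<tau>)\<bar> < R"
proof (rule ccontr)
  assume "\<not> \<bar>fst (\<phi> \<tau>)\<bar> < R"
  define S where "S = {0..\<tau>} \<inter> (\<lambda>\<tau>. \<bar>fst (\<phi> \<tau>)\<bar>) -` {R..}"
  have cont: "continuous_on UNIV \<phi>"
    by (rule continuous_on_vector_derivative[OF has_vector_derivative_at_within[OF \<phi>]])
  have "closed S" unfolding S_def
    by (intro continuous_closed_preimage continuous_intros continuous_on_subset[OF cont]) auto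
  moreover have "\<tau> \<in> S" using \<open>\<not> \<bar>fst (\<phi> \<tau>)\<bar> < R\<close> \<open>\<tau> \<ge> 0\<close> by (auto simp: S_def)
  moreover have bdd: "bdd_below S" by (auto simp: S_def bdd_below_def)
  ultimately have T: "Inf S \<in> S" by (intro closed_contains_Inf) auto
  define T where "T = Inf S"
  have below: "\<bar>fst (\<phi> \<sigma>)\<bar> < R" if "0 \<le> \<sigma>" "\<sigma> < T" for \<sigma>
  proof (rule ccontr)
    assume "\<not> \<bar>fst (\<phi> \<sigma>)\<bar> < R"
    then have "\<sigma> \<in> S" using that T by (auto simp: S_def T_def)
    then show False using cInf_lower[OF _ bdd] that by (force simp: T_def)
  qed
  have "energy k (\<phi> T) = energy k (\<phi> 0)"
  proof (cases "T = 0")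
    case False
    then have "T > 0" using T by (auto simp: S_def T_def)
    have D: "((\<lambda>\<tau>. energy k (\<phi> \<tau>)) has_real_derivative
      (real k + 1) * snd (\<phi> \<sigma>) * (fst (\<phi> \<sigma>) ^ k - (max (-R) (min R (fst (\<phi> \<sigma>))))^k)) (at \<sigma>)" for \<sigma>
      using energy_derivative[of \<phi> \<sigma> "- ((max (-R) (min R (fst (\<phi> \<sigma>))))^k)" k] \<phi>[of \<sigma>]
      by (simp add: cut_field_def)
    have D0: "((\<lambda>\<tau>. energy k (\<phi> \<tau>)) has_real_derivative 0) (at \<sigma>)" if "0 < \<sigma>" "\<sigma> < T" for \<sigma>
      using D[of \<sigma>] below[of \<sigma>] that by (simp add: max_def min_def abs_less_iff)
    have "continuous_on {0..T} (\<lambda>\<tau>. energy k (\<phi> \<tau>))"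
      by (rule DERIV_continuous_on[OF has_field_derivative_at_within[OF D]])
    then show ?thesis
      by (rule DERIV_isconst2[OF \<open>T > 0\<close>]) (use D0 \<open>T > 0\<close> in auto)
  qed auto
  then have "\<bar>fst (\<phi> T)\<bar> < R" using E k R by (intro abs_fst_less_if_energy_less) auto
  then show False using T by (auto simp: S_def T_def)
qed

lemma energy_less_power: "\<exists>R>0. energy k p < R ^ (k + 1)"
proof (intro exI conjI)
  let ?R = "1 + \<bar>energy k p\<bar>"
  show "?R > 0" by simp
  have "energy k p < ?R ^ 1" by simp
  also have "\<dots> \<le> ?R ^ (k + 1)" by (rule power_increasing) auto
  finally show "energy k p < ?R ^ (k + 1)" .
qed

lemma solves_ode_forward_unique:
  assumes "odd k" "solves_ode k \<phi>" "solves_ode k \<psi>" "\<phi> 0 = \<psi> 0" "\<tau> \<ge> 0"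
  shows "\<phi> \<tau> = \<psi> \<tau>"
proof -
  obtain R where R: "R > 0" "energy k (\<phi> 0) < R ^ (k + 1)" using energy_less_power by blast
  obtain L where L: "\<And>p q. norm (cut_field k R p - cut_field k R q) \<le> L * norm (p - q)"
    using cut_field_lipschitz[OF R(1)] by blast
  have "norm (\<phi> \<tau> - \<psi> \<tau>) \<le> exp (L * \<tau>) * norm (\<phi> 0 - \<psi> 0)"
    using assms R by (intro lipschitz_ode_gronwall[OF L] solves_ode_cut_field) auto
  then show ?thesis using assms by simp
qed

lemma solves_ode_unique:
  assumes "odd k" "solves_ode k \<phi>" "solves_ode k \<psi>" "\<phi> 0 = \<psi> 0"
  shows "\<phi> = \<psi>"
proof
  fix \<tau>
  show "\<phi> \<tau> = \<psi> \<tau>"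
  proof (cases "\<tau> \<ge> 0")
    case True then show ?thesis by (rule solves_ode_forward_unique[OF assms])
  next
    case False
    then show ?thesis
      using solves_ode_forward_unique[OF assms(1) solves_ode_reverse[OF assms(2)]
        solves_ode_reverse[OF assms(3)], of "-\<tau>"] assms(4) by (simp add: prod_eq_iff)
  qed
qed

lemma solves_ode_exists:
  assumes "odd k"
  shows "\<exists>\<phi>. \<phi> 0 = p \<and> solves_ode k \<phi>"
proof -
  obtain R where R: "R > 0" "energy k p < R ^ (k + 1)" using energy_less_power by blast
  obtain L where L: "L > 0" "\<And>p q. norm (cut_field k R p - cut_field k R q) \<le> L * norm (p - q)"
    using cut_field_lipschitz[OF R(1)] by blast
  obtain \<phi> where \<phi>: "\<phi> 0 = p" "\<And>\<tau>. (\<phi> has_vector_derivative cut_field k R (\<phi> \<tau>)) (at \<tau>)"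
    using lipschitz_ode_solution_exists[OF L] by blast
  define \<psi> where "\<psi> \<tau> = (fst (\<phi> (-\<tau>)), - snd (\<phi> (-\<tau>)))" for \<tau>
  have \<psi>: "(\<psi> has_vector_derivative cut_field k R (\<psi> \<tau>)) (at \<tau>)" for \<tau>
    using time_reversal_derivative[OF \<phi>(2)[unfolded cut_field_def]]
    unfolding \<psi>_def by (simp add: cut_field_def)
  have bd: "\<bar>fst (\<phi> \<tau>)\<bar> < R" for \<tau>
  proof (cases "\<tau> \<ge> 0")
    case True then show ?thesis using R \<phi> assms by (intro cut_field_solution_bounded) auto
  next
    case False
    have "\<bar>fst (\<psi> (-\<tau>))\<bar> < R"
    proof (rule cut_field_solution_bounded[OF assms \<psi>])
      show "energy k (\<psi> 0) < R ^ (k + 1)" using R \<phi>(1) by (simp add: \<psi>_def energy_def)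
    qed (use R False in auto)
    then show ?thesis by (simp add: \<psi>_def)
  qed
  have "solves_ode k \<phi>" unfolding solves_ode_def
    using \<phi>(2) cut_field_eq[OF less_imp_le[OF bd]] by simp
  then show ?thesis using \<phi> by blast
qed

section \<open>The flow map and its dependence on the data\<close>

lemma ode_flow_properties:
  assumes "odd k"
  shows ode_flow_0: "ode_flow k p 0 = p" and ode_flow_solves: "solves_ode k (ode_flow k p)"
proof -
  \<comment> \<open>\<open>ode_flow\<close> is a \<open>THE\<close>, hence unspecified until
    existence and uniqueness are known.\<close>
  have "\<exists>!\<phi>. \<phi> 0 = p \<and> solves_ode k \<phi>"
    using solves_ode_exists[OF assms, of p] solves_ode_unique[OF assms] by (intro ex_ex1I) auto
  from theI'[OF this] show "ode_flow k p 0 = p" "solves_ode k (ode_flow k p)"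
    by (simp_all add: ode_flow_def solves_ode_def)
qed

lemma ode_flow_components:
  assumes "odd k"
  shows position_derivative: "((\<lambda>\<tau>. fst (ode_flow k p \<tau>)) has_real_derivative snd (ode_flow k p \<tau>)) (at \<tau>)"
    and velocity_derivative: "((\<lambda>\<tau>. snd (ode_flow k p \<tau>)) has_real_derivative - (fst (ode_flow k p \<tau>) ^ k)) (at \<tau>)"
  using ode_flow_solves[OF assms, of p] fst_derivative snd_derivative
  unfolding solves_ode_def has_real_derivative_iff_has_vector_derivative by blast+

text \<open>Below one energy level both trajectories solve the same truncated Lipschitz equation, so
  Gronwall applies with a common constant.\<close>

lemma ode_flow_lipschitz:
  assumes "odd k" "\<tau> \<ge> 0" "R > 0"
  shows "\<exists>L. \<forall>p q. energy k p < R ^ (k + 1) \<longrightarrow> energy k q < R ^ (k + 1) \<longrightarrow>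
    norm (ode_flow k p \<tau> - ode_flow k q \<tau>) \<le> L * norm (p - q)"
proof -
  obtain L where L: "\<And>p q. norm (cut_field k R p - cut_field k R q) \<le> L * norm (p - q)"
    using cut_field_lipschitz[OF assms(3)] by blast
  have "norm (ode_flow k p \<tau> - ode_flow k q \<tau>) \<le> exp (L * \<tau>) * norm (p - q)"
    if "energy k p < R ^ (k + 1)" "energy k q < R ^ (k + 1)" for p q
    using lipschitz_ode_gronwall[OF L solves_ode_cut_field[OF assms(1) ode_flow_solves[OF assms(1)]]
        solves_ode_cut_field[OF assms(1) ode_flow_solves[OF assms(1)]] assms(2), of p q]
      ode_flow_0[OF assms(1)] that assms(3) by (simp only:)
  then show ?thesis by blast
qed

lemma continuous_on_energy: "continuous_on UNIV (energy k)"
  unfolding energy_def by (intro continuous_intros)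

text \<open>Serves twice: it gives continuity, hence measurability of the pair at time
  \<open>t\<close>, and it carries the order 1/2 from the data to the later position.\<close>

lemma ode_flow_locally_lipschitz:
  assumes "odd k" "\<tau> \<ge> 0"
  shows "\<exists>L. \<forall>\<^sub>F p in nhds q. norm (ode_flow k p \<tau> - ode_flow k q \<tau>) \<le> L * norm (p - q)"
proof -
  obtain R where R: "R > 0" "energy k q < R ^ (k + 1)" using energy_less_power by blast
  obtain L where L: "\<And>p. energy k p < R ^ (k + 1) \<Longrightarrow>
      norm (ode_flow k p \<tau> - ode_flow k q \<tau>) \<le> L * norm (p - q)"
    using ode_flow_lipschitz[OF assms R(1)] R by blast
  have "open (energy k -` {..< R ^ (k + 1)})"
    using continuous_on_energy by (intro open_vimage) auto
  then have "\<forall>\<^sub>F p in nhds q. energy k p < R ^ (k + 1)"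
    using R by (intro eventually_nhds[THEN iffD2]) (auto intro!: exI[of _ "energy k -` {..< R ^ (k + 1)}"])
  then show ?thesis using L by (intro exI[of _ L]) (auto elim: eventually_mono)
qed

lemma continuous_on_ode_flow:
  assumes "odd k" "\<tau> \<ge> 0"
  shows "continuous_on UNIV (\<lambda>p. ode_flow k p \<tau>)"
  unfolding continuous_on_eq_continuous_at[OF open_UNIV]
proof
  fix q
  obtain L where L: "\<forall>\<^sub>F p in nhds q. norm (ode_flow k p \<tau> - ode_flow k q \<tau>) \<le> L * norm (p - q)"
    using ode_flow_locally_lipschitz[OF assms] by blast
  have "((\<lambda>p. ode_flow k p \<tau> - ode_flow k q \<tau>) \<longlongrightarrow> 0) (at q)"
  proof (rule Lim_null_comparison)
    show "\<forall>\<^sub>F p in at q. norm (ode_flow k p \<tau> - ode_flow k q \<tau>) \<le> L * norm (p - q)"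
      using L by (simp add: eventually_at_filter eventually_mono)
    show "((\<lambda>p. L * norm (p - q)) \<longlongrightarrow> 0) (at q)"
      by (rule tendsto_eq_intros refl | simp)+
  qed
  then show "isCont (\<lambda>p. ode_flow k p \<tau>) q"
    unfolding isCont_def by (simp add: LIM_zero_iff)
qed

section \<open>Sequences that are polynomial up to a fractional power\<close>

definition dy :: "nat \<Rightarrow> real" where "dy j = (1 / 2) ^ j"

lemma dy_pos [simp]: "dy j > 0" by (simp add: dy_def)
lemma dy_nonzero [simp]: "dy j \<noteq> 0" by (simp add: dy_def)
lemma dy_le_1: "dy j \<le> 1" by (simp add: dy_def power_le_one)
lemma dy_add: "dy (j + i) = dy j * dy i" by (simp add: dy_def power_add)

lemma dy_tendsto_0: "dy \<longlonglongrightarrow> 0"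
  unfolding dy_def by (rule LIMSEQ_power_zero) simp

abbreviation ody :: "real \<Rightarrow> (nat \<Rightarrow> real) set" where
  "ody \<theta> \<equiv> O(\<lambda>j. dy j powr \<theta>)"

lemma dy_powr_bigo: "a \<le> b \<Longrightarrow> (\<lambda>j. dy j powr b) \<in> ody a"
  by (intro bigoI[of _ 1] always_eventually allI) (auto intro!: powr_mono' simp: dy_le_1 less_imp_le)

lemma dy_powr_bigo_trans: "f \<in> ody b \<Longrightarrow> a \<le> b \<Longrightarrow> f \<in> ody a"
  using dy_powr_bigo landau_o.big_trans by blast

lemma poly_dy_bounded: "(\<lambda>j. poly P (dy j)) \<in> O(\<lambda>_. 1)"
proof (induction P)
  case (pCons a P)
  have "dy \<in> O(\<lambda>_. 1)" by (intro bigoI[of _ 1]) (simp add: dy_le_1 less_imp_le)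
  then show ?case using landau_o.big.mult[OF _ pCons(2), of dy "\<lambda>_. 1"]
    by (auto intro!: sum_in_bigo)
qed auto

text \<open>A dyadic substitute for Hoelder regularity at 0. The degree of \<open>P\<close> is left
  free, since monomials of degree at least \<open>\<beta>\<close> are absorbed in the error.\<close>

definition polyasym :: "real \<Rightarrow> (nat \<Rightarrow> real) \<Rightarrow> bool" where
  "polyasym \<beta> w \<longleftrightarrow> (\<exists>P. (\<lambda>j. w j - poly P (dy j)) \<in> ody \<beta>)"

lemma polyasym_bigo: "w \<in> ody \<beta> \<Longrightarrow> polyasym \<beta> w"
  unfolding polyasym_def by (intro exI[of _ 0]) simp

lemma polyasym_const: "polyasym \<beta> (\<lambda>_. c)"
  unfolding polyasym_def by (intro exI[of _ "[:c:]"]) simp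

lemma polyasym_mono: "polyasym \<beta> w \<Longrightarrow> \<gamma> \<le> \<beta> \<Longrightarrow> polyasym \<gamma> w"
  unfolding polyasym_def using dy_powr_bigo_trans by blast

lemma polyasym_add:
  assumes "polyasym \<beta> w" "polyasym \<beta> w'" shows "polyasym \<beta> (\<lambda>j. w j + w' j)"
proof -
  obtain P Q where "(\<lambda>j. w j - poly P (dy j)) \<in> ody \<beta>"
      "(\<lambda>j. w' j - poly Q (dy j)) \<in> ody \<beta>"
    using assms unfolding polyasym_def by blast
  from sum_in_bigo(1)[OF this] show ?thesis
    unfolding polyasym_def by (intro exI[of _ "P + Q"]) (simp add: algebra_simps)
qed

lemma polyasym_cmult:
  assumes "polyasym \<beta> w" shows "polyasym \<beta> (\<lambda>j. c * w j)"
proof -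
  obtain P where P: "(\<lambda>j. w j - poly P (dy j)) \<in> ody \<beta>"
    using assms unfolding polyasym_def by blast
  have "(\<lambda>j. c * (w j - poly P (dy j))) \<in> ody \<beta>"
    using P by (cases "c = 0") auto
  then show ?thesis
    unfolding polyasym_def by (intro exI[of _ "smult c P"]) (simp add: algebra_simps)
qed

lemma polyasym_diff:
  "polyasym \<beta> w \<Longrightarrow> polyasym \<beta> w' \<Longrightarrow> polyasym \<beta> (\<lambda>j. w j - w' j)"
  using polyasym_add[of \<beta> w "\<lambda>j. (-1) * w' j"] polyasym_cmult[of \<beta> w' "-1"] by simp

lemma polyasym_cong:
  assumes "eventually (\<lambda>j. w j = w' j) sequentially" "polyasym \<beta> w"
  shows "polyasym \<beta> w'"
proof -
  obtain P where P: "(\<lambda>j. w j - poly P (dy j)) \<in> ody \<beta>"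
    using assms unfolding polyasym_def by blast
  have "(\<lambda>j. w' j - poly P (dy j)) \<in> ody \<beta>"
    by (rule landau_o.big.in_cong[THEN iffD1, OF _ P]) (use assms in \<open>auto elim: eventually_mono\<close>)
  then show ?thesis unfolding polyasym_def by blast
qed

lemma polyasym_bounded:
  assumes "polyasym \<beta> w" "\<beta> \<ge> 0" shows "w \<in> O(\<lambda>_. 1)"
proof -
  obtain P where P: "(\<lambda>j. w j - poly P (dy j)) \<in> ody \<beta>"
    using assms unfolding polyasym_def by blast
  then have "(\<lambda>j. w j - poly P (dy j)) \<in> O(\<lambda>_. 1)"
    using dy_powr_bigo_trans[OF P assms(2)] by simp
  from sum_in_bigo(1)[OF this poly_dy_bounded[of P]] show ?thesis by simp
qed

lemma polyasym_mult:
  assumes "polyasym \<beta> w" "polyasym \<beta> w'" "\<beta> \<ge> 0" shows "polyasym \<beta> (\<lambda>j. w j * w' j)"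
proof -
  obtain P Q where P: "(\<lambda>j. w j - poly P (dy j)) \<in> ody \<beta>"
      and Q: "(\<lambda>j. w' j - poly Q (dy j)) \<in> ody \<beta>"
    using assms unfolding polyasym_def by blast
  have "(\<lambda>j. (w j - poly P (dy j)) * w' j + poly P (dy j) * (w' j - poly Q (dy j))) \<in> ody \<beta>"
    using landau_o.big.mult[OF P polyasym_bounded[OF assms(2,3)]]
      landau_o.big.mult[OF poly_dy_bounded[of P] Q]
    by (intro sum_in_bigo) auto
  then show ?thesis
    unfolding polyasym_def by (intro exI[of _ "P * Q"]) (simp add: algebra_simps)
qed

lemma polyasym_power:
  "polyasym \<beta> w \<Longrightarrow> \<beta> \<ge> 0 \<Longrightarrow> polyasym \<beta> (\<lambda>j. w j ^ n)"
  by (induction n) (auto intro: polyasym_const polyasym_mult)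

lemma polyasym_poly:
  "polyasym \<beta> w \<Longrightarrow> \<beta> \<ge> 0 \<Longrightarrow> polyasym \<beta> (\<lambda>j. poly T (w j))"
  by (induction T) (auto intro!: polyasym_const polyasym_mult polyasym_add)

text \<open>In \<open>w w' - P Q = (w - P) w' + P (w' - Q)\<close> each error of order
  \<open>\<beta>\<close> meets a factor of order 1/2; \<open>P\<close> has that order because
  \<open>w\<close> does and \<open>\<beta> \<ge> 1/2\<close>.\<close>

lemma polyasym_mult_gain:
  assumes "polyasym \<beta> w" "polyasym \<beta> w'" "\<beta> \<ge> 1/2"
    and w: "w \<in> ody (1/2)" and w': "w' \<in> ody (1/2)"
  shows "polyasym (\<beta> + 1/2) (\<lambda>j. w j * w' j)"
proof -
  obtain P Q where P: "(\<lambda>j. w j - poly P (dy j)) \<in> ody \<beta>"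
      and Q: "(\<lambda>j. w' j - poly Q (dy j)) \<in> ody \<beta>"
    using assms unfolding polyasym_def by blast
  have "(\<lambda>j. w j - (w j - poly P (dy j))) \<in> ody (1/2)"
    by (rule sum_in_bigo(2)[OF w dy_powr_bigo_trans[OF P assms(3)]])
  then have P': "(\<lambda>j. poly P (dy j)) \<in> ody (1/2)" by simp
  have "(\<lambda>j. (w j - poly P (dy j)) * w' j + poly P (dy j) * (w' j - poly Q (dy j))) \<in> ody (\<beta> + 1/2)"
    using landau_o.big.mult[OF P w'] landau_o.big.mult[OF P' Q]
    by (intro sum_in_bigo) (auto simp: powr_add mult_ac)
  then show ?thesis
    unfolding polyasym_def by (intro exI[of _ "P * Q"]) (simp add: algebra_simps)
qed

section \<open>Taylor expansions and composition with smooth functions\<close>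

definition tay :: "nat \<Rightarrow> (real \<Rightarrow> real) \<Rightarrow> real \<Rightarrow> bool" where
  "tay K f x \<longleftrightarrow> (\<exists>T. (\<lambda>y. f y - poly T (y - x)) \<in> O[nhds x](\<lambda>y. (y - x) ^ K))"


lemma tay_0_if_isCont:
  assumes "isCont f x" shows "tay 0 f x"
proof -
  have "(f \<longlongrightarrow> f x) (nhds x)" using assms by (simp add: isCont_def tendsto_at_iff_tendsto_nhds)
  then have "f \<in> O[nhds x](\<lambda>_. 1)" by (intro bigoI_tendsto[where c = "f x"]) auto
  then show ?thesis unfolding tay_def by (intro exI[of _ 0]) simp
qed

lemma tay_cmult:
  assumes "tay K f x" shows "tay K (\<lambda>y. c * f y) x"
proof -
  obtain T where T: "(\<lambda>y. f y - poly T (y - x)) \<in> O[nhds x](\<lambda>y. (y - x) ^ K)"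
    using assms unfolding tay_def by blast
  have "(\<lambda>y. c * (f y - poly T (y - x))) \<in> O[nhds x](\<lambda>y. (y - x) ^ K)"
    using T by (cases "c = 0") auto
  then show ?thesis
    unfolding tay_def by (intro exI[of _ "smult c T"]) (simp add: algebra_simps)
qed

lemma poly_antiderivative_exists: "\<exists>S::real poly. pderiv S = T"
proof
  show "pderiv (\<Sum>i\<le>degree T. monom (coeff T i / real (Suc i)) (Suc i)) = T"
    by (rule poly_eqI) 
      (auto simp: coeff_pderiv coeff_sum if_distrib sum.delta coeff_eq_0 not_le cong: if_cong)
qed

text \<open>Each integration raises the order by one, so expansions of all orders follow by
  induction without speaking of higher derivatives.\<close>

lemma tay_antiderivative:
  assumes D: "\<forall>\<^sub>F y in nhds x. (f has_real_derivative g y) (at y)" and "tay K g x"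
  shows "tay (Suc K) f x"
proof -
  obtain T where T: "(\<lambda>y. g y - poly T (y - x)) \<in> O[nhds x](\<lambda>y. (y - x) ^ K)"
    using assms unfolding tay_def by blast
  obtain C where C: "C > 0" "\<forall>\<^sub>F y in nhds x. norm (g y - poly T (y - x)) \<le> C * norm ((y - x) ^ K)"
    using landau_o.bigE[OF T] by blast
  obtain S0 where S0: "pderiv S0 = T" using poly_antiderivative_exists by blast
  \<comment> \<open>The constant makes the remainder vanish at \<open>x\<close>, so the mean value
    bound on the ball of radius \<open>|y - x|\<close> supplies the extra factor.\<close>
  define S where "S = S0 + [:f x - poly S0 0:]"
  have S: "pderiv S = T" "poly S 0 = f x" by (auto simp: S_def S0 pderiv_add pderiv_pCons)
  from eventually_conj[OF D C(2)] obtain d where d: "d > 0" 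
    "\<And>y. dist y x < d \<Longrightarrow> (f has_real_derivative g y) (at y) \<and> norm (g y - poly T (y - x)) \<le> C * norm ((y - x) ^ K)"
    unfolding eventually_nhds_metric by blast
  have "norm (f y - poly S (y - x)) \<le> C * norm ((y - x) ^ Suc K)" if y: "dist y x < d" for y
  proof -
    let ?r = "\<lambda>y. f y - poly S (y - x)"
    have "norm (?r y - ?r x) \<le> (C * \<bar>y - x\<bar> ^ K) * norm (y - x)"
    proof (rule field_differentiable_bound[where S = "cball x \<bar>y - x\<bar>" and f' = "\<lambda>z. g z - poly T (z - x)"])
      fix z assume z: "z \<in> cball x \<bar>y - x\<bar>"
      then have zd: "dist z x < d" "\<bar>z - x\<bar> \<le> \<bar>y - x\<bar>" using y by (auto simp: dist_real_def)
      have "(f has_real_derivative g z) (at z)" using d(2)[OF zd(1)] by simp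
      then have "(?r has_real_derivative g z - poly (pderiv S) (z - x) * 1) (at z)"
        by (rule DERIV_diff, intro DERIV_chain2[OF poly_DERIV]) (auto intro!: derivative_eq_intros)
      then show "(?r has_real_derivative g z - poly T (z - x)) (at z within cball x \<bar>y - x\<bar>)"
        by (simp add: S has_field_derivative_at_within)
      have "norm (g z - poly T (z - x)) \<le> C * \<bar>z - x\<bar> ^ K" using d(2)[OF zd(1)] by (simp add: power_abs)
      also have "\<dots> \<le> C * \<bar>y - x\<bar> ^ K" using zd C by (intro mult_left_mono power_mono) auto
      finally show "norm (g z - poly T (z - x)) \<le> C * \<bar>y - x\<bar> ^ K" .
    qed (auto simp: dist_real_def)
    then show ?thesis by (simp add: S power_abs abs_mult mult_ac)
  qed
  then have "(\<lambda>y. f y - poly S (y - x)) \<in> O[nhds x](\<lambda>y. (y - x) ^ Suc K)"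
    using d(1) by (intro bigoI[of _ C]) (auto simp: eventually_nhds_metric)
  then show ?thesis unfolding tay_def by blast
qed

text \<open>The exponent varies in the induction because the derivative of a power is a multiple of
  the power with exponent \<open>r - 1\<close>.\<close>

lemma tay_powr: "x > 0 \<Longrightarrow> tay K (\<lambda>y. y powr r) x"
proof (induction K arbitrary: r)
  case 0 then show ?case by (intro tay_0_if_isCont) (auto intro!: continuous_intros)
next
  case (Suc K)
  have "\<forall>\<^sub>F y in nhds x. ((\<lambda>y. y powr r) has_real_derivative r * y powr (r - 1)) (at y)"
    using eventually_nhds_in_open[of "{0<..}" x] Suc.prems
    by (auto elim!: eventually_mono intro!: has_real_derivative_powr)
  then show ?case by (rule tay_antiderivative) (intro tay_cmult Suc.IH Suc.prems)
qed

lemma isCont_poly_real: "isCont (poly p) x" for p :: "real poly"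
  by (rule DERIV_isCont[OF poly_DERIV])

text \<open>\<open>p y - p x\<close> has the factor \<open>y - x\<close>, so an error in powers of
  the former is one in powers of the latter.\<close>

lemma tay_compose_poly:
  assumes "tay K f (poly p x)" shows "tay K (\<lambda>y. f (poly p y)) x"
proof -
  obtain T where T: "(\<lambda>y. f y - poly T (y - poly p x)) \<in> O[nhds (poly p x)](\<lambda>y. (y - poly p x) ^ K)"
    using assms unfolding tay_def by blast
  have lim: "filterlim (poly p) (nhds (poly p x)) (nhds x)"
    using isCont_poly_real[of x p] by (simp add: isCont_def tendsto_at_iff_tendsto_nhds)
  have 1: "(\<lambda>y. f (poly p y) - poly T (poly p y - poly p x)) \<in> O[nhds x](\<lambda>y. (poly p y - poly p x) ^ K)"
    using landau_o.big.compose[OF T lim] .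
  obtain q where q: "p - [:poly p x:] = [:- x, 1:] * q"
    using poly_eq_0_iff_dvd[of "p - [:poly p x:]" x] by (auto elim: dvdE)
  have pq: "poly p y - poly p x = (y - x) * poly q y" for y
    using arg_cong[OF q, of "\<lambda>p. poly p y"] by (simp add: algebra_simps)
  have "poly q \<in> O[nhds x](\<lambda>_. 1)"
    using isCont_poly_real[of x q]
    by (intro bigoI_tendsto[where c = "poly q x"]) (auto simp: isCont_def tendsto_at_iff_tendsto_nhds)
  then have "(\<lambda>y. (y - x) * poly q y) \<in> O[nhds x](\<lambda>y. (y - x) * 1)"
    by (intro landau_o.big.mult) auto
  then have 2: "(\<lambda>y. (poly p y - poly p x) ^ K) \<in> O[nhds x](\<lambda>y. (y - x) ^ K)"
    unfolding pq by (intro landau_o.big_power) simp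
  define S where "S = pcompose T (pcompose p [:x, 1:] - [:poly p x:])"
  have "poly S (y - x) = poly T (poly p y - poly p x)" for y
    by (simp add: S_def poly_pcompose)
  then show ?thesis unfolding tay_def using landau_o.big_trans[OF 1 2] by (intro exI[of _ S]) simp
qed

text \<open>Along a sequence within \<open>O (2^(-j/2))\<close> of \<open>x\<close> each Taylor
  order is worth half a power of \<open>2^-j\<close>. The first two coefficients are identified for
  the linearization below.\<close>

lemma tay_seq:
  assumes "tay K f x" and lim: "w \<longlonglongrightarrow> x" and w: "(\<lambda>j. w j - x) \<in> ody (1/2)"
  obtains T where "(\<lambda>j. f (w j) - poly T (w j - x)) \<in> ody (real K / 2)"
    "K \<ge> 2 \<Longrightarrow> (f has_real_derivative coeff T 1) (at x)" "K \<ge> 1 \<Longrightarrow> coeff T 0 = f x"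
proof -
  obtain T where T: "(\<lambda>y. f y - poly T (y - x)) \<in> O[nhds x](\<lambda>y. (y - x) ^ K)"
    using assms unfolding tay_def by blast
  have 1: "(\<lambda>j. f (w j) - poly T (w j - x)) \<in> O(\<lambda>j. (w j - x) ^ K)"
    using landau_o.big.compose[OF T lim] .
  have "(\<lambda>j. (w j - x) ^ K) \<in> O(\<lambda>j. (dy j powr (1/2)) ^ K)"
    by (intro landau_o.big_power w)
  also have "(\<lambda>j. (dy j powr (1/2)) ^ K) = (\<lambda>j. dy j powr (real K / 2))"
    by (simp add: powr_powr flip: powr_realpow)
  finally have 2: "(\<lambda>j. f (w j) - poly T (w j - x)) \<in> ody (real K / 2)"
    using landau_o.big_trans[OF 1] by simp
  obtain C where C: "C > 0" "\<forall>\<^sub>F y in nhds x. norm (f y - poly T (y - x)) \<le> C * norm ((y - x) ^ K)"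
    using landau_o.bigE[OF T] by blast
  \<comment> \<open>\<open>nhds x\<close> includes the point \<open>x\<close> itself, where the
    bound is 0 for \<open>K \<ge> 1\<close>.\<close>
  have c0: "coeff T 0 = f x" if "K \<ge> 1"
    using eventually_nhds_x_imp_x[OF C(2)] that by (simp add: poly_0_coeff_0 power_0_left)
  have c1: "(f has_real_derivative coeff T 1) (at x)" if "K \<ge> 2"
  proof -
    \<comment> \<open>For \<open>K \<ge> 2\<close> the remainder is at most quadratic near
      \<open>x\<close>, so its derivative there is 0.\<close>
    define r where "r y = f y - poly T (y - x)" for y
    have r0: "r x = 0" using c0 that by (simp add: r_def poly_0_coeff_0)
    have "(\<lambda>y. (r y - r x) / (y - x)) \<midarrow>x\<rightarrow> 0"
    proof (rule Lim_null_comparison)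
      have "\<forall>\<^sub>F y in nhds x. dist y x < 1" unfolding eventually_nhds_metric by (intro exI[of _ 1]) simp
      from eventually_conj[OF C(2) this]
      have "\<forall>\<^sub>F y in nhds x. y \<noteq> x \<longrightarrow> norm ((r y - r x) / (y - x)) \<le> C * norm (y - x)"
      proof (rule eventually_mono, safe)
        fix y assume y: "norm (f y - poly T (y - x)) \<le> C * norm ((y - x) ^ K)" "dist y x < 1" "y \<noteq> x"
        have "\<bar>y - x\<bar> ^ K \<le> \<bar>y - x\<bar> ^ 2"
          using y that by (intro power_decreasing) (auto simp: dist_real_def)
        then have "C * norm ((y - x) ^ K) \<le> C * (\<bar>y - x\<bar> ^ 2)"
          using C(1) by (simp add: power_abs)
        then have "\<bar>r y\<bar> \<le> C * \<bar>y - x\<bar> * \<bar>y - x\<bar>" using y(1) by (simp add: r_def power2_eq_square)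
        then show "norm ((r y - r x) / (y - x)) \<le> C * norm (y - x)"
          using y(3) r0 by (simp add: field_simps)
      qed
      then show "\<forall>\<^sub>F y in at x. norm ((r y - r x) / (y - x)) \<le> C * norm (y - x)"
        by (simp add: eventually_at_filter)
      show "((\<lambda>y. C * norm (y - x)) \<longlongrightarrow> 0) (at x)" by (rule tendsto_eq_intros refl | simp)+
    qed
    then have "(r has_real_derivative 0) (at x)" by (simp add: has_field_derivative_iff)
    moreover have "((\<lambda>y. poly T (y - x)) has_real_derivative poly (pderiv T) (x - x) * 1) (at x)"
      by (rule DERIV_chain2[OF poly_DERIV]) (auto intro!: derivative_eq_intros)
    ultimately have "((\<lambda>y. r y + poly T (y - x)) has_real_derivative 0 + poly (pderiv T) (x - x) * 1) (at x)"
      by (rule DERIV_add)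
    then show ?thesis by (simp add: r_def poly_0_coeff_0 coeff_pderiv)
  qed
  show thesis using that[OF 2 c1 c0] by blast
qed

lemma bigo_half_tendsto:
  assumes "(\<lambda>j. w j - x) \<in> ody (1/2)" shows "w \<longlonglongrightarrow> x"
proof -
  obtain C where C: "C > 0" "\<forall>\<^sub>F j in sequentially. norm (w j - x) \<le> C * norm (dy j powr (1/2))"
    using landau_o.bigE[OF assms] by blast
  have "(\<lambda>j. w j - x) \<longlonglongrightarrow> 0"
  proof (rule Lim_null_comparison[OF C(2)])
    have "(\<lambda>j. C * (dy j powr (1/2))) \<longlonglongrightarrow> C * (0 powr (1/2))"
      by (intro tendsto_intros dy_tendsto_0) (auto simp: less_imp_le)
    then show "(\<lambda>j. C * norm (dy j powr (1/2))) \<longlonglongrightarrow> 0" by simp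
  qed
  then show ?thesis by (simp add: LIM_zero_iff)
qed

lemma polyasym_compose:
  assumes "\<And>K. tay K f x" and w: "(\<lambda>j. w j - x) \<in> ody (1/2)"
    and "polyasym \<beta> w" "\<beta> \<ge> 0"
  shows "polyasym \<beta> (\<lambda>j. f (w j))"
proof -
  \<comment> \<open>At half a power per Taylor order, order \<open>2 * \<beta>\<close> makes the
    Taylor error negligible.\<close>
  define K where "K = nat \<lceil>2 * \<beta>\<rceil>"
  have K: "\<beta> \<le> real K / 2" unfolding K_def by linarith
  obtain T where T: "(\<lambda>j. f (w j) - poly T (w j - x)) \<in> ody (real K / 2)"
    using tay_seq[OF assms(1) bigo_half_tendsto[OF w] w] by blast
  have "polyasym \<beta> (\<lambda>j. (f (w j) - poly T (w j - x)) + poly T (w j - x))"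
    by (rule polyasym_add[OF polyasym_bigo[OF dy_powr_bigo_trans[OF T K]]])
      (intro polyasym_poly polyasym_diff polyasym_const assms)
  then show ?thesis by simp
qed

lemma bigo_half_mult:
  assumes "w \<in> ody (1/2)" "w' \<in> O(\<lambda>_. 1)"
  shows "(\<lambda>j. w j * w' j) \<in> ody (1/2)"
  using landau_o.big.mult[OF assms] by simp

lemma bigo_half_bounded:
  assumes "(\<lambda>j. w j - x) \<in> ody (1/2)" shows "w \<in> O(\<lambda>_. 1)"
  using bigo_half_tendsto[OF assms] by (intro bigoI_tendsto[where c = x]) auto

text \<open>Beyond its affine part the Taylor polynomial has the form
  \<open>(w - x) * ((w - x) * T2)\<close>, a product of two factors of order 1/2, so
  \<open>polyasym_mult_gain\<close> applies.\<close>

lemma polyasym_compose_gain: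
  assumes f: "\<And>K. tay K f x" "(f has_real_derivative d) (at x)"
    and w: "(\<lambda>j. w j - x) \<in> ody (1/2)"
    and \<beta>: "polyasym \<beta> w" "\<beta> \<ge> 1/2"
  shows "polyasym (\<beta> + 1/2) (\<lambda>j. f (w j) - d * (w j - x))"
proof -
  define K where "K = nat \<lceil>2 * \<beta> + 2\<rceil>"
  have K: "\<beta> + 1/2 \<le> real K / 2" "K \<ge> 2" unfolding K_def using \<beta>(2) by linarith+
  obtain T where T: "(\<lambda>j. f (w j) - poly T (w j - x)) \<in> ody (real K / 2)"
    "(f has_real_derivative coeff T 1) (at x)"
    using tay_seq[OF f(1) bigo_half_tendsto[OF w] w, of K] K by blast
  have d: "coeff T 1 = d" using T(2) f(2) by (rule DERIV_unique)
  obtain a T1 where T1: "T = pCons a T1" by (cases T)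
  obtain b T2 where T2: "T1 = pCons b T2" by (cases T1)
  have b: "b = d" using d by (simp add: T1 T2)
  have pw: "polyasym \<beta> (\<lambda>j. w j - x)" using \<beta> by (intro polyasym_diff polyasym_const)
  have "polyasym (\<beta> + 1/2) (\<lambda>j. (w j - x) * ((w j - x) * poly T2 (w j - x)))"
  proof (rule polyasym_mult_gain[OF pw _ \<beta>(2) w])
    have p: "polyasym \<beta> (\<lambda>j. poly T2 (w j - x))" using \<beta> by (intro polyasym_poly pw) auto
    show "polyasym \<beta> (\<lambda>j. (w j - x) * poly T2 (w j - x))"
      using \<beta> by (intro polyasym_mult pw p) auto
    show "(\<lambda>j. (w j - x) * poly T2 (w j - x)) \<in> ody (1 / 2)"
      using \<beta> by (intro bigo_half_mult w polyasym_bounded[OF p]) auto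
  qed
  then have "polyasym (\<beta> + 1/2) (\<lambda>j. (f (w j) - poly T (w j - x)) + (a + (w j - x) * ((w j - x) * poly T2 (w j - x))))"
    by (intro polyasym_add[OF polyasym_bigo[OF dy_powr_bigo_trans[OF T(1) K(1)]]]
        polyasym_add[OF polyasym_const])
  then show ?thesis by (simp add: T1 T2 b algebra_simps)
qed

lemma bigo_half_compose:
  assumes "tay 1 f x" and w: "(\<lambda>j. w j - x) \<in> ody (1/2)"
  shows "(\<lambda>j. f (w j) - f x) \<in> ody (1/2)"
proof -
  obtain T where T: "(\<lambda>j. f (w j) - poly T (w j - x)) \<in> ody (1 / 2)" "coeff T 0 = f x"
    using tay_seq[OF assms(1) bigo_half_tendsto[OF w] w] by (metis le_refl of_nat_1)
  obtain a T1 where T1: "T = pCons a T1" by (cases T)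
  have "(\<lambda>j. w j - x) \<longlonglongrightarrow> 0" using bigo_half_tendsto[OF w] by (simp add: LIM_zero_iff)
  then have "(\<lambda>j. poly T1 (w j - x)) \<longlonglongrightarrow> poly T1 0" by (intro tendsto_intros)
  then have "(\<lambda>j. poly T1 (w j - x)) \<in> O(\<lambda>_. 1)" by (intro bigoI_tendsto[where c = "poly T1 0"]) auto
  from sum_in_bigo(1)[OF T(1) bigo_half_mult[OF w this]] T(2) show ?thesis by (simp add: T1)
qed

lemma bigo_half_prod:
  assumes a: "(\<lambda>j. a j - a0) \<in> ody (1/2)" and b: "(\<lambda>j. b j - b0) \<in> ody (1/2)"
  shows "(\<lambda>j. a j * b j - a0 * b0) \<in> ody (1/2)"
proof -
  have "(\<lambda>j. (a j - a0) * b j + (b j - b0) * a0) \<in> ody (1/2)"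
    by (intro sum_in_bigo bigo_half_mult a b bigo_half_bounded[OF b]) auto
  then show ?thesis by (simp add: algebra_simps)
qed

lemma bigo_half_power:
  assumes a: "(\<lambda>j. a j - a0) \<in> ody (1/2)"
  shows "(\<lambda>j. a j ^ n - a0 ^ n) \<in> ody (1/2)"
  by (induction n) (auto intro: bigo_half_prod a)

text \<open>Here \<open>y\<close> has the target regularity and \<open>b\<close> only the current
  one. In \<open>y b - y0 b0 = y0 (b - b0) + b0 (y - y0) + (y - y0) (b - b0)\<close> the second term
  is known to order \<open>\<theta>\<close> and the last gains 1/2, so only the part linear in
  \<open>b\<close> is left over.\<close>

lemma polyasym_compose_mult_gain:
  assumes f: "\<And>K. tay K f (y0 * b0)" "(f has_real_derivative d) (at (y0 * b0))"
    and y: "(\<lambda>j. y j - y0) \<in> ody (1/2)" "polyasym \<theta> y"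
    and b: "(\<lambda>j. b j - b0) \<in> ody (1/2)" "polyasym \<beta> b"
    and \<beta>: "\<beta> \<ge> 1/2" "\<beta> \<le> \<theta>" "\<gamma> \<le> \<theta>" "\<gamma> \<le> \<beta> + 1/2"
  shows "polyasym \<gamma> (\<lambda>j. f (y j * b j) - d * y0 * b j)"
proof -
  have y\<beta>: "polyasym \<beta> y" using polyasym_mono[OF y(2)] \<beta> by simp
  have "polyasym \<beta> (\<lambda>j. y j * b j)" using \<beta> by (intro polyasym_mult y\<beta> b) auto
  from polyasym_compose_gain[OF f bigo_half_prod[OF y(1) b(1)] this \<beta>(1)]
  have 1: "polyasym \<gamma> (\<lambda>j. f (y j * b j) - d * (y j * b j - y0 * b0))"
    by (rule polyasym_mono) (use \<beta> in auto)
  have 2: "polyasym \<gamma> (\<lambda>j. (y j - y0) * (b j - b0))"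
    by (rule polyasym_mono[OF polyasym_mult_gain[OF _ _ \<beta>(1) y(1) b(1)]])
      (use \<beta> in \<open>auto intro!: polyasym_diff polyasym_const y\<beta> b\<close>)
  have 3: "polyasym \<gamma> (\<lambda>j. y j - y0)"
    using polyasym_mono[OF y(2) \<beta>(3)] by (intro polyasym_diff polyasym_const)
  have "polyasym \<gamma> (\<lambda>j. (f (y j * b j) - d * (y j * b j - y0 * b0)) + d * ((y j - y0) * (b j - b0))
      + (d * b0) * (y j - y0) - d * y0 * b0)"
    by (intro polyasym_add polyasym_diff polyasym_cmult 1 2 3 polyasym_const)
  then show ?thesis by (simp add: algebra_simps)
qed

section \<open>Dyadic differences\<close>

lemma bigo_dy_all:
  assumes "f \<in> ody \<theta>"
  shows "\<exists>C\<ge>0. \<forall>j. \<bar>f j\<bar> \<le> C * dy j powr \<theta>"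
proof -
  obtain C J where C: "C > 0" "\<And>j. j \<ge> J \<Longrightarrow> \<bar>f j\<bar> \<le> C * dy j powr \<theta>"
  proof -
    obtain C where "C > 0" "\<forall>\<^sub>F j in sequentially. norm (f j) \<le> C * norm (dy j powr \<theta>)"
      using landau_o.bigE[OF assms] by blast
    then show thesis using that by (auto simp: eventually_sequentially)
  qed
  \<comment> \<open>The sum pays for the finitely many indices before \<open>J\<close>.\<close>
  define C' where "C' = C + (\<Sum>i<J. \<bar>f i\<bar> / dy i powr \<theta>)"
  have sum_nn: "(\<Sum>i<J. \<bar>f i\<bar> / dy i powr \<theta>) \<ge> 0" by (intro sum_nonneg) auto
  have "\<bar>f j\<bar> \<le> C' * dy j powr \<theta>" for j
  proof (cases "j \<ge> J")
    case True
    then have "\<bar>f j\<bar> \<le> C * dy j powr \<theta>" by (rule C)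
    also have "\<dots> \<le> C' * dy j powr \<theta>" using sum_nn by (intro mult_right_mono) (auto simp: C'_def)
    finally show ?thesis .
  next
    case False
    have "\<bar>f j\<bar> / dy j powr \<theta> \<le> (\<Sum>i<J. \<bar>f i\<bar> / dy i powr \<theta>)"
      using False by (intro member_le_sum) auto
    then have "\<bar>f j\<bar> / dy j powr \<theta> \<le> C'" using C(1) by (simp add: C'_def)
    then show ?thesis by (simp add: pos_divide_le_eq)
  qed
  moreover have "C' \<ge> 0" using C(1) sum_nn by (simp add: C'_def)
  ultimately show ?thesis by blast
qed

lemma bigo_dyI: "(\<And>j. \<bar>f j\<bar> \<le> C * dy j powr \<theta>) \<Longrightarrow> f \<in> ody \<theta>"
  by (intro bigoI[of _ C]) auto

text \<open>Natural constants and a bound for every \<open>j\<close> turn the asymptotic statement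
  into countably many inequalities, which makes it measurable.\<close>

lemma bigo_dy_iff: "f \<in> ody \<theta> \<longleftrightarrow> (\<exists>C::nat. \<forall>j. \<bar>f j\<bar> \<le> real C * dy j powr \<theta>)"
proof
  assume "f \<in> ody \<theta>"
  then obtain C where C: "\<And>j. \<bar>f j\<bar> \<le> C * dy j powr \<theta>" using bigo_dy_all by blast
  have "\<bar>f j\<bar> \<le> real (nat \<lceil>C\<rceil>) * dy j powr \<theta>" for j
    by (rule order_trans[OF C]) (intro mult_right_mono real_nat_ceiling_ge, simp)
  then show "\<exists>C::nat. \<forall>j. \<bar>f j\<bar> \<le> real C * dy j powr \<theta>" by blast
qed (blast intro: bigo_dyI)

text \<open>Since \<open>2 ^ l * dy (Suc j) ^ l = dy j ^ l\<close>, the factor with number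
  \<open>l\<close> kills the \<open>l\<close>-th power of \<open>dy j\<close>; hence
  \<open>dd N\<close> kills polynomials in \<open>dy j\<close> of degree below
  \<open>N\<close>.\<close>

fun dd :: "nat \<Rightarrow> (nat \<Rightarrow> real) \<Rightarrow> nat \<Rightarrow> real" where
  "dd 0 w = w"
| "dd (Suc N) w = (\<lambda>j. dd N w j - 2 ^ N * dd N w (Suc j))"

lemma dd_add: "dd N (\<lambda>j. w j + w' j) = (\<lambda>j. dd N w j + dd N w' j)"
  by (induction N) (auto simp: algebra_simps)

lemma dd_cmult: "dd N (\<lambda>j. c * w j) = (\<lambda>j. c * dd N w j)"
  by (induction N) (auto simp: algebra_simps)

lemma dd_dy_power: "dd N (\<lambda>j. dy j ^ l) = (\<lambda>j. (\<Prod>i<N. 1 - 2 ^ i / 2 ^ l) * dy j ^ l)"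
  by (induction N) (auto simp: dy_def power_mult_distrib power_divide field_simps)

lemma dd_bigo:
  assumes "w \<in> ody \<theta>" shows "dd N w \<in> ody \<theta>"
proof (induction N)
  case (Suc N)
  obtain C where C: "\<And>j. \<bar>dd N w j\<bar> \<le> C * dy j powr \<theta>" using bigo_dy_all[OF Suc] by blast
  have "\<bar>dd N w (Suc j)\<bar> \<le> (C * (1/2) powr \<theta>) * dy j powr \<theta>" for j
    using C[of "Suc j"] by (simp add: dy_def powr_mult powr_divide mult_ac)
  then have "(\<lambda>j. dd N w (Suc j)) \<in> ody \<theta>" by (rule bigo_dyI)
  then show ?case using Suc by (auto intro!: sum_in_bigo)
qed (use assms in simp)

lemma dd_poly_bigo:
  assumes "\<theta> \<le> real N" shows "dd N (\<lambda>j. poly P (dy j)) \<in> ody \<theta>"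
proof -
  have mon: "dd N (\<lambda>j. dy j ^ l) \<in> ody \<theta>" for l
  proof (cases "l < N")
    case True
    then have "(\<Prod>i<N. 1 - 2 ^ i / 2 ^ l) = (0::real)" by (auto simp: prod_zero_iff intro!: bexI[of _ l])
    then show ?thesis by (simp add: dd_dy_power)
  next
    case False
    then have "(\<lambda>j. dy j ^ l) \<in> ody \<theta>"
      using assms dy_powr_bigo[of \<theta> "real l"] by (simp add: powr_realpow)
    then show ?thesis by (rule dd_bigo)
  qed
  have "dd N (\<lambda>j. \<Sum>i\<in>A. coeff P i * dy j ^ i) \<in> ody \<theta>" if "finite A" for A
    using that
  proof induction
    case empty
    have "dd N (\<lambda>j. 0) = (\<lambda>j. 0)" using dd_cmult[of N 0 "\<lambda>_. 0"] by simp
    then show ?case by simp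
  next
    case (insert i A)
    have "(\<lambda>j. coeff P i * dd N (\<lambda>j. dy j ^ i) j) \<in> ody \<theta>"
      using mon[of i] by (cases "coeff P i = 0") auto
    then show ?case using insert by (simp add: dd_add dd_cmult) (auto intro!: sum_in_bigo)
  qed
  then show ?thesis by (simp add: poly_altdef)
qed

lemma polyasym_imp_dd_bigo:
  assumes "polyasym \<theta> w" "\<theta> \<le> real N" shows "dd N w \<in> ody \<theta>"
proof -
  obtain P where P: "(\<lambda>j. w j - poly P (dy j)) \<in> ody \<theta>"
    using assms unfolding polyasym_def by blast
  from sum_in_bigo(1)[OF dd_bigo[OF P, of N] dd_poly_bigo[OF assms(2), of P]]
  show ?thesis by (simp flip: dd_add)
qed

text \<open>For \<open>\<rho> < 1\<close> the sequence is Cauchy and \<open>c\<close> is its limit;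
  for \<open>\<rho> > 1\<close> it grows at most like \<open>\<rho> ^ j\<close> and
  \<open>c = 0\<close> works. At \<open>\<rho> = 1\<close> linear growth would be possible, which is
  why integer orders are excluded later.\<close>

lemma geometric_increments:
  fixes y :: "nat \<Rightarrow> real"
  assumes y: "\<And>j. \<bar>y j - y (Suc j)\<bar> \<le> C * \<rho> ^ j" and \<rho>: "\<rho> > 0" "\<rho> \<noteq> 1"
  shows "\<exists>c C'. \<forall>j. \<bar>y j - c\<bar> \<le> C' * \<rho> ^ j"
proof (cases "\<rho> < 1")
  case True
  \<comment> \<open>Chosen so that
    \<open>C * \<rho> ^ j = K * \<rho> ^ j - K * \<rho> ^ Suc j\<close> telescopes.\<close>
  define K where "K = C / (1 - \<rho>)"
  have C: "C = K * (1 - \<rho>)" using True by (simp add: K_def)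
  have "C \<ge> 0" using y[of 0] by simp
  then have K: "K \<ge> 0" using True by (simp add: K_def)
  have bd: "\<bar>y j - y (j + n)\<bar> \<le> K * \<rho> ^ j - K * \<rho> ^ (j + n)" for j n
  proof (induction n)
    case (Suc n)
    have "\<bar>y (j + n) - y (Suc (j + n))\<bar> \<le> K * \<rho> ^ (j + n) - K * \<rho> ^ (Suc (j + n))"
      using y[of "j + n"] by (simp add: C algebra_simps)
    then show ?case using Suc by (simp del: power_Suc)
  qed simp
  have bd': "\<bar>y j - y (j + n)\<bar> \<le> K * \<rho> ^ j" for j n
    using bd[of j n] K \<rho> by (smt (verit) mult_nonneg_nonneg zero_le_power)
  have "(\<lambda>j. K * \<rho> ^ j) \<longlonglongrightarrow> 0"
    using True \<rho> by (intro tendsto_mult_right_zero LIMSEQ_power_zero) auto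
  have "Cauchy y"
  proof (rule metric_CauchyI)
    fix e :: real assume "e > 0"
    then obtain J where J: "K * \<rho> ^ J < e / 2"
      using order_tendstoD(2)[OF \<open>(\<lambda>j. K * \<rho> ^ j) \<longlonglongrightarrow> 0\<close>, of "e / 2"]
      by (auto simp: eventually_sequentially)
    have "dist (y m) (y n) < e" if "m \<ge> J" "n \<ge> J" for m n
      using bd'[of J "m - J"] bd'[of J "n - J"] that J by (simp add: dist_real_def)
    then show "\<exists>M. \<forall>m\<ge>M. \<forall>n\<ge>M. dist (y m) (y n) < e" by blast
  qed
  then obtain c where c: "y \<longlonglongrightarrow> c" using Cauchy_convergent convergent_def by blast
  have "\<bar>y j - c\<bar> \<le> K * \<rho> ^ j" for j
  proof (rule LIMSEQ_le_const2)
    have "(\<lambda>n. y (n + j)) \<longlonglongrightarrow> c" using c by (rule LIMSEQ_ignore_initial_segment)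
    then show "(\<lambda>n. \<bar>y j - y (n + j)\<bar>) \<longlonglongrightarrow> \<bar>y j - c\<bar>" by (intro tendsto_intros)
    show "\<exists>N. \<forall>n\<ge>N. \<bar>y j - y (n + j)\<bar> \<le> K * \<rho> ^ j" using bd'[of j] by (simp add: add.commute)
  qed
  then show ?thesis by blast
next
  case False
  \<comment> \<open>Large enough for the start and for \<open>C \<le> K * (\<rho> - 1)\<close>,
    which closes the induction.\<close>
  define K where "K = \<bar>y 0\<bar> + C / (\<rho> - 1)"
  have \<rho>1: "\<rho> > 1" using False \<rho> by simp
  have "\<bar>y j\<bar> \<le> K * \<rho> ^ j" for j
  proof (induction j)
    case 0
    have "C \<ge> 0" using y[of 0] by simp
    then show ?case using \<rho>1 by (simp add: K_def)
  next
    case (Suc j)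
    have "C \<le> K * (\<rho> - 1)" using \<rho>1 by (simp add: K_def distrib_right)
    then have "C * \<rho> ^ j \<le> K * (\<rho> - 1) * \<rho> ^ j" using \<rho> by (intro mult_right_mono) auto
    then show ?case using Suc y[of j] by (simp add: algebra_simps)
  qed
  then show ?thesis by (intro exI[of _ 0] exI[of _ K]) simp
qed

text \<open>Dividing by \<open>dy j ^ l\<close> turns the weighted difference into a plain increment
  of geometric size with ratio \<open>2 powr (l - \<theta>)\<close>, which differs from 1 because
  \<open>\<theta> \<noteq> l\<close>.\<close>

lemma dd_step_inverse:
  assumes z: "(\<lambda>j. z j - 2 ^ l * z (Suc j)) \<in> ody \<theta>" and "\<theta> \<noteq> real l"
  shows "\<exists>c. (\<lambda>j. z j - c * dy j ^ l) \<in> ody \<theta>"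
proof -
  obtain C where C: "\<And>j. \<bar>z j - 2 ^ l * z (Suc j)\<bar> \<le> C * dy j powr \<theta>" using bigo_dy_all[OF z] by blast
  define \<rho> where "\<rho> = (1/2::real) powr (\<theta> - real l)"
  have \<rho>: "dy j ^ l * \<rho> ^ j = dy j powr \<theta>" for j
  proof -
    have "\<rho> ^ j = dy j powr (\<theta> - real l)"
      unfolding \<rho>_def dy_def by (simp add: powr_powr powr_power mult.commute flip: powr_realpow)
    then show ?thesis by (simp add: powr_diff powr_realpow)
  qed
  define y where "y j = z j / dy j ^ l" for j
  have "\<bar>y j - y (Suc j)\<bar> \<le> C * \<rho> ^ j" for j
  proof -
    have "y j - y (Suc j) = (z j - 2 ^ l * z (Suc j)) / dy j ^ l"
      by (simp add: y_def dy_def power_mult_distrib power_divide field_simps)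
    then have "\<bar>y j - y (Suc j)\<bar> = \<bar>z j - 2 ^ l * z (Suc j)\<bar> / dy j ^ l" by (simp add: less_imp_le)
    also have "\<dots> \<le> C * (dy j ^ l * \<rho> ^ j) / dy j ^ l" using C[of j] \<rho>[of j] by (intro divide_right_mono) (auto simp: less_imp_le)
    finally show ?thesis by simp
  qed
  moreover have "\<rho> > 0" "\<rho> \<noteq> 1" using assms(2) by (auto simp: \<rho>_def)
  ultimately obtain c C' where c: "\<And>j. \<bar>y j - c\<bar> \<le> C' * \<rho> ^ j" using geometric_increments by blast
  have "\<bar>z j - c * dy j ^ l\<bar> \<le> C' * dy j powr \<theta>" for j
  proof -
    have "z j - c * dy j ^ l = (y j - c) * dy j ^ l" by (simp add: y_def field_simps)
    then have "\<bar>z j - c * dy j ^ l\<bar> = \<bar>y j - c\<bar> * dy j ^ l" by (simp add: abs_mult less_imp_le)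
    also have "\<dots> \<le> (C' * \<rho> ^ j) * dy j ^ l" by (intro mult_right_mono c) (auto simp: less_imp_le)
    finally show ?thesis using \<rho>[of j] by (simp add: mult_ac)
  qed
  then have "(\<lambda>j. z j - c * dy j ^ l) \<in> ody \<theta>" by (rule bigo_dyI)
  then show ?thesis by blast
qed

text \<open>The last factor is undone first: it leaves \<open>dd N w = c * dy j ^ N\<close> up to
  the error. As \<open>dd N\<close> multiplies \<open>dy j ^ N\<close> by the nonzero
  \<open>e\<close>, subtracting \<open>(c / e) * dy j ^ N\<close> from \<open>w\<close> removes this
  term, and the induction hypothesis for \<open>N\<close> applies.\<close>

lemma dd_bigo_imp_polyasym:
  assumes "dd N w \<in> ody \<theta>" "\<theta> \<notin> \<nat>"
  shows "polyasym \<theta> w"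
  using assms(1)
proof (induction N arbitrary: w)
  case 0 then show ?case by (simp add: polyasym_bigo)
next
  case (Suc N)
  have "\<theta> \<noteq> real N" using assms(2) by auto
  then obtain c where c: "(\<lambda>j. dd N w j - c * dy j ^ N) \<in> ody \<theta>"
    using dd_step_inverse[of "dd N w" N \<theta>] Suc.prems by auto
  define e where "e = (\<Prod>i<N. 1 - 2 ^ i / 2 ^ N :: real)"
  have "e \<noteq> 0" unfolding e_def by (auto simp: prod_zero_iff)
  have "dd N (\<lambda>j. w j + (- c / e) * dy j ^ N) = (\<lambda>j. dd N w j - c * dy j ^ N)"
    using \<open>e \<noteq> 0\<close> by (simp only: dd_add dd_cmult dd_dy_power flip: e_def) auto
  with c have "polyasym \<theta> (\<lambda>j. w j + (- c / e) * dy j ^ N)" by (intro Suc.IH) simp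
  moreover have "polyasym \<theta> (\<lambda>j. (c / e) * dy j ^ N)"
    unfolding polyasym_def by (intro exI[of _ "monom (c / e) N"]) (simp add: poly_monom)
  ultimately have "polyasym \<theta> (\<lambda>j. (w j + (- c / e) * dy j ^ N) + (c / e) * dy j ^ N)"
    by (rule polyasym_add)
  then show ?case by simp
qed

text \<open>The nonzero last coefficient later keeps the Fourier symbol of \<open>dd N\<close> from
  vanishing identically.\<close>

lemma dd_coefficients:
  "\<exists>c. (\<forall>w j. dd N w j = (\<Sum>i\<le>N. c i * w (j + i))) \<and> c N \<noteq> 0"
proof (induction N)
  case 0 show ?case by (intro exI[of _ "\<lambda>_. 1"]) simp
next
  case (Suc N)
  then obtain c where c: "\<And>w j. dd N w j = (\<Sum>i\<le>N. c i * w (j + i))" "c N \<noteq> 0" by blast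
  define c' where "c' i = (if i \<le> N then c i else 0) - 2 ^ N * (if i = 0 then 0 else c (i - 1))" for i
  have "dd (Suc N) w j = (\<Sum>i\<le>Suc N. c' i * w (j + i))" for w j
  proof -
    have "(\<Sum>i\<le>Suc N. c' i * w (j + i)) = (\<Sum>i\<le>Suc N. (if i \<le> N then c i else 0) * w (j + i))
        - (\<Sum>i\<le>Suc N. 2 ^ N * (if i = 0 then 0 else c (i - 1)) * w (j + i))"
      by (simp only: c'_def left_diff_distrib sum_subtractf)
    also have "(\<Sum>i\<le>Suc N. (if i \<le> N then c i else 0) * w (j + i)) = dd N w j"
      by (simp add: c(1))
    also have "(\<Sum>i\<le>Suc N. 2 ^ N * (if i = 0 then 0 else c (i - 1)) * w (j + i)) = 2 ^ N * dd N w (Suc j)"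
      by (subst sum.atMost_Suc_shift) (simp add: c(1) sum_distrib_left mult.assoc)
    finally show ?thesis by simp
  qed
  moreover have "c' (Suc N) \<noteq> 0" using c(2) by (simp add: c'_def)
  ultimately show ?case by blast
qed

section \<open>Recovering the velocity from two positions\<close>

text \<open>Energy conservation gives \<open>d\<tau> = du / v\<close> with
  \<open>v = sqrt (2 / (k + 1) * (A ^ (k + 1) - u ^ (k + 1)))\<close>; in the variable
  \<open>z = u / A\<close> this is \<open>A powr (- (k - 1) / 2) * tmap_deriv k z dz\<close>. The
  primitive \<open>tmap\<close> is the function \<open>a\<close> of the overview, smooth only short
  of the turning point \<open>z = 1\<close>.\<close>

definition tmap_deriv :: "nat \<Rightarrow> real \<Rightarrow> real" where
  "tmap_deriv k z = sqrt ((real k + 1) / 2) * (1 - z ^ (k + 1)) powr (- 1 / 2)"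

definition tmap :: "nat \<Rightarrow> real \<Rightarrow> real" where
  "tmap k z = integral {0..z} (tmap_deriv k)"

lemma one_minus_power_pos: "0 \<le> z \<Longrightarrow> z < 1 \<Longrightarrow> 1 - z ^ (k + 1) > (0::real)"
  using power_less_one_iff[of z "k + 1"] by simp

lemma tmap_has_derivative:
  assumes "0 < z" "z < 1"
  shows "(tmap k has_real_derivative tmap_deriv k z) (at z)"
proof -
  define b where "b = (z + 1) / 2"
  have b: "z < b" "b < 1" using assms by (auto simp: b_def)
  have "continuous_on {0..b} (tmap_deriv k)"
    unfolding tmap_deriv_def
  proof (intro continuous_intros ballI)
    fix x assume "x \<in> {0..b}"
    then show "1 - x ^ (k + 1) \<noteq> 0" using b one_minus_power_pos[of x k] by auto
  qed
  then have "((\<lambda>u. integral {0..u} (tmap_deriv k)) has_vector_derivative tmap_deriv k z) (at z within {0..b})"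
    using assms b by (intro integral_has_vector_derivative) auto
  then show ?thesis
    using assms b
    by (subst (asm) at_within_interior) (auto simp: tmap_def[abs_def] has_real_derivative_iff_has_vector_derivative)
qed

lemma tay_tmap:
  assumes "0 < z" "z < 1"
  shows "tay K (tmap k) z"
proof -
  have "tay K (\<lambda>y. (poly (1 - monom 1 (k + 1)) y) powr (- 1 / 2)) z" for K
    using one_minus_power_pos[of z k] assms
    by (intro tay_compose_poly tay_powr) (auto simp: poly_monom)
  then have *: "tay K (tmap_deriv k) z" for K
    unfolding tmap_deriv_def[abs_def] using tay_cmult by (simp add: poly_monom)
  have "\<forall>\<^sub>F y in nhds z. (tmap k has_real_derivative tmap_deriv k y) (at y)"
    using eventually_nhds_in_open[of "{0<..<1}" z] assms
    by (auto elim!: eventually_mono intro: tmap_has_derivative)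
  from tay_antiderivative[OF this *] have "tay (Suc K) (tmap k) z" for K .
  moreover have "tay 0 (tmap k) z"
    using DERIV_isCont[OF tmap_has_derivative[OF assms]] by (rule tay_0_if_isCont)
  ultimately show ?thesis by (cases K) auto
qed

lemma tmap_deriv_mono:
  assumes "0 \<le> x" "x \<le> y" "y < 1" shows "tmap_deriv k x \<le> tmap_deriv k y"
proof -
  have "x ^ (k + 1) \<le> y ^ (k + 1)" using assms by (intro power_mono)
  then show ?thesis unfolding tmap_deriv_def using one_minus_power_pos[of y k] assms
    by (intro mult_left_mono powr_mono2') auto
qed

text \<open>On this region the velocity stays positive up to time t, because the force is at most
  \<open>A ^ k\<close>, where \<open>A\<close> is the amplitude.\<close>

definition rise_region :: "nat \<Rightarrow> real \<Rightarrow> (real \<times> real) set" where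
  "rise_region k t = {p. fst p > 0 \<and> snd p > 0 \<and> t ^ (k + 1) * energy k p ^ k < snd p ^ (k + 1)}"

lemma open_rise_region: "open (rise_region k t)"
  unfolding rise_region_def
  by (intro open_Collect_conj open_Collect_less continuous_intros continuous_on_energy)

text \<open>\<open>energy\<close> is \<open>k + 1\<close> times the conserved density, so it equals
  \<open>u ^ (k + 1)\<close> where the velocity vanishes; \<open>amp\<close> is thus the position of
  the turning point.\<close>

definition amp :: "nat \<Rightarrow> real \<times> real \<Rightarrow> real" where
  "amp k p = energy k p powr (1 / (real k + 1))"

lemma energy_pos: "odd k \<Longrightarrow> snd p > 0 \<Longrightarrow> energy k p > 0"
proof -
  assume "odd k" "snd p > 0"
  then have "fst p ^ (k + 1) \<ge> 0" by (intro zero_le_even_power) simp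
  moreover have "(real k + 1) / 2 * (snd p)\<^sup>2 > 0" using \<open>snd p > 0\<close> by simp
  ultimately show ?thesis unfolding energy_def by linarith
qed

lemma amp_power: "energy k p > 0 \<Longrightarrow> amp k p ^ (k + 1) = energy k p"
  unfolding amp_def by (subst powr_power) (auto simp: add.commute)

lemma amp_pos: "energy k p > 0 \<Longrightarrow> amp k p > 0"
  by (simp add: amp_def)

text \<open>Keeps \<open>u / amp\<close> inside \<open>(0, 1)\<close> up to time \<open>t\<close>,
  where \<open>tmap\<close> is smooth.\<close>

lemma rise_region_flow:
  assumes k: "odd k" and p: "p \<in> rise_region k t" and t: "0 \<le> \<tau>" "\<tau> \<le> t"
  shows "snd (ode_flow k p \<tau>) > 0" "fst p \<le> fst (ode_flow k p \<tau>)"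
    "fst (ode_flow k p \<tau>) < amp k p"
proof -
  let ?\<phi> = "ode_flow k p" and ?A = "amp k p"
  have e: "energy k p > 0" using energy_pos[OF k] p by (simp add: rise_region_def)
  note du = position_derivative[OF k, of p] and dv = velocity_derivative[OF k, of p]
  have en: "energy k (?\<phi> \<tau>) = ?A ^ (k + 1)" for \<tau>
    using energy_conserved[OF ode_flow_solves[OF k], of p \<tau>] amp_power[OF e] by (simp add: ode_flow_0[OF k])
  have ub: "fst (?\<phi> \<tau>) ^ k \<le> ?A ^ k" for \<tau>
  proof -
    have "\<bar>fst (?\<phi> \<tau>)\<bar> ^ (k + 1) = fst (?\<phi> \<tau>) ^ (k + 1)" using k by (intro power_even_abs) simp
    also have "\<dots> \<le> ?A ^ (k + 1)" unfolding en[of \<tau>, symmetric] by (simp add: energy_def)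
    finally have "\<bar>fst (?\<phi> \<tau>)\<bar> \<le> ?A" using amp_pos[OF e] by (subst (asm) power_mono_iff) auto
    then have "\<bar>fst (?\<phi> \<tau>)\<bar> ^ k \<le> ?A ^ k" by (intro power_mono) auto
    then show ?thesis by (simp add: power_abs[symmetric] abs_le_iff)
  qed
  \<comment> \<open>The inequality in \<open>rise_region\<close> is this one raised to the power
    \<open>k + 1\<close>, a form without the root in \<open>amp\<close>.\<close>
  have tA: "t * ?A ^ k < snd p"
  proof -
    have "(t * ?A ^ k) ^ (k + 1) = t ^ (k + 1) * (?A ^ (k + 1)) ^ k"
      by (simp only: power_mult_distrib power_mult[symmetric] mult.commute)
    also have "\<dots> < snd p ^ (k + 1)" using p amp_power[OF e] by (simp add: rise_region_def)
    finally show ?thesis by (rule power_less_imp_less_base) (use p in \<open>simp add: rise_region_def\<close>)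
  qed
  \<comment> \<open>The force is at least \<open>- A ^ k\<close>, so
    \<open>v + A ^ k * \<tau>\<close> cannot decrease.\<close>
  have vpos: "snd (?\<phi> \<tau>) > 0" if "0 \<le> \<tau>" "\<tau> \<le> t" for \<tau>
  proof -
    have "(\<lambda>\<tau>. snd (?\<phi> \<tau>) + ?A ^ k * \<tau>) 0 \<le> (\<lambda>\<tau>. snd (?\<phi> \<tau>) + ?A ^ k * \<tau>) \<tau>"
    proof (rule DERIV_nonneg_imp_nondecreasing[OF that(1)])
      fix x
      have "((\<lambda>\<tau>. snd (?\<phi> \<tau>) + ?A ^ k * \<tau>) has_real_derivative - (fst (?\<phi> x) ^ k) + ?A ^ k * 1) (at x)"
        by (intro DERIV_add dv DERIV_cmult DERIV_ident)
      then show "\<exists>y. ((\<lambda>\<tau>. snd (?\<phi> \<tau>) + ?A ^ k * \<tau>) has_real_derivative y) (at x) \<and> 0 \<le> y"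
        using ub[of x] by (intro exI[of _ "- (fst (?\<phi> x) ^ k) + ?A ^ k * 1"]) simp
    qed
    moreover have "?A ^ k * \<tau> \<le> ?A ^ k * t" using that amp_pos[OF e] by (intro mult_left_mono) auto
    ultimately show ?thesis using tA by (simp add: ode_flow_0[OF k] mult.commute)
  qed
  show "snd (?\<phi> \<tau>) > 0" using vpos t by simp
  have "(\<lambda>\<tau>. fst (?\<phi> \<tau>)) 0 \<le> (\<lambda>\<tau>. fst (?\<phi> \<tau>)) \<tau>"
  proof (rule DERIV_nonneg_imp_nondecreasing[OF t(1)])
    fix x assume "0 \<le> x" "x \<le> \<tau>"
    then show "\<exists>y. ((\<lambda>\<tau>. fst (?\<phi> \<tau>)) has_real_derivative y) (at x) \<and> 0 \<le> y"
      using du[of x] vpos[of x] t by (intro exI[of _ "snd (?\<phi> x)"]) auto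
  qed
  then show "fst p \<le> fst (?\<phi> \<tau>)" by (simp add: ode_flow_0[OF k])
  have "(real k + 1) / 2 * (snd (?\<phi> \<tau>))\<^sup>2 > 0" using vpos[OF t] by simp
  then have "fst (?\<phi> \<tau>) ^ (k + 1) < ?A ^ (k + 1)" using en[of \<tau>] unfolding energy_def by linarith
  then show "fst (?\<phi> \<tau>) < ?A" by (rule power_less_imp_less_base) (use amp_pos[OF e] in simp)
qed

text \<open>Since the equation is homogeneous, the travel time is a function of \<open>u / A\<close> alone,
  up to the factor \<open>A ^ ((k - 1) / 2)\<close>.\<close>

lemma rise_region_travel_time:
  assumes k: "odd k" and p: "p \<in> rise_region k t" and t: "0 < t"
  shows "tmap k (fst (ode_flow k p t) / amp k p) - tmap k (fst p / amp k p) = t * amp k p ^ ((k - 1) div 2)"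
proof -
  let ?\<phi> = "ode_flow k p" and ?A = "amp k p"
  define m where "m = (k - 1) div 2"
  have km: "k = 2 * m + 1" using k by (auto simp: m_def elim!: oddE)
  have e: "energy k p > 0" using energy_pos[OF k] p by (simp add: rise_region_def)
  have A: "?A > 0" by (rule amp_pos[OF e])
  have u0: "fst p > 0" using p by (simp add: rise_region_def)
  note du = position_derivative[OF k, of p]
  have en: "energy k (?\<phi> \<tau>) = ?A ^ (k + 1)" for \<tau>
    using energy_conserved[OF ode_flow_solves[OF k], of p \<tau>] amp_power[OF e] by (simp add: ode_flow_0[OF k])
  \<comment> \<open>Scaled travel time minus scaled clock time; its derivative vanishes since
    \<open>tmap_deriv k z * (v / A) = A ^ m\<close>.\<close>
  define f where "f \<tau> = tmap k (fst (?\<phi> \<tau>) / ?A) - \<tau> * ?A ^ m" for \<tau>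
  have D: "(f has_real_derivative 0) (at \<tau>)" if \<tau>: "0 \<le> \<tau>" "\<tau> \<le> t" for \<tau>
  proof -
    define z where "z = fst (?\<phi> \<tau>) / ?A"
    define v where "v = snd (?\<phi> \<tau>)"
    note r = rise_region_flow[OF k p \<tau>]
    have z: "0 < z" "z < 1" using r u0 A by (auto simp: z_def)
    have v: "v > 0" using r by (simp add: v_def)
    have "1 - z ^ (k + 1) = (?A ^ (k + 1) - fst (?\<phi> \<tau>) ^ (k + 1)) / ?A ^ (k + 1)"
      using A by (simp add: z_def power_divide diff_divide_distrib del: power_Suc)
    also have "?A ^ (k + 1) - fst (?\<phi> \<tau>) ^ (k + 1) = (real k + 1) / 2 * v\<^sup>2"
      using en[of \<tau>] unfolding energy_def v_def by linarith
    also have "(real k + 1) / 2 * v\<^sup>2 / ?A ^ (k + 1) = (sqrt ((real k + 1) / 2) * v / ?A ^ (m + 1))\<^sup>2"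
    proof -
      have "?A ^ (k + 1) = (?A ^ (m + 1))\<^sup>2" unfolding power_mult[symmetric] by (simp add: km mult.commute)
      then show ?thesis by (simp add: power_divide power_mult_distrib del: power_Suc)
    qed
    finally have "(1 - z ^ (k + 1)) powr (- 1 / 2) = 1 / (sqrt ((real k + 1) / 2) * v / ?A ^ (m + 1))"
      using v A by (simp add: powr_minus_divide powr_half_sqrt del: power_Suc)
    then have "tmap_deriv k z * (v / ?A) = ?A ^ m"
      using v A by (simp add: tmap_deriv_def)
    moreover have "((\<lambda>\<tau>. tmap k (fst (?\<phi> \<tau>) / ?A)) has_real_derivative tmap_deriv k z * (v / ?A)) (at \<tau>)"
      unfolding z_def v_def
      by (intro DERIV_chain2[OF tmap_has_derivative] DERIV_cdivide du z[unfolded z_def])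
    ultimately have "((\<lambda>\<tau>. tmap k (fst (?\<phi> \<tau>) / ?A)) has_real_derivative ?A ^ m) (at \<tau>)" by simp
    then have "((\<lambda>\<tau>. tmap k (fst (?\<phi> \<tau>) / ?A) - \<tau> * ?A ^ m) has_real_derivative (?A ^ m - 1 * ?A ^ m)) (at \<tau>)"
      by (intro DERIV_diff DERIV_cmult_right DERIV_ident)
    then show ?thesis by (simp add: f_def[abs_def])
  qed
  have "continuous_on {0..t} f"
    by (rule DERIV_continuous_on[OF has_field_derivative_at_within[OF D]]) auto
  then have "f t = f 0" by (rule DERIV_isconst2[OF t]) (use D t in auto)
  then show ?thesis by (simp add: f_def ode_flow_0[OF k] m_def)
qed

lemma snd_eq_powr:
  assumes "snd p > 0" "odd k"
  shows "snd p = (2 / (real k + 1) * (energy k p - fst p ^ (k + 1))) powr (1 / 2)"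
  using assms by (simp add: energy_def powr_half_sqrt)

text \<open>The travel time relation determines the amplitude from the two positions at times 0 and t;
  its linearization in \<open>1 / amp\<close> is nondegenerate, so regularity passes from the
  positions to the amplitude, half a power at a time, and then to the velocity.\<close>

lemma polyasym_velocity:
  assumes k: "odd k" "k \<ge> 3" and t: "t > 0" and \<theta>: "\<theta> \<ge> 1 / 2"
    and p: "(u0, v0) \<in> rise_region k t"
    and u: "(\<lambda>j. u j - u0) \<in> ody (1/2)" "polyasym \<theta> u"
    and v: "(\<lambda>j. v j - v0) \<in> ody (1/2)"
    and w: "polyasym \<theta> (\<lambda>j. fst (ode_flow k (u j, v j) t))"
  shows "polyasym \<theta> v"
proof -
  let ?h = "ody (1/2)"
  define m where "m = (k - 1) div 2"
  have km: "k = 2 * m + 1" using k by (auto simp: m_def elim!: oddE)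
  have m: "m \<ge> 1" using k by (simp add: km)
  define w where "w j = fst (ode_flow k (u j, v j) t)" for j
  define w0 where "w0 = fst (ode_flow k (u0, v0) t)"
  define e where "e j = energy k (u j, v j)" for j
  define e0 where "e0 = energy k (u0, v0)"
  \<comment> \<open>The inverse amplitude, so that \<open>u / A\<close> becomes the product
    \<open>u * b\<close>, the form handled by \<open>polyasym_compose_mult_gain\<close>.\<close>
  define b where "b j = e j powr (- 1 / (real k + 1))" for j
  define b0 where "b0 = e0 powr (- 1 / (real k + 1))"
  have uv: "(\<lambda>j. (u j, v j)) \<longlonglongrightarrow> (u0, v0)"
    by (intro tendsto_Pair bigo_half_tendsto u v)
  have ev: "\<forall>\<^sub>F j in sequentially. (u j, v j) \<in> rise_region k t"
    using topological_tendstoD[OF uv open_rise_region p] .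
  have e0: "e0 > 0" using p energy_pos[OF k(1), of "(u0, v0)"] by (simp add: e0_def rise_region_def)
  have b0: "b0 > 0" using e0 by (simp add: b0_def)
  have b_amp: "b0 = 1 / amp k (u0, v0)" "\<And>j. b j = 1 / amp k (u j, v j)"
    by (auto simp: b_def b0_def e0_def e_def amp_def powr_minus_divide)
  have u0: "u0 > 0" using p by (simp add: rise_region_def)
  have w0: "u0 \<le> w0" "w0 * b0 < 1" "0 < u0 * b0" "0 < w0 * b0" "u0 * b0 < 1" "u0 * b0 \<le> w0 * b0"
  proof -
    note r = rise_region_flow[OF k(1) p, of t]
    have A: "amp k (u0, v0) > 0" using e0 by (intro amp_pos) (simp add: e0_def)
    show 1: "u0 \<le> w0" "w0 * b0 < 1" using r t A by (auto simp: w0_def b_amp)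
    show 2: "0 < u0 * b0" "0 < w0 * b0" using 1 u0 b0 by auto
    show 3: "u0 * b0 \<le> w0 * b0" using 1 b0 by simp
    show "u0 * b0 < 1" using 1 3 by linarith
  qed
  have eh: "(\<lambda>j. e j - e0) \<in> ?h"
  proof -
    have "(\<lambda>j. (u j ^ (k + 1) - u0 ^ (k + 1)) + (real k + 1) / 2 * ((v j)\<^sup>2 - v0\<^sup>2)) \<in> ?h"
      by (rule sum_in_bigo(1)[OF bigo_half_power[OF u(1)]]) (use bigo_half_power[OF v, of 2] in auto)
    then show ?thesis by (simp add: e_def e0_def energy_def algebra_simps)
  qed
  have bh: "(\<lambda>j. b j - b0) \<in> ?h"
    unfolding b_def b0_def by (rule bigo_half_compose[OF tay_powr[OF e0] eh])
  have wh: "(\<lambda>j. w j - w0) \<in> ?h"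
  proof -
    obtain L where "\<forall>\<^sub>F q in nhds (u0, v0). norm (ode_flow k q t - ode_flow k (u0, v0) t) \<le> L * norm (q - (u0, v0))"
      using ode_flow_locally_lipschitz[OF k(1)] t by (meson less_imp_le)
    then have "\<forall>\<^sub>F j in sequentially. norm (ode_flow k (u j, v j) t - ode_flow k (u0, v0) t) \<le> L * norm ((u j, v j) - (u0, v0))"
      using uv by (auto simp: filterlim_iff)
    then have "\<forall>\<^sub>F j in sequentially. norm (w j - w0) \<le> \<bar>L\<bar> * norm (\<bar>u j - u0\<bar> + \<bar>v j - v0\<bar>)"
    proof (rule eventually_mono)
      fix j assume *: "norm (ode_flow k (u j, v j) t - ode_flow k (u0, v0) t) \<le> L * norm ((u j, v j) - (u0, v0))"
      have "norm (w j - w0) \<le> norm (ode_flow k (u j, v j) t - ode_flow k (u0, v0) t)"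
        unfolding w_def w0_def by (metis fst_diff norm_fst_le prod.collapse)
      also have "\<dots> \<le> \<bar>L\<bar> * norm (u j - u0, v j - v0)"
        using * by (smt (verit) diff_Pair mult_right_mono norm_ge_zero)
      also have "\<dots> \<le> \<bar>L\<bar> * (\<bar>u j - u0\<bar> + \<bar>v j - v0\<bar>)"
        using norm_Pair_le[of "u j - u0" "v j - v0"] by (intro mult_left_mono) auto
      finally show "norm (w j - w0) \<le> \<bar>L\<bar> * norm (\<bar>u j - u0\<bar> + \<bar>v j - v0\<bar>)" by simp
    qed
    then have "(\<lambda>j. w j - w0) \<in> O(\<lambda>j. \<bar>u j - u0\<bar> + \<bar>v j - v0\<bar>)" by (rule bigoI)
    also have "(\<lambda>j. \<bar>u j - u0\<bar> + \<bar>v j - v0\<bar>) \<in> ?h"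
      using u(1) v by (intro sum_in_bigo) auto
    finally show ?thesis .
  qed
  \<comment> \<open>The factor 1 writes \<open>b\<close> as a product with a constant sequence, so
    that \<open>polyasym_compose_mult_gain\<close> covers the right-hand side as well.\<close>
  have rel: "\<forall>\<^sub>F j in sequentially. tmap k (w j * b j) - tmap k (u j * b j) = t * (1 * b j) powr (- real m)"
    using ev
  proof (rule eventually_mono)
    fix j assume j: "(u j, v j) \<in> rise_region k t"
    then have "energy k (u j, v j) > 0" using energy_pos[OF k(1), of "(u j, v j)"] by (simp add: rise_region_def)
    then have "amp k (u j, v j) > 0" by (rule amp_pos)
    then show "tmap k (w j * b j) - tmap k (u j * b j) = t * (1 * b j) powr (- real m)"
      using rise_region_travel_time[OF k(1) j t]
      by (simp add: w_def b_amp m_def powr_minus powr_realpow power_divide powr_divide)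
  qed
  \<comment> \<open>The derivative with respect to \<open>b\<close> of left side minus right side of
    the travel time relation, at the limit point.\<close>
  define D where "D = tmap_deriv k (w0 * b0) * w0 - tmap_deriv k (u0 * b0) * u0
      - t * (- real m * (1 * b0) powr (- real m - 1) * 1)"
  \<comment> \<open>The first difference is nonnegative because \<open>tmap_deriv\<close> increases
    and \<open>u0 \<le> w0\<close>; the last term is strictly positive because
    \<open>k \<ge> 3\<close> gives \<open>m \<ge> 1\<close>.\<close>
  have "D > 0"
  proof -
    have "tmap_deriv k (u0 * b0) * u0 \<le> tmap_deriv k (w0 * b0) * w0"
      using w0 u0 b0 by (intro mult_mono tmap_deriv_mono) (auto simp: tmap_deriv_def)
    moreover have "t * (real m * b0 powr (- real m - 1)) > 0" using t m b0 by simp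
    ultimately show ?thesis by (simp add: D_def)
  qed
  have step: "polyasym \<gamma> b" if \<beta>: "polyasym \<beta> b" "\<beta> \<ge> 1/2" "\<beta> \<le> \<theta>" "\<gamma> \<le> \<theta>" "\<gamma> \<le> \<beta> + 1/2" for \<beta> \<gamma>
  proof -
    have 1: "polyasym \<gamma> (\<lambda>j. tmap k (w j * b j) - tmap_deriv k (w0 * b0) * w0 * b j)"
      using w0 \<beta> assms(9) by (intro polyasym_compose_mult_gain[OF tay_tmap tmap_has_derivative wh _ bh]) (auto simp: w_def)
    have 2: "polyasym \<gamma> (\<lambda>j. tmap k (u j * b j) - tmap_deriv k (u0 * b0) * u0 * b j)"
      using w0 \<beta> by (intro polyasym_compose_mult_gain[OF tay_tmap tmap_has_derivative u(1,2) bh]) auto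
    have 3: "polyasym \<gamma> (\<lambda>j. (1 * b j) powr (- real m) - (- real m * (1 * b0) powr (- real m - 1)) * 1 * b j)"
    proof (rule polyasym_compose_mult_gain[where f = "\<lambda>x. x powr (- real m)", OF _ _ _ polyasym_const bh])
      show "tay K (\<lambda>x. x powr (- real m)) (1 * b0)" for K using b0 by (intro tay_powr) simp
      show "((\<lambda>x. x powr (- real m)) has_real_derivative - real m * (1 * b0) powr (- real m - 1)) (at (1 * b0))"
        using b0 by (intro has_real_derivative_powr) simp
    qed (use \<beta> in auto)
    \<comment> \<open>By the travel time relation the nonlinear terms cancel and only
      \<open>- D * b\<close> survives.\<close>
    have "polyasym \<gamma> (\<lambda>j. (tmap k (w j * b j) - tmap_deriv k (w0 * b0) * w0 * b j) - (tmap k (u j * b j) - tmap_deriv k (u0 * b0) * u0 * b j)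
        - t * ((1 * b j) powr (- real m) - (- real m * (1 * b0) powr (- real m - 1)) * 1 * b j))"
      by (intro polyasym_diff polyasym_cmult 1 2 3)
    then have "polyasym \<gamma> (\<lambda>j. - (D * b j))"
    proof (rule polyasym_cong[rotated])
      show "\<forall>\<^sub>F j in sequentially. (tmap k (w j * b j) - tmap_deriv k (w0 * b0) * w0 * b j) - (tmap k (u j * b j) - tmap_deriv k (u0 * b0) * u0 * b j)
        - t * ((1 * b j) powr (- real m) - (- real m * (1 * b0) powr (- real m - 1)) * 1 * b j) = - (D * b j)"
        using rel by (rule eventually_mono) (simp add: D_def algebra_simps)
    qed
    from polyasym_cmult[OF this, of "- 1 / D"] show ?thesis using \<open>D > 0\<close> by simp
  qed
  \<comment> \<open>Bootstrap from the a priori order 1/2, gaining 1/2 per step and capped at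
    \<open>\<theta>\<close>.\<close>
  have "polyasym (min \<theta> (1/2 + real n / 2)) b" for n
  proof (induction n)
    case 0
    have "polyasym (1/2) (\<lambda>j. (b j - b0) + b0)" by (intro polyasym_add polyasym_bigo[OF bh] polyasym_const)
    then have "polyasym (1/2) b" by simp
    then show ?case by (rule polyasym_mono) simp
  next
    case (Suc n)
    show ?case by (rule step[OF Suc]) (use \<theta> in \<open>auto simp: min_def add_divide_distrib\<close>)
  qed
  from this[of "nat \<lceil>2 * \<theta>\<rceil>"] have pb: "polyasym \<theta> b"
    by (rule polyasym_mono) linarith
  have e_eq: "b j powr (- (real k + 1)) = e j" if "e j > 0" for j
  proof -
    have "(- 1 / (real k + 1)) * (- (real k + 1)) = 1" by (simp add: field_simps)
    then show ?thesis using that unfolding b_def powr_powr by (simp only: powr_one)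
  qed
  have pe: "polyasym \<theta> (\<lambda>j. b j powr (- (real k + 1)))"
    using \<theta> b0 by (intro polyasym_compose[OF tay_powr bh pb]) auto
  \<comment> \<open>The square of \<open>v\<close> is a function of \<open>b\<close> and
    \<open>u\<close>, and the root is smooth near its limit \<open>v0\<^sup>2 > 0\<close>.\<close>
  have pv: "polyasym \<theta> (\<lambda>j. (2 / (real k + 1) * (b j powr (- (real k + 1)) - u j ^ (k + 1))) powr (1 / 2))"
  proof (rule polyasym_compose[where x = "v0\<^sup>2" and f = "\<lambda>x. x powr (1 / 2)"])
    have v0: "v0 > 0" using p by (simp add: rise_region_def)
    show "tay K (\<lambda>x. x powr (1/2)) (v0\<^sup>2)" for K using v0 by (intro tay_powr) simp
    have h1: "(\<lambda>j. 2 / (real k + 1) * ((e j - e0) - (u j ^ (k + 1) - u0 ^ (k + 1)))) \<in> ?h"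
      by (subst landau_o.big.cmult_in_iff)
        (use sum_in_bigo(2)[OF eh bigo_half_power[OF u(1), of "k + 1"]] in auto)
    have h2: "\<forall>\<^sub>F j in sequentially. 2 / (real k + 1) * ((e j - e0) - (u j ^ (k + 1) - u0 ^ (k + 1))) =
        2 / (real k + 1) * (b j powr (- (real k + 1)) - u j ^ (k + 1)) - v0\<^sup>2"
      using ev
    proof (rule eventually_mono)
      fix j assume "(u j, v j) \<in> rise_region k t"
      then have "e j > 0" using energy_pos[OF k(1), of "(u j, v j)"] by (simp add: rise_region_def e_def)
      moreover have "2 / (real k + 1) * (e0 - u0 ^ (k + 1)) = v0\<^sup>2" by (simp add: e0_def energy_def)
      ultimately show "2 / (real k + 1) * ((e j - e0) - (u j ^ (k + 1) - u0 ^ (k + 1))) =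
        2 / (real k + 1) * (b j powr (- (real k + 1)) - u j ^ (k + 1)) - v0\<^sup>2"
        by (simp only: e_eq right_diff_distrib)
    qed
    show "(\<lambda>j. 2 / (real k + 1) * (b j powr (- (real k + 1)) - u j ^ (k + 1)) - v0\<^sup>2) \<in> ?h"
      by (rule landau_o.big.in_cong[THEN iffD1, OF h2 h1])
    show "polyasym \<theta> (\<lambda>j. 2 / (real k + 1) * (b j powr (- (real k + 1)) - u j ^ (k + 1)))"
      using \<theta> by (intro polyasym_cmult polyasym_diff pe polyasym_power u) auto
  qed (use \<theta> in simp)
  show ?thesis
  proof (rule polyasym_cong[OF _ pv])
    show "\<forall>\<^sub>F j in sequentially. (2 / (real k + 1) * (b j powr (- (real k + 1)) - u j ^ (k + 1))) powr (1 / 2) = v j"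
      using ev
    proof (rule eventually_mono)
      fix j assume j: "(u j, v j) \<in> rise_region k t"
      then have v: "v j > 0" by (simp add: rise_region_def)
      then have "e j > 0" using energy_pos[OF k(1), of "(u j, v j)"] by (simp add: e_def)
      then have "b j powr (- (real k + 1)) = e j" by (rule e_eq)
      then show "(2 / (real k + 1) * (b j powr (- (real k + 1)) - u j ^ (k + 1))) powr (1 / 2) = v j"
        using snd_eq_powr[of "(u j, v j)" k] v k by (simp add: e_def)
    qed
  qed
qed

section \<open>Lattice sums\<close>

lemma jbr_ge_1: "jbr n \<ge> 1"
  by (simp add: jbr_def sum_nonneg)

lemma jbr_pos [simp]: "jbr n > 0" using jbr_ge_1[of n] by simp

lemma jbr_minus [simp]: "jbr (- n) = jbr n" by (simp add: jbr_def)

lemma jbr_power2: "(jbr n)\<^sup>2 = 1 + (\<Sum>i\<in>UNIV. (real_of_int (n$i))\<^sup>2)"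
  by (simp add: jbr_def sum_nonneg)

lemma component_square_le: "1 + (real_of_int (n$i))\<^sup>2 \<le> (jbr n)\<^sup>2"
  unfolding jbr_power2 using member_le_sum[of i UNIV "\<lambda>i. (real_of_int (n$i))\<^sup>2"] by simp

lemma abs_component_le_jbr: "\<bar>real_of_int (n$i)\<bar> \<le> jbr n"
proof (rule power2_le_imp_le)
  show "\<bar>real_of_int (n$i)\<bar>\<^sup>2 \<le> (jbr n)\<^sup>2" using component_square_le[of n i] by simp
qed (simp add: less_imp_le)

lemma bij_betw_cube: "bij_betw vec_nth (cube N) (PiE UNIV (\<lambda>_. {- int N..int N}))"
proof (rule bij_betwI[where g = vec_lambda])
  show "vec_nth \<in> cube N \<rightarrow> PiE UNIV (\<lambda>_. {- int N..int N})"
  proof (rule funcsetI, rule PiE_I)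
    fix x :: "int^3" and i :: 3 assume "x \<in> cube N"
    then have "\<bar>x $ i\<bar> \<le> int N" by (simp add: cube_def)
    then show "x $ i \<in> {- int N..int N}" unfolding atLeastAtMost_iff by linarith
  qed simp
  show "vec_lambda \<in> PiE UNIV (\<lambda>_. {- int N..int N}) \<rightarrow> cube N"
  proof (rule funcsetI)
    fix h :: "3 \<Rightarrow> int" assume "h \<in> PiE UNIV (\<lambda>_. {- int N..int N})"
    then have "h i \<in> {- int N..int N}" for i by (rule PiE_mem) simp
    then show "vec_lambda h \<in> cube N" by (simp add: cube_def abs_le_iff minus_le_iff)
  qed
qed (simp_all add: fun_eq_iff)

lemma finite_cube [simp]: "finite (cube N)"
  using bij_betw_finite[OF bij_betw_cube] by (simp add: finite_PiE)

lemma cube_mono: "M \<le> N \<Longrightarrow> cube M \<subseteq> cube N"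
  unfolding cube_def by (intro Collect_mono impI allI) (metis of_nat_mono order_trans)

lemma minus_in_cube [simp]: "- n \<in> cube N \<longleftrightarrow> n \<in> cube N"
  by (simp add: cube_def)

lemma jbr_ge_outside_cube: "n \<notin> cube N \<Longrightarrow> real (Suc N) \<le> jbr n"
proof -
  assume "n \<notin> cube N"
  then obtain i where "\<bar>n$i\<bar> > int N" by (auto simp: cube_def not_le)
  then have "real (Suc N) \<le> \<bar>real_of_int (n$i)\<bar>" by linarith
  also have "\<dots> \<le> jbr n" by (rule abs_component_le_jbr)
  finally show ?thesis .
qed

lemma sum_symmetric_interval_le:
  fixes f :: "int \<Rightarrow> real"
  assumes "\<And>l. f (- l) = f l" "\<And>l. f l \<ge> 0"
  shows "(\<Sum>l\<in>{- int N..int N}. f l) \<le> 2 * (\<Sum>i\<le>N. f (int i))"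
proof (induction N)
  case 0 show ?case using assms(2)[of 0] by simp
next
  case (Suc N)
  have "{- int (Suc N)..int (Suc N)} = insert (- int (Suc N)) (insert (int (Suc N)) {- int N..int N})"
    by auto
  then have "(\<Sum>l\<in>{- int (Suc N)..int (Suc N)}. f l) = f (- int (Suc N)) + (f (int (Suc N)) + (\<Sum>l\<in>{- int N..int N}. f l))"
    by (simp add: sum.insert)
  then show ?case using Suc assms(1)[of "int (Suc N)"] by simp
qed

text \<open>\<open>jbr n ^ 6\<close> dominates the product of the three factors
  \<open>1 + n_i^2\<close>, so the sum is at most the cube of a one-dimensional sum with terms of
  order \<open>l powr (- q / 3)\<close>, which converges for \<open>q > 3\<close>.\<close>

lemma jbr_powr_sum_bounded:
  assumes "q > 3"
  shows "\<exists>C. \<forall>N. (\<Sum>n\<in>cube N. jbr n powr (- q)) \<le> C"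
proof -
  define f where "f l = (1 + (real_of_int l)\<^sup>2) powr (- q / 6)" for l
  have f_nn: "f l \<ge> 0" for l by (simp add: f_def)
  have le: "jbr n powr (- q) \<le> (\<Prod>i\<in>UNIV. f (n$i))" for n :: "int^3"
  proof -
    have pos: "0 < 1 + (real_of_int (n$i))\<^sup>2" for i by (simp add: add_pos_nonneg)
    have "(\<Prod>i\<in>UNIV. 1 + (real_of_int (n$i))\<^sup>2) \<le> (\<Prod>i\<in>(UNIV::3 set). (jbr n)\<^sup>2)"
      by (intro prod_mono) (use pos component_square_le in \<open>auto simp: less_imp_le\<close>)
    also have "\<dots> = jbr n ^ 6" by (simp flip: power_mult)
    finally have "(jbr n ^ 6) powr (- q / 6) \<le> (\<Prod>i\<in>UNIV. 1 + (real_of_int (n$i))\<^sup>2) powr (- q / 6)"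
      using assms pos by (intro powr_mono2') (auto intro!: prod_pos)
    also have "jbr n ^ 6 = jbr n powr 6" using powr_realpow[of "jbr n" 6] by simp
    also have "(jbr n powr 6) powr (- q / 6) = jbr n powr (- q)"
      by (simp only: powr_powr) simp
    also have "(\<Prod>i\<in>UNIV. 1 + (real_of_int (n$i))\<^sup>2) powr (- q / 6) = (\<Prod>i\<in>UNIV. f (n$i))"
      unfolding f_def by (simp add: prod_powr_distrib pos less_imp_le)
    finally show ?thesis .
  qed
  have "summable (\<lambda>i. f (int i))"
  proof (rule summable_comparison_test)
    show "summable (\<lambda>i. real i powr (- q / 3))" using assms by (simp add: summable_real_powr_iff)
    have "norm (f (int i)) \<le> real i powr (- q / 3)" if "i \<ge> 1" for i
    proof -
      have "(1 + (real i)\<^sup>2) powr (- q / 6) \<le> ((real i)\<^sup>2) powr (- q / 6)"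
        using assms that by (intro powr_mono2') auto
      also have "(real i)\<^sup>2 = real i powr 2" using that powr_realpow[of "real i" 2] by simp
      also have "(real i powr 2) powr (- q / 6) = real i powr (- q / 3)" by (simp only: powr_powr) simp
      finally show ?thesis by (simp add: f_def)
    qed
    then show "\<exists>N. \<forall>n\<ge>N. norm (f (int n)) \<le> real n powr (- q / 3)" by blast
  qed
  then have partial: "(\<Sum>i\<le>N. f (int i)) \<le> (\<Sum>i. f (int i))" for N
    by (intro sum_le_suminf) (auto simp: f_nn)
  have "(\<Sum>n\<in>cube N. jbr n powr (- q)) \<le> (2 * (\<Sum>i. f (int i))) ^ 3" for N
  proof -
    have "(\<Sum>n\<in>cube N. jbr n powr (- q)) \<le> (\<Sum>n\<in>cube N. \<Prod>i\<in>UNIV. f (n$i))"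
      by (intro sum_mono le)
    also have "\<dots> = (\<Sum>h\<in>PiE UNIV (\<lambda>_. {- int N..int N}). \<Prod>i\<in>(UNIV :: 3 set). f (h i))"
      by (rule sum.reindex_bij_betw[OF bij_betw_cube])
    also have "\<dots> = (\<Prod>i\<in>(UNIV :: 3 set). \<Sum>l\<in>{- int N..int N}. f l)"
      by (subst prod_sum_PiE) auto
    also have "\<dots> = (\<Sum>l\<in>{- int N..int N}. f l) ^ 3" by simp
    also have "\<dots> \<le> (2 * (\<Sum>i. f (int i))) ^ 3"
    proof (rule power_mono)
      have "(\<Sum>l\<in>{- int N..int N}. f l) \<le> 2 * (\<Sum>i\<le>N. f (int i))"
        by (rule sum_symmetric_interval_le) (auto simp: f_def)
      then show "(\<Sum>l\<in>{- int N..int N}. f l) \<le> 2 * (\<Sum>i. f (int i))" using partial[of N] by linarith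
    qed (auto intro: sum_nonneg f_nn)
    finally show ?thesis .
  qed
  then show ?thesis by blast
qed

section \<open>The half-lattice and the symmetry between \<open>n\<close> and
  \<open>- n\<close>\<close>

lemma lex_pos_cases: "n = 0 \<or> lex_pos n \<or> lex_pos (- n)"
  unfolding lex_pos_def vec_eq_iff forall_3 by (simp, linarith)

lemma not_lex_pos_0 [simp]: "\<not> lex_pos 0" by (simp add: lex_pos_def)

lemma not_lex_pos_minus: "lex_pos n \<Longrightarrow> \<not> lex_pos (- n)"
  by (auto simp: lex_pos_def)

text \<open>Folds \<open>n\<close> and \<open>- n\<close> together, since independence is available
  only for the variables of the half-lattice.\<close>

lemma sum_even_half_lattice:
  fixes f :: "int^3 \<Rightarrow> real"
  assumes "finite F" "\<And>n. n \<in> F \<Longrightarrow> - n \<in> F" "\<And>n. f (- n) = f n"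
  shows "(\<Sum>n\<in>F. f n) = (\<Sum>n\<in>F \<inter> ({0} \<union> {n. lex_pos n}). if n = 0 then f n else 2 * f n)"
proof -
  let ?P = "{n \<in> F. lex_pos n}" and ?M = "{n \<in> F. lex_pos (- n)}" and ?Z = "F \<inter> {0}"
  have F: "F = ?Z \<union> (?P \<union> ?M)" using lex_pos_cases by blast
  have "(\<Sum>n\<in>F. f n) = (\<Sum>n\<in>?Z. f n) + ((\<Sum>n\<in>?P. f n) + (\<Sum>n\<in>?M. f n))"
  proof -
    have 1: "(\<Sum>n\<in>?P \<union> ?M. f n) = (\<Sum>n\<in>?P. f n) + (\<Sum>n\<in>?M. f n)"
      using assms(1) not_lex_pos_minus by (intro sum.union_disjoint) auto
    have 2: "(\<Sum>n\<in>?Z \<union> (?P \<union> ?M). f n) = (\<Sum>n\<in>?Z. f n) + (\<Sum>n\<in>?P \<union> ?M. f n)"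
      using assms(1) by (intro sum.union_disjoint) auto
    show ?thesis using arg_cong[OF F, of "sum f"] 1 2 by (simp only:)
  qed
  also have "(\<Sum>n\<in>?M. f n) = (\<Sum>n\<in>?P. f n)"
    by (rule sum.reindex_bij_witness[where i = uminus and j = uminus]) (use assms in auto)
  also have "(\<Sum>n\<in>?Z. f n) + ((\<Sum>n\<in>?P. f n) + (\<Sum>n\<in>?P. f n)) =
    (\<Sum>n\<in>?Z. if n = 0 then f n else 2 * f n) + (\<Sum>n\<in>?P. if n = 0 then f n else 2 * f n)"
  proof -
    have "(\<Sum>n\<in>?P. if n = 0 then f n else 2 * f n) = (\<Sum>n\<in>?P. 2 * f n)" by (rule sum.cong) auto
    moreover have "(\<Sum>n\<in>?Z. if n = 0 then f n else 2 * f n) = (\<Sum>n\<in>?Z. f n)" by (rule sum.cong) auto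
    ultimately show ?thesis by (simp add: sum_distrib_left[symmetric])
  qed
  also have "\<dots> = (\<Sum>n\<in>?Z \<union> ?P. if n = 0 then f n else 2 * f n)"
    by (rule sum.union_disjoint[symmetric]) (use assms(1) in auto)
  also have "?Z \<union> ?P = F \<inter> ({0} \<union> {n. lex_pos n})" by auto
  finally show ?thesis .
qed

section \<open>Gaussian trigonometric sums\<close>

text \<open>Lets a density on the complex plane be read as a joint density of real and imaginary
  parts.\<close>

lemma lborel_complex:
  "(lborel :: complex measure) = distr (lborel \<Otimes>\<^sub>M lborel) borel (\<lambda>(x, y). Complex x y)"
proof (rule lborel_eqI)
  fix l u :: complex
  assume le: "\<And>b. b \<in> Basis \<Longrightarrow> l \<bullet> b \<le> u \<bullet> b"
  have meas: "(\<lambda>(x, y). Complex x y) \<in> borel_measurable (lborel \<Otimes>\<^sub>M lborel)"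
    unfolding Complex_eq by measurable
  have vim: "(\<lambda>(x, y). Complex x y) -` box l u \<inter> space (lborel \<Otimes>\<^sub>M lborel) = {Re l<..<Re u} \<times> {Im l<..<Im u}"
    by (auto simp: box_def Basis_complex_def space_pair_measure)
  have "Re l \<le> Re u" "Im l \<le> Im u" using le[of 1] le[of \<i>] by (auto simp: Basis_complex_def)
  then have "emeasure (lborel \<Otimes>\<^sub>M lborel) ({Re l<..<Re u} \<times> {Im l<..<Im u}) =
      ennreal (Re u - Re l) * ennreal (Im u - Im l)"
    by (subst lborel.emeasure_pair_measure_Times) auto
  also have "\<dots> = ennreal (\<Prod>b\<in>Basis. (u - l) \<bullet> b)"
    using \<open>Re l \<le> Re u\<close> \<open>Im l \<le> Im u\<close> by (simp add: Basis_complex_def ennreal_mult)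
  finally show "emeasure (distr (lborel \<Otimes>\<^sub>M lborel) borel (\<lambda>(x, y). Complex x y)) (box l u) = ennreal (\<Prod>b\<in>Basis. (u - l) \<bullet> b)"
    by (subst emeasure_distr[OF meas]) (auto simp: vim)
qed simp

text \<open>The density \<open>exp (- |z|^2) / pi\<close> factors into two centred normal densities
  of variance 1/2.\<close>

lemma (in prob_space) std_complex_gaussian_parts:
  assumes "std_complex_gaussian M X"
  shows "distributed M lborel (\<lambda>\<omega>. Re (X \<omega>)) (normal_density 0 (1 / sqrt 2))"
    "distributed M lborel (\<lambda>\<omega>. Im (X \<omega>)) (normal_density 0 (1 / sqrt 2))"
    "indep_var borel (\<lambda>\<omega>. Re (X \<omega>)) borel (\<lambda>\<omega>. Im (X \<omega>))"
proof -
  let ?d = "normal_density 0 (1 / sqrt 2)"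
  let ?f = "\<lambda>z. ennreal (exp (- ((cmod z)^2)) / pi)"
  let ?P = "(lborel :: real measure) \<Otimes>\<^sub>M (lborel :: real measure)"
  let ?C = "\<lambda>(x, y). Complex x y"
  have X[measurable]: "X \<in> borel_measurable M"
    and Xd: "distr M lborel X = density lborel ?f"
    using assms unfolding std_complex_gaussian_def distributed_def by auto
  have [measurable]: "?C \<in> borel_measurable ?P" unfolding Complex_eq by measurable
  have dens: "?f (Complex x y) = ennreal (?d x) * ennreal (?d y)" for x y
  proof -
    have "exp (- ((cmod (Complex x y))\<^sup>2)) / pi = ?d x * ?d y"
      by (simp add: normal_density_def cmod_power2 power_divide exp_add[symmetric] exp_minus field_simps)
    then show ?thesis by (simp add: ennreal_mult')
  qed
  have "distr M (borel \<Otimes>\<^sub>M borel) (\<lambda>\<omega>. (Re (X \<omega>), Im (X \<omega>))) =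
      distr (distr M lborel X) (borel \<Otimes>\<^sub>M borel) (\<lambda>z. (Re z, Im z))"
    by (subst distr_distr) (auto simp: o_def)
  also have "\<dots> = distr (density (distr ?P borel ?C) ?f) (borel \<Otimes>\<^sub>M borel) (\<lambda>z. (Re z, Im z))"
    unfolding Xd by (subst (1) lborel_complex) simp
  also have "\<dots> = distr (distr (density ?P (\<lambda>p. ?f (?C p))) borel ?C) (borel \<Otimes>\<^sub>M borel) (\<lambda>z. (Re z, Im z))"
    by (subst density_distr) auto
  also have "\<dots> = distr (density ?P (\<lambda>p. ?f (?C p))) (borel \<Otimes>\<^sub>M borel) (\<lambda>p. p)"
    by (subst distr_distr) (auto simp: o_def case_prod_beta)
  also have "\<dots> = density ?P (\<lambda>p. ?f (?C p))"
    by (rule distr_id2) (auto cong: sets_pair_measure_cong)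
  also have "\<dots> = density ?P (\<lambda>(x, y). ennreal (?d x) * ennreal (?d y))"
    by (intro arg_cong[where f = "density ?P"]) (auto simp: dens fun_eq_iff)
  finally have joint: "distr M (borel \<Otimes>\<^sub>M borel) (\<lambda>\<omega>. (Re (X \<omega>), Im (X \<omega>))) =
      density ?P (\<lambda>(x, y). ennreal (?d x) * ennreal (?d y))" .
  have prob: "prob_space (density lborel ?d)" by (rule prob_space_normal_density) simp
  then interpret d: prob_space "density lborel ?d" .
  have prod: "density lborel ?d \<Otimes>\<^sub>M density lborel ?d = density ?P (\<lambda>(x, y). ennreal (?d x) * ennreal (?d y))"
    by (intro pair_measure_density) (auto intro: d.sigma_finite_measure_axioms lborel.sigma_finite_measure_axioms)
  have mR: "distr M borel (\<lambda>\<omega>. Re (X \<omega>)) = density lborel ?d"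
  proof -
    have "distr M borel (\<lambda>\<omega>. Re (X \<omega>)) = distr (distr M (borel \<Otimes>\<^sub>M borel) (\<lambda>\<omega>. (Re (X \<omega>), Im (X \<omega>)))) borel fst"
      by (subst distr_distr) (auto simp: o_def)
    also have "\<dots> = distr (density lborel ?d \<Otimes>\<^sub>M density lborel ?d) (density lborel ?d) fst"
      unfolding joint prod by (rule distr_cong) auto
    also have "\<dots> = density lborel ?d" by (subst d.distr_pair_fst) auto
    finally show ?thesis .
  qed
  have mI: "distr M borel (\<lambda>\<omega>. Im (X \<omega>)) = density lborel ?d"
  proof -
    have "distr M borel (\<lambda>\<omega>. Im (X \<omega>)) = distr (distr M (borel \<Otimes>\<^sub>M borel) (\<lambda>\<omega>. (Re (X \<omega>), Im (X \<omega>)))) borel snd"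
      by (subst distr_distr) (auto simp: o_def)
    also have "\<dots> = distr (density lborel ?d \<Otimes>\<^sub>M density lborel ?d) (density lborel ?d) snd"
      unfolding joint prod by (rule distr_cong) auto
    also have "\<dots> = density lborel ?d"
    proof (rule measure_eqI)
      fix A assume "A \<in> sets (distr (density lborel ?d \<Otimes>\<^sub>M density lborel ?d) (density lborel ?d) snd)"
      then have A: "A \<in> sets (density lborel ?d)" by simp
      have "emeasure (distr (density lborel ?d \<Otimes>\<^sub>M density lborel ?d) (density lborel ?d) snd) A =
          emeasure (density lborel ?d \<Otimes>\<^sub>M density lborel ?d) (space (density lborel ?d) \<times> A)"
        using A sets.sets_into_space[OF A]
        by (subst emeasure_distr) (auto intro!: arg_cong2[where f = emeasure] simp: space_pair_measure)
      also have "\<dots> = emeasure (density lborel ?d) A"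
        using A d.emeasure_space_1 by (subst d.emeasure_pair_measure_Times) auto
      finally show "emeasure (distr (density lborel ?d \<Otimes>\<^sub>M density lborel ?d) (density lborel ?d) snd) A =
        emeasure (density lborel ?d) A" .
    qed simp
    finally show ?thesis .
  qed
  have lb: "distr M lborel Z = distr M borel Z" for Z :: "'a \<Rightarrow> real" by (rule distr_cong) auto
  show "distributed M lborel (\<lambda>\<omega>. Re (X \<omega>)) ?d" "distributed M lborel (\<lambda>\<omega>. Im (X \<omega>)) ?d"
    unfolding distributed_def lb mR mI by auto
  show "indep_var borel (\<lambda>\<omega>. Re (X \<omega>)) borel (\<lambda>\<omega>. Im (X \<omega>))"
    unfolding indep_var_distribution_eq mR mI joint prod by simp
qed

lemma (in prob_space) std_complex_gaussian_linear:
  assumes X: "std_complex_gaussian M X" and w: "w \<noteq> 0"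
  shows "distributed M lborel (\<lambda>\<omega>. Re (w * X \<omega>)) (normal_density 0 (cmod w / sqrt 2))"
proof -
  note p = std_complex_gaussian_parts[OF X]
  have R: "distributed M lborel (\<lambda>\<omega>. Re w * Re (X \<omega>)) (normal_density 0 (\<bar>Re w\<bar> * (1 / sqrt 2)))" if "Re w \<noteq> 0"
    using normal_density_affine[OF p(1), of "Re w" 0] that by simp
  have I: "distributed M lborel (\<lambda>\<omega>. - Im w * Im (X \<omega>)) (normal_density 0 (\<bar>Im w\<bar> * (1 / sqrt 2)))" if "Im w \<noteq> 0"
    using normal_density_affine[OF p(2), of "- Im w" 0] that by simp
  \<comment> \<open>A vanishing part of \<open>w\<close> is treated apart, because a normal density
    needs a positive deviation.\<close>
  consider "Re w = 0" "Im w \<noteq> 0" | "Re w \<noteq> 0" "Im w = 0" | "Re w \<noteq> 0" "Im w \<noteq> 0"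
    using w by (auto simp: complex_eq_iff)
  then show ?thesis
  proof cases
    case 1
    then have "cmod w = \<bar>Im w\<bar>" by (simp add: cmod_def)
    with 1 I show ?thesis by simp
  next
    case 2
    then have "cmod w = \<bar>Re w\<bar>" by (simp add: cmod_def)
    with 2 R show ?thesis by simp
  next
    case 3
    have ind: "indep_var borel ((\<lambda>x. Re w * x) \<circ> (\<lambda>\<omega>. Re (X \<omega>))) borel ((\<lambda>x. - Im w * x) \<circ> (\<lambda>\<omega>. Im (X \<omega>)))"
      by (rule indep_var_compose[OF p(3)]) auto
    have "distributed M lborel (\<lambda>\<omega>. Re w * Re (X \<omega>) + - Im w * Im (X \<omega>))
        (normal_density (0 + 0) (sqrt ((\<bar>Re w\<bar> * (1 / sqrt 2))\<^sup>2 + (\<bar>Im w\<bar> * (1 / sqrt 2))\<^sup>2)))"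
      using 3 ind by (intro add_indep_normal R I) (auto simp: o_def)
    moreover have "sqrt ((\<bar>Re w\<bar> * (1 / sqrt 2))\<^sup>2 + (\<bar>Im w\<bar> * (1 / sqrt 2))\<^sup>2) = cmod w / sqrt 2"
      by (simp add: cmod_def power_mult_distrib power_divide flip: real_sqrt_divide add_divide_distrib)
    ultimately show ?thesis by simp
  qed
qed

section \<open>Gaussian sums over symmetric sets of frequencies\<close>

locale gaussian_family = prob_space M for M :: "'w measure" +
  fixes \<gamma> :: "int^3 \<Rightarrow> 'w \<Rightarrow> complex"
  assumes indep: "indep_vars (\<lambda>_. borel) \<gamma> ({0} \<union> {n. lex_pos n})"
    and gauss: "lex_pos n \<Longrightarrow> std_complex_gaussian M (\<gamma> n)"
    and gauss_0: "std_real_gaussian M (\<gamma> 0)"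
    and conj_sym: "\<gamma> (- n) \<omega> = cnj (\<gamma> n \<omega>)"
begin

lemma \<gamma>_measurable [measurable]: "\<gamma> n \<in> borel_measurable M"
proof -
  have *: "\<gamma> n \<in> borel_measurable M" if "n = 0 \<or> lex_pos n" for n
    using indep that by (auto simp: indep_vars_def2)
  show ?thesis
  proof (cases "n = 0 \<or> lex_pos n")
    case False
    then have "lex_pos (- n)" using lex_pos_cases by blast
    then have "\<gamma> (- n) \<in> borel_measurable M" by (intro *) simp
    then have "(\<lambda>\<omega>. cnj (\<gamma> (- n) \<omega>)) \<in> borel_measurable M"
      by (rule measurable_compose) (intro borel_measurable_continuous_onI continuous_intros)
    then show ?thesis by (simp add: conj_sym)
  qed (rule *)
qed

definition herm :: "(int^3 \<Rightarrow> complex) \<Rightarrow> bool" where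
  "herm a \<longleftrightarrow> (\<forall>n. a (- n) = cnj (a n))"

text \<open>The joint contribution of \<open>n\<close> and \<open>- n\<close> for Hermitian
  coefficients, with 0 contributing alone.\<close>

definition gpart :: "(int^3 \<Rightarrow> complex) \<Rightarrow> int^3 \<Rightarrow> 'w \<Rightarrow> real" where
  "gpart a n \<omega> = (if n = 0 then Re (a n * \<gamma> n \<omega>) else 2 * Re (a n * \<gamma> n \<omega>))"

lemma sum_eq_gpart:
  assumes "finite F" "\<And>n. n \<in> F \<Longrightarrow> - n \<in> F" "herm a"
  shows "(\<Sum>n\<in>F. Re (a n * \<gamma> n \<omega>)) = (\<Sum>n\<in>F \<inter> ({0} \<union> {n. lex_pos n}). gpart a n \<omega>)"
  unfolding gpart_def
  by (rule sum_even_half_lattice) (use assms in \<open>auto simp: herm_def conj_sym\<close>)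

lemma sum_norm_eq_half:
  assumes "finite F" "\<And>n. n \<in> F \<Longrightarrow> - n \<in> F" "herm a"
  shows "(\<Sum>n\<in>F. (cmod (a n))\<^sup>2) =
    (\<Sum>n\<in>F \<inter> ({0} \<union> {n. lex_pos n}). if n = 0 then (cmod (a n))\<^sup>2 else 2 * (cmod (a n))\<^sup>2)"
  by (rule sum_even_half_lattice) (use assms in \<open>auto simp: herm_def\<close>)

lemma gpart_normal:
  assumes "herm a" "n = 0 \<or> lex_pos n" "a n \<noteq> 0"
  shows "distributed M lborel (gpart a n)
    (normal_density 0 (if n = 0 then cmod (a n) else sqrt 2 * cmod (a n)))"
proof (cases "n = 0")
  case True
  have a0: "Im (a 0) = 0" using assms(1) unfolding herm_def by (metis add.inverse_neutral complex_cnj complex_surj minus_zero Reals_cnj_iff complex_is_Real_iff)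
  then have "cmod (a 0) = \<bar>Re (a 0)\<bar>" "Re (a 0) \<noteq> 0"
    using assms True by (auto simp: cmod_def complex_eq_iff)
  then show ?thesis
    using normal_density_affine[of "\<lambda>\<omega>. Re (\<gamma> 0 \<omega>)" 0 1 "Re (a 0)" 0] gauss_0 a0 True
    by (simp add: std_real_gaussian_def gpart_def[abs_def])
next
  case False
  then have "distributed M lborel (\<lambda>\<omega>. Re ((2 * a n) * \<gamma> n \<omega>)) (normal_density 0 (cmod (2 * a n) / sqrt 2))"
    using assms by (intro std_complex_gaussian_linear gauss) auto
  moreover have "cmod (2 * a n) / sqrt 2 = sqrt 2 * cmod (a n)"
    by (simp add: norm_mult field_simps)
  moreover have "gpart a n = (\<lambda>\<omega>. Re ((2 * a n) * \<gamma> n \<omega>))"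
    using False by (auto simp: gpart_def fun_eq_iff algebra_simps)
  ultimately show ?thesis using False by simp
qed

lemma indep_gpart: "indep_vars (\<lambda>_. borel) (gpart a) ({0} \<union> {n. lex_pos n})"
proof -
  have "indep_vars (\<lambda>_. borel) (\<lambda>n \<omega>. (\<lambda>z. if n = 0 then Re (a n * z) else 2 * Re (a n * z)) (\<gamma> n \<omega>)) ({0} \<union> {n. lex_pos n})"
    by (rule indep_vars_compose2[OF indep]) auto
  then show ?thesis by (simp add: gpart_def[abs_def])
qed

text \<open>A pair contributes variance \<open>2^2 * |a n|^2 / 2\<close>, which is its share
  \<open>|a n|^2 + |a (- n)|^2\<close> of the full sum.\<close>

lemma symmetric_sum_normal:
  assumes F: "finite F" "\<And>n. n \<in> F \<Longrightarrow> - n \<in> F" and a: "herm a"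
    and pos: "(\<Sum>n\<in>F. (cmod (a n))\<^sup>2) > 0"
  shows "distributed M lborel (\<lambda>\<omega>. \<Sum>n\<in>F. Re (a n * \<gamma> n \<omega>)) (normal_density 0 (sqrt (\<Sum>n\<in>F. (cmod (a n))\<^sup>2)))"
proof -
  let ?H = "F \<inter> ({0} \<union> {n. lex_pos n})"
  \<comment> \<open>Zero coefficients are dropped: their contribution has no density.\<close>
  let ?I = "{n \<in> ?H. a n \<noteq> 0}"
  let ?\<sigma> = "\<lambda>n. if n = 0 then cmod (a n) else sqrt 2 * cmod (a n)"
  have var: "(\<Sum>n\<in>F. (cmod (a n))\<^sup>2) = (\<Sum>n\<in>?I. (?\<sigma> n)\<^sup>2)"
  proof -
    have "(\<Sum>n\<in>F. (cmod (a n))\<^sup>2) = (\<Sum>n\<in>?H. if n = 0 then (cmod (a n))\<^sup>2 else 2 * (cmod (a n))\<^sup>2)"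
      by (rule sum_norm_eq_half, fact+)
    also have "\<dots> = (\<Sum>n\<in>?I. (?\<sigma> n)\<^sup>2)"
      by (rule sum.mono_neutral_cong_right) (use F(1) in \<open>auto simp: power_mult_distrib\<close>)
    finally show ?thesis .
  qed
  have "(\<lambda>\<omega>. \<Sum>n\<in>F. Re (a n * \<gamma> n \<omega>)) = (\<lambda>\<omega>. \<Sum>n\<in>?I. gpart a n \<omega>)"
  proof
    fix \<omega>
    have "(\<Sum>n\<in>F. Re (a n * \<gamma> n \<omega>)) = (\<Sum>n\<in>?H. gpart a n \<omega>)"
      by (rule sum_eq_gpart, fact+)
    also have "\<dots> = (\<Sum>n\<in>?I. gpart a n \<omega>)"
      by (rule sum.mono_neutral_right) (use F(1) in \<open>auto simp: gpart_def\<close>)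
    finally show "(\<Sum>n\<in>F. Re (a n * \<gamma> n \<omega>)) = (\<Sum>n\<in>?I. gpart a n \<omega>)" .
  qed
  moreover have "distributed M lborel (\<lambda>\<omega>. \<Sum>n\<in>?I. gpart a n \<omega>)
      (normal_density (\<Sum>n\<in>?I. 0) (sqrt (\<Sum>n\<in>?I. (?\<sigma> n)\<^sup>2)))"
  proof (rule sum_indep_normal)
    show "?I \<noteq> {}"
    proof
      assume "?I = {}"
      then have "(\<Sum>n\<in>F. (cmod (a n))\<^sup>2) = 0" unfolding var by (simp only: sum.empty)
      with pos show False by simp
    qed
    show "indep_vars (\<lambda>i. borel) (gpart a) ?I" by (rule indep_vars_subset[OF indep_gpart]) auto
    show "distributed M lborel (gpart a n) (normal_density 0 (?\<sigma> n))" if "n \<in> ?I" for n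
      using that by (intro gpart_normal a) auto
  qed (use F(1) in auto)
  ultimately show ?thesis using var by simp
qed

lemma symmetric_sum_second_moment:
  assumes F: "finite F" "\<And>n. n \<in> F \<Longrightarrow> - n \<in> F" and a: "herm a"
  shows "(\<integral>\<^sup>+\<omega>. ennreal ((\<Sum>n\<in>F. Re (a n * \<gamma> n \<omega>))\<^sup>2) \<partial>M) = ennreal (\<Sum>n\<in>F. (cmod (a n))\<^sup>2)"
proof (cases "(\<Sum>n\<in>F. (cmod (a n))\<^sup>2) > 0")
  case True
  define \<sigma> where "\<sigma> = sqrt (\<Sum>n\<in>F. (cmod (a n))\<^sup>2)"
  have \<sigma>: "\<sigma> > 0" "\<sigma>\<^sup>2 = (\<Sum>n\<in>F. (cmod (a n))\<^sup>2)" using True by (auto simp: \<sigma>_def)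
  let ?S = "\<lambda>\<omega>. \<Sum>n\<in>F. Re (a n * \<gamma> n \<omega>)"
  have D: "distributed M lborel ?S (normal_density 0 \<sigma>)"
    unfolding \<sigma>_def by (rule symmetric_sum_normal, fact+)
  have int: "integrable M (\<lambda>\<omega>. (?S \<omega>)\<^sup>2)"
    using integrable_normal_moment[OF \<sigma>(1), of 0 2]
      distributed_integrable[OF D, of "\<lambda>x. x\<^sup>2"] by simp
  have "expectation ?S = 0" using normal_distributed_expectation[OF \<sigma>(1) D] .
  then have "expectation (\<lambda>\<omega>. (?S \<omega>)\<^sup>2) = \<sigma>\<^sup>2" using normal_distributed_variance[OF \<sigma>(1) D] by simp
  then show ?thesis using nn_integral_eq_integral[OF int] \<sigma> by simp
next
  case False
  then have "(\<Sum>n\<in>F. (cmod (a n))\<^sup>2) = 0" by (simp add: sum_nonneg order_antisym not_less)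
  then have "a n = 0" if "n \<in> F" for n using F(1) that by (simp add: sum_nonneg_eq_0_iff)
  then show ?thesis by simp
qed

end

text \<open>Thanks to \<open>\<theta> < \<theta>'\<close> the squares of \<open>X j\<close>, divided
  by \<open>dy j powr (2 * \<theta>)\<close>, have expectations bounded by a convergent geometric
  series; so their sum is finite almost surely and the terms tend to 0.\<close>

lemma AE_bigo_of_second_moments:
  fixes X :: "nat \<Rightarrow> 'w \<Rightarrow> real"
  assumes [measurable]: "\<And>j. X j \<in> borel_measurable M"
    and m: "\<And>j. (\<integral>\<^sup>+\<omega>. ennreal ((X j \<omega>)\<^sup>2) \<partial>M) \<le> ennreal (C * dy j powr (2 * \<theta>'))"
    and \<theta>: "\<theta> < \<theta>'" and C: "C \<ge> 0"
  shows "AE \<omega> in M. (\<lambda>j. X j \<omega>) \<in> ody \<theta>"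
proof -
  define \<rho> where "\<rho> = (1/2::real) powr (2 * (\<theta>' - \<theta>))"
  have \<rho>: "0 < \<rho>" "\<rho> < 1"
    using \<theta> powr_less_mono2_neg[of "-(2 * (\<theta>' - \<theta>))" 1 2] by (auto simp: \<rho>_def powr_divide)
  have \<rho>j: "dy j powr (2 * \<theta>') / dy j powr (2 * \<theta>) = \<rho> ^ j" for j
  proof -
    have "\<rho> ^ j = dy j powr (2 * (\<theta>' - \<theta>))"
      unfolding \<rho>_def dy_def by (simp add: powr_powr powr_power mult.commute flip: powr_realpow)
    then show ?thesis by (simp add: powr_diff right_diff_distrib)
  qed
  have "(\<integral>\<^sup>+\<omega>. (\<Sum>j. ennreal ((X j \<omega>)\<^sup>2 / dy j powr (2 * \<theta>))) \<partial>M) =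
      (\<Sum>j. \<integral>\<^sup>+\<omega>. ennreal ((X j \<omega>)\<^sup>2 / dy j powr (2 * \<theta>)) \<partial>M)"
    by (intro nn_integral_suminf) auto
  also have "\<dots> \<le> (\<Sum>j. ennreal (C * \<rho> ^ j))"
  proof (intro suminf_le allI)
    fix j
    have "(\<integral>\<^sup>+\<omega>. ennreal ((X j \<omega>)\<^sup>2 / dy j powr (2 * \<theta>)) \<partial>M) =
        (\<integral>\<^sup>+\<omega>. ennreal (1 / dy j powr (2 * \<theta>)) * ennreal ((X j \<omega>)\<^sup>2) \<partial>M)"
      by (intro nn_integral_cong) (simp flip: ennreal_mult')
    also have "\<dots> = ennreal (1 / dy j powr (2 * \<theta>)) * (\<integral>\<^sup>+\<omega>. ennreal ((X j \<omega>)\<^sup>2) \<partial>M)"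
      by (rule nn_integral_cmult) auto
    also have "\<dots> \<le> ennreal (1 / dy j powr (2 * \<theta>)) * ennreal (C * dy j powr (2 * \<theta>'))"
      by (intro mult_left_mono m) auto
    also have "\<dots> = ennreal (C * \<rho> ^ j)"
      using C by (simp add: \<rho>j[symmetric] flip: ennreal_mult')
    finally show "(\<integral>\<^sup>+\<omega>. ennreal ((X j \<omega>)\<^sup>2 / dy j powr (2 * \<theta>)) \<partial>M) \<le> ennreal (C * \<rho> ^ j)" .
  qed auto
  also have "\<dots> = ennreal (\<Sum>j. C * \<rho> ^ j)"
    using C \<rho> by (intro suminf_ennreal2 summable_mult summable_geometric) auto
  finally have "(\<integral>\<^sup>+\<omega>. (\<Sum>j. ennreal ((X j \<omega>)\<^sup>2 / dy j powr (2 * \<theta>))) \<partial>M) < \<infinity>"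
    by (rule le_less_trans) simp
  then have fin: "(\<integral>\<^sup>+\<omega>. (\<Sum>j. ennreal ((X j \<omega>)\<^sup>2 / dy j powr (2 * \<theta>))) \<partial>M) \<noteq> \<infinity>" by simp
  have "AE \<omega> in M. (\<Sum>j. ennreal ((X j \<omega>)\<^sup>2 / dy j powr (2 * \<theta>))) \<noteq> \<infinity>"
    by (rule nn_integral_PInf_AE[OF _ fin]) measurable
  then show ?thesis
  proof (eventually_elim)
    case (elim \<omega>)
    have "summable (\<lambda>j. (X j \<omega>)\<^sup>2 / dy j powr (2 * \<theta>))"
      using elim by (intro summable_suminf_not_top) auto
    then have "(\<lambda>j. (X j \<omega>)\<^sup>2 / dy j powr (2 * \<theta>)) \<longlonglongrightarrow> 0" by (rule summable_LIMSEQ_zero)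
    then have "\<forall>\<^sub>F j in sequentially. (X j \<omega>)\<^sup>2 / dy j powr (2 * \<theta>) < 1"
      by (rule order_tendstoD) simp
    then have "\<forall>\<^sub>F j in sequentially. norm (X j \<omega>) \<le> 1 * norm (dy j powr \<theta>)"
    proof (rule eventually_mono)
      fix j assume "(X j \<omega>)\<^sup>2 / dy j powr (2 * \<theta>) < 1"
      then have "(X j \<omega>)\<^sup>2 \<le> dy j powr (2 * \<theta>)" by (simp add: field_simps)
      also have "dy j powr (2 * \<theta>) = (dy j powr \<theta>)\<^sup>2" by (simp add: power2_eq_square powr_add[symmetric])
      finally have "\<bar>X j \<omega>\<bar> \<le> dy j powr \<theta>" by (metis abs_le_square_iff abs_of_nonneg powr_ge_zero)
      then show "norm (X j \<omega>) \<le> 1 * norm (dy j powr \<theta>)" by simp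
    qed
    then show ?case by (rule bigoI)
  qed
qed

section \<open>Limits of Gaussian sums over growing cubes\<close>

context gaussian_family
begin

definition gsum :: "(int^3 \<Rightarrow> complex) \<Rightarrow> nat \<Rightarrow> 'w \<Rightarrow> real" where
  "gsum a N \<omega> = (\<Sum>n\<in>cube N. Re (a n * \<gamma> n \<omega>))"

lemma gsum_measurable [measurable]: "gsum a N \<in> borel_measurable M"
  unfolding gsum_def[abs_def] by measurable

text \<open>Outside \<open>cube N\<close> one has \<open>N + 1 \<le> jbr n\<close>, so the weighted
  bound makes the sum over the shells of \<open>(N + 1)^2 * (D N)^2\<close> integrable; pairing with
  \<open>1 / (N + 1)^2\<close> gives absolute convergence of the shell increments.\<close>

lemma gsum_converges:
  assumes a: "herm a" and C: "\<And>N. (\<Sum>n\<in>cube N. (jbr n)\<^sup>2 * (cmod (a n))\<^sup>2) \<le> C"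
  shows "AE \<omega> in M. convergent (\<lambda>N. gsum a N \<omega>)"
proof -
  define D where "D N \<omega> = (\<Sum>n\<in>cube (Suc N) - cube N. Re (a n * \<gamma> n \<omega>))" for N \<omega>
  have [measurable]: "D N \<in> borel_measurable M" for N unfolding D_def[abs_def] by measurable
  have D: "D N \<omega> = gsum a (Suc N) \<omega> - gsum a N \<omega>" for N \<omega>
    unfolding D_def gsum_def by (rule sum_diff) (use cube_mono[of N "Suc N"] in auto)
  have mom: "(\<integral>\<^sup>+\<omega>. ennreal ((D N \<omega>)\<^sup>2) \<partial>M) = ennreal (\<Sum>n\<in>cube (Suc N) - cube N. (cmod (a n))\<^sup>2)" for N
    unfolding D_def by (rule symmetric_sum_second_moment) (use a in auto)
  let ?w = "\<lambda>n. (jbr n)\<^sup>2 * (cmod (a n))\<^sup>2"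
  have "(\<integral>\<^sup>+\<omega>. (\<Sum>N. ennreal ((real (Suc N))\<^sup>2 * (D N \<omega>)\<^sup>2)) \<partial>M) =
      (\<Sum>N. \<integral>\<^sup>+\<omega>. ennreal ((real (Suc N))\<^sup>2 * (D N \<omega>)\<^sup>2) \<partial>M)"
    by (intro nn_integral_suminf) auto
  also have "\<dots> \<le> (\<Sum>N. ennreal (\<Sum>n\<in>cube (Suc N) - cube N. ?w n))"
  proof (intro suminf_le allI)
    fix N
    have "(\<integral>\<^sup>+\<omega>. ennreal ((real (Suc N))\<^sup>2 * (D N \<omega>)\<^sup>2) \<partial>M) =
        (\<integral>\<^sup>+\<omega>. ennreal ((real (Suc N))\<^sup>2) * ennreal ((D N \<omega>)\<^sup>2) \<partial>M)"
      by (intro nn_integral_cong) (simp add: ennreal_mult')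
    also have "\<dots> = ennreal ((real (Suc N))\<^sup>2) * ennreal (\<Sum>n\<in>cube (Suc N) - cube N. (cmod (a n))\<^sup>2)"
      by (subst nn_integral_cmult) (auto simp: mom)
    also have "\<dots> = ennreal (\<Sum>n\<in>cube (Suc N) - cube N. (real (Suc N))\<^sup>2 * (cmod (a n))\<^sup>2)"
      by (simp only: sum_distrib_left ennreal_mult'[symmetric] zero_le_power2)
    also have "\<dots> \<le> ennreal (\<Sum>n\<in>cube (Suc N) - cube N. ?w n)"
      by (intro ennreal_leI sum_mono mult_right_mono power_mono jbr_ge_outside_cube) auto
    finally show "(\<integral>\<^sup>+\<omega>. ennreal ((real (Suc N))\<^sup>2 * (D N \<omega>)\<^sup>2) \<partial>M) \<le> ennreal (\<Sum>n\<in>cube (Suc N) - cube N. ?w n)" .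
  qed auto
  also have "\<dots> \<le> ennreal C"
  proof -
    have "(\<Sum>N<K. ennreal (\<Sum>n\<in>cube (Suc N) - cube N. ?w n)) \<le> ennreal C" for K
    proof -
      have "(\<Sum>N<K. ennreal (\<Sum>n\<in>cube (Suc N) - cube N. ?w n)) = ennreal (\<Sum>N<K. \<Sum>n\<in>cube (Suc N) - cube N. ?w n)"
        by (intro sum_ennreal sum_nonneg) auto
      also have "(\<Sum>N<K. \<Sum>n\<in>cube (Suc N) - cube N. ?w n) = (\<Sum>N<K. (\<Sum>n\<in>cube (Suc N). ?w n) - (\<Sum>n\<in>cube N. ?w n))"
        by (intro sum.cong refl sum_diff) (use cube_mono in auto)
      also have "\<dots> = (\<Sum>n\<in>cube K. ?w n) - (\<Sum>n\<in>cube 0. ?w n)"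
        by (rule sum_lessThan_telescope)
      also have "\<dots> \<le> C" using C[of K] sum_nonneg[of "cube 0" ?w] by auto
      finally show ?thesis by (simp add: ennreal_leI)
    qed
    then show ?thesis unfolding suminf_eq_SUP by (intro SUP_least)
  qed
  finally have "(\<integral>\<^sup>+\<omega>. (\<Sum>N. ennreal ((real (Suc N))\<^sup>2 * (D N \<omega>)\<^sup>2)) \<partial>M) < \<infinity>"
    by (rule le_less_trans) simp
  then have fin: "(\<integral>\<^sup>+\<omega>. (\<Sum>N. ennreal ((real (Suc N))\<^sup>2 * (D N \<omega>)\<^sup>2)) \<partial>M) \<noteq> \<infinity>" by simp
  have "AE \<omega> in M. (\<Sum>N. ennreal ((real (Suc N))\<^sup>2 * (D N \<omega>)\<^sup>2)) \<noteq> \<infinity>"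
    by (rule nn_integral_PInf_AE[OF _ fin]) measurable
  then show ?thesis
  proof eventually_elim
    case (elim \<omega>)
    have s1: "summable (\<lambda>N. (real (Suc N))\<^sup>2 * (D N \<omega>)\<^sup>2)"
      using elim by (intro summable_suminf_not_top) auto
    have s2: "summable (\<lambda>N. 1 / (real (Suc N))\<^sup>2)"
      using inverse_power_summable[of 2, where 'a = real] summable_Suc_iff[of "\<lambda>n. inverse ((real n)\<^sup>2)"]
      by (simp add: inverse_eq_divide)
    have "summable (\<lambda>N. D N \<omega>)"
    proof (rule summable_comparison_test'[OF summable_add[OF s2 s1]])
      fix N
      have "2 * ((1 / real (Suc N)) * (real (Suc N) * \<bar>D N \<omega>\<bar>)) \<le> (1 / real (Suc N))\<^sup>2 + (real (Suc N) * \<bar>D N \<omega>\<bar>)\<^sup>2"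
        using sum_squares_bound[of "1 / real (Suc N)" "real (Suc N) * \<bar>D N \<omega>\<bar>"] by (simp only: mult.assoc)
      also have "\<dots> = 1 / (real (Suc N))\<^sup>2 + (real (Suc N))\<^sup>2 * (D N \<omega>)\<^sup>2"
        by (simp add: power_divide power_mult_distrib)
      finally have "2 * \<bar>D N \<omega>\<bar> \<le> 1 / (real (Suc N))\<^sup>2 + (real (Suc N))\<^sup>2 * (D N \<omega>)\<^sup>2" by simp
      then show "norm (D N \<omega>) \<le> 1 / (real (Suc N))\<^sup>2 + (real (Suc N))\<^sup>2 * (D N \<omega>)\<^sup>2"
        using abs_ge_zero[of "D N \<omega>"] unfolding real_norm_def by linarith
    qed
    then have "convergent (\<lambda>K. \<Sum>N<K. D N \<omega>)" by (simp add: summable_iff_convergent)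
    moreover have "(\<Sum>N<K. D N \<omega>) = gsum a K \<omega> - gsum a 0 \<omega>" for K
      unfolding D by (rule sum_lessThan_telescope)
    ultimately have "convergent (\<lambda>K. gsum a K \<omega> - gsum a 0 \<omega>)" by simp
    from convergent_add[OF this convergent_const[of "gsum a 0 \<omega>"]] show ?case by simp
  qed
qed

text \<open>Fatou's lemma: the second moments of the partial sums are known exactly, and their
  common bound survives the limit.\<close>

lemma limit_second_moment:
  assumes a: "herm a" and [measurable]: "S \<in> borel_measurable M"
    and lim: "AE \<omega> in M. (\<lambda>N. gsum a N \<omega>) \<longlonglongrightarrow> S \<omega>"
    and C: "\<And>N. (\<Sum>n\<in>cube N. (cmod (a n))\<^sup>2) \<le> C"
  shows "(\<integral>\<^sup>+\<omega>. ennreal ((S \<omega>)\<^sup>2) \<partial>M) \<le> ennreal C"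
proof -
  have "(\<integral>\<^sup>+\<omega>. ennreal ((S \<omega>)\<^sup>2) \<partial>M) = (\<integral>\<^sup>+\<omega>. liminf (\<lambda>N. ennreal ((gsum a N \<omega>)\<^sup>2)) \<partial>M)"
  proof (rule nn_integral_cong_AE, use lim in eventually_elim)
    case (elim \<omega>)
    then have "(\<lambda>N. ennreal ((gsum a N \<omega>)\<^sup>2)) \<longlonglongrightarrow> ennreal ((S \<omega>)\<^sup>2)"
      by (intro tendsto_intros tendsto_ennrealI)
    then show ?case by (metis lim_imp_Liminf sequentially_bot)
  qed
  also have "\<dots> \<le> liminf (\<lambda>N. \<integral>\<^sup>+\<omega>. ennreal ((gsum a N \<omega>)\<^sup>2) \<partial>M)"
    by (rule nn_integral_liminf) measurable
  also have "\<dots> \<le> ennreal C"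
  proof (rule Liminf_le)
    have "(\<integral>\<^sup>+\<omega>. ennreal ((gsum a N \<omega>)\<^sup>2) \<partial>M) \<le> ennreal C" for N
      unfolding gsum_def using C[of N] by (subst symmetric_sum_second_moment) (use a in \<open>auto intro: ennreal_leI\<close>)
    then show "\<forall>\<^sub>F N in sequentially. (\<integral>\<^sup>+\<omega>. ennreal ((gsum a N \<omega>)\<^sup>2) \<partial>M) \<le> ennreal C" by simp
  qed simp
  finally show ?thesis .
qed

text \<open>An interval of length \<open>2 * K\<close> is integrated against a density that is at
  most \<open>1 / sqrt (2 * pi * \<tau>\<^sup>2)\<close>, hence at most
  \<open>1 / \<sigma>\<close>.\<close>

lemma gsum_anticoncentration:
  assumes a: "herm a" and \<sigma>: "\<sigma> > 0" and v: "\<sigma>\<^sup>2 \<le> (\<Sum>n\<in>cube N. (cmod (a n))\<^sup>2)" and K: "K \<ge> 0"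
  shows "emeasure M {\<omega> \<in> space M. \<bar>gsum a N \<omega>\<bar> \<le> K} \<le> ennreal (2 * K / \<sigma>)"
proof -
  define \<tau> where "\<tau> = sqrt (\<Sum>n\<in>cube N. (cmod (a n))\<^sup>2)"
  have \<tau>: "\<sigma> \<le> \<tau>" unfolding \<tau>_def by (rule real_le_rsqrt) (use v in simp)
  have "\<tau> > 0" using \<tau> \<sigma> by simp
  have D: "distributed M lborel (gsum a N) (normal_density 0 \<tau>)"
    unfolding gsum_def[abs_def] \<tau>_def
    by (rule symmetric_sum_normal) (use a \<open>\<tau> > 0\<close> in \<open>auto simp: \<tau>_def\<close>)
  have "{\<omega> \<in> space M. \<bar>gsum a N \<omega>\<bar> \<le> K} = gsum a N -` {-K..K} \<inter> space M" by (auto simp: abs_le_iff)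
  then have "emeasure M {\<omega> \<in> space M. \<bar>gsum a N \<omega>\<bar> \<le> K} = (\<integral>\<^sup>+x. ennreal (normal_density 0 \<tau> x) * indicator {-K..K} x \<partial>lborel)"
    using distributed_emeasure[OF D, of "{-K..K}"] by simp
  also have "\<dots> \<le> (\<integral>\<^sup>+x. ennreal (1 / \<sigma>) * indicator {-K..K} x \<partial>lborel)"
  proof (intro nn_integral_mono mult_right_mono ennreal_leI)
    fix x
    have "normal_density 0 \<tau> x = 1 / sqrt (2 * pi * \<tau>\<^sup>2) * exp (- (x\<^sup>2 / (2 * \<tau>\<^sup>2)))"
      by (simp add: normal_density_def)
    also have "\<dots> \<le> 1 / sqrt (2 * pi * \<tau>\<^sup>2) * 1" by (intro mult_left_mono) auto
    also have "sqrt (2 * pi * \<tau>\<^sup>2) \<ge> \<sigma>"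
    proof (rule real_le_rsqrt)
      have "\<sigma>\<^sup>2 \<le> 1 * \<tau>\<^sup>2" using \<tau> \<sigma> by (simp add: power_mono)
      also have "\<dots> \<le> 2 * pi * \<tau>\<^sup>2" using pi_gt3 by (intro mult_right_mono) auto
      finally show "\<sigma>\<^sup>2 \<le> 2 * pi * \<tau>\<^sup>2" .
    qed
    then have "1 / sqrt (2 * pi * \<tau>\<^sup>2) * 1 \<le> 1 / \<sigma>" using \<sigma> by (simp add: frac_le)
    finally show "normal_density 0 \<tau> x \<le> 1 / \<sigma>" .
  qed auto
  also have "\<dots> = ennreal (1 / \<sigma>) * ennreal (2 * K)"
    using K by (subst nn_integral_cmult_indicator) auto
  also have "\<dots> = ennreal (2 * K / \<sigma>)" using \<sigma> K by (simp flip: ennreal_mult')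
  finally show ?thesis .
qed

lemma limit_anticoncentration:
  assumes a: "herm a" and [measurable]: "S \<in> borel_measurable M"
    and lim: "AE \<omega> in M. (\<lambda>N. gsum a N \<omega>) \<longlonglongrightarrow> S \<omega>"
    and \<sigma>: "\<sigma> > 0" and v: "\<forall>\<^sub>F N in sequentially. \<sigma>\<^sup>2 \<le> (\<Sum>n\<in>cube N. (cmod (a n))\<^sup>2)"
    and K: "K > 0"
  shows "emeasure M {\<omega> \<in> space M. \<bar>S \<omega>\<bar> \<le> K} \<le> ennreal (4 * K / \<sigma>)"
proof -
  let ?A = "{\<omega> \<in> space M. \<bar>S \<omega>\<bar> \<le> K}"
  \<comment> \<open>The threshold is doubled so that \<open>|S| \<le> K\<close> puts the partial
    sums eventually below it; this doubles the constant in the bound.\<close>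
  let ?B = "\<lambda>N. {\<omega> \<in> space M. \<bar>gsum a N \<omega>\<bar> \<le> 2 * K}"
  have "emeasure M ?A = (\<integral>\<^sup>+\<omega>. indicator ?A \<omega> \<partial>M)" by simp
  also have "\<dots> \<le> (\<integral>\<^sup>+\<omega>. liminf (\<lambda>N. indicator (?B N) \<omega>) \<partial>M)"
  proof (rule nn_integral_mono_AE, use lim AE_space in eventually_elim)
    case (elim \<omega>)
    show "indicator ?A \<omega> \<le> liminf (\<lambda>N. indicator (?B N) \<omega> :: ennreal)"
    proof (cases "\<omega> \<in> ?A")
      case True
      have "(\<lambda>N. \<bar>gsum a N \<omega>\<bar>) \<longlonglongrightarrow> \<bar>S \<omega>\<bar>" using elim by (intro tendsto_intros)
      then have "\<forall>\<^sub>F N in sequentially. \<bar>gsum a N \<omega>\<bar> < 2 * K"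
        by (rule order_tendstoD) (use True K in auto)
      then have "\<forall>\<^sub>F N in sequentially. (1::ennreal) \<le> indicator (?B N) \<omega>"
        by (rule eventually_mono) (use True in auto)
      then have "1 \<le> liminf (\<lambda>N. indicator (?B N) \<omega> :: ennreal)" by (rule Liminf_bounded)
      then show ?thesis using True by simp
    qed simp
  qed
  also have "\<dots> \<le> liminf (\<lambda>N. \<integral>\<^sup>+\<omega>. indicator (?B N) \<omega> \<partial>M)"
    by (rule nn_integral_liminf) measurable
  also have "\<dots> \<le> ennreal (4 * K / \<sigma>)"
  proof (rule Liminf_le)
    show "\<forall>\<^sub>F N in sequentially. (\<integral>\<^sup>+\<omega>. indicator (?B N) \<omega> \<partial>M) \<le> ennreal (4 * K / \<sigma>)"
      using v
    proof (rule eventually_mono)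
      fix N assume "\<sigma>\<^sup>2 \<le> (\<Sum>n\<in>cube N. (cmod (a n))\<^sup>2)"
      from gsum_anticoncentration[OF a \<sigma> this, of "2 * K"] K
      show "(\<integral>\<^sup>+\<omega>. indicator (?B N) \<omega> \<partial>M) \<le> ennreal (4 * K / \<sigma>)" by simp
    qed
  qed simp
  finally show ?thesis .
qed

end

section \<open>The symbol of the dyadic difference\<close>

definition xp :: "nat \<Rightarrow> real^3" where "xp j = axis 1 (dy j)"

lemma lat_ip_xp: "lat_ip n (xp j) = real_of_int (n$1) * dy j"
  by (simp add: lat_ip_def xp_def axis_def sum_3)

lemma lat_ip_0 [simp]: "lat_ip n 0 = 0" by (simp add: lat_ip_def)

lemma lat_ip_minus: "lat_ip (- n) x = - lat_ip n x"
  by (simp add: lat_ip_def sum_negf)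

text \<open>The Fourier multiplier of the dyadic difference: the combination with coefficients
  \<open>c\<close> sends the sequence \<open>cis (\<eta> * dy j)\<close> to
  \<open>symb N c (\<eta> * dy j)\<close>.\<close>

definition symb :: "nat \<Rightarrow> (nat \<Rightarrow> real) \<Rightarrow> real \<Rightarrow> complex" where
  "symb N c y = (\<Sum>i\<le>N. of_real (c i) * cis (y * dy i))"

text \<open>Vanishing moments give a zero of order \<open>N\<close> at 0, used for
  \<open>|y| \<le> 1\<close>; for larger \<open>y\<close> plain boundedness is enough since
  \<open>\<theta> \<ge> 0\<close>.\<close>

lemma symb_bound:
  assumes c: "\<And>w j. dd N w j = (\<Sum>i\<le>N. c i * w (j + i))" and N: "N \<ge> 1" and \<theta>: "0 \<le> \<theta>" "\<theta> \<le> real N"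
  shows "\<exists>C\<ge>0. \<forall>y. cmod (symb N c y) \<le> C * \<bar>y\<bar> powr \<theta>"
proof -
  define C where "C = (\<Sum>i\<le>N. \<bar>c i\<bar>)"
  have C: "C \<ge> 0" by (simp add: C_def sum_nonneg)
  have bd: "cmod (symb N c y) \<le> C" for y
  proof -
    have "cmod (symb N c y) \<le> (\<Sum>i\<le>N. cmod (of_real (c i) * cis (y * dy i)))"
      unfolding symb_def by (rule norm_sum)
    also have "\<dots> = C" by (simp add: C_def norm_mult)
    finally show ?thesis .
  qed
  obtain N' where N': "N = Suc N'" using N by (cases N) auto
  have mom: "(\<Sum>i\<le>N. c i * dy i ^ l) = 0" if "l < N" for l
  proof -
    have "(\<Sum>i\<le>N. c i * dy i ^ l) = dd N (\<lambda>j. dy j ^ l) 0" by (simp add: c)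
    also have "\<dots> = 0" using that by (auto simp: dd_dy_power prod_zero_iff intro!: bexI[of _ l])
    finally show ?thesis .
  qed
  have vanish: "cmod (symb N c y) \<le> C * \<bar>y\<bar> ^ N" for y
  proof -
    \<comment> \<open>The Taylor polynomial of degree \<open>N - 1\<close>, which the vanishing
      moments cancel.\<close>
    define T where "T x = (\<Sum>l\<le>N'. (\<i> * of_real x) ^ l / fact l)" for x :: real
    have "(\<Sum>i\<le>N. of_real (c i) * T (y * dy i)) = (\<Sum>i\<le>N. \<Sum>l\<le>N'. (\<i> * of_real y) ^ l / fact l * of_real (c i * dy i ^ l))"
      unfolding T_def by (simp add: sum_distrib_left power_mult_distrib mult_ac)
    also have "\<dots> = (\<Sum>l\<le>N'. (\<i> * of_real y) ^ l / fact l * of_real (\<Sum>i\<le>N. c i * dy i ^ l))"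
      by (subst sum.swap) (simp only: of_real_sum sum_distrib_left)
    also have "\<dots> = 0" by (intro sum.neutral ballI) (subst mom, auto simp: N')
    finally have "symb N c y = (\<Sum>i\<le>N. of_real (c i) * (cis (y * dy i) - T (y * dy i)))"
      unfolding symb_def by (simp add: right_diff_distrib sum_subtractf)
    also have "cmod \<dots> \<le> (\<Sum>i\<le>N. \<bar>c i\<bar> * \<bar>y\<bar> ^ N)"
    proof (rule sum_norm_le)
      fix i
      have "cmod (cis (y * dy i) - T (y * dy i)) \<le> \<bar>y * dy i\<bar> ^ Suc N' / fact (Suc N')"
        using iexp_approx1[of "y * dy i" N'] by (simp add: cis_conv_exp T_def)
      also have "\<dots> \<le> \<bar>y * dy i\<bar> ^ Suc N'"
        using divide_left_mono[of 1 "fact (Suc N')" "\<bar>y * dy i\<bar> ^ Suc N'"] by (simp del: fact_Suc power_Suc add: fact_ge_1)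
      also have "\<dots> \<le> \<bar>y\<bar> ^ Suc N'"
        using mult_left_mono[OF dy_le_1[of i], of "\<bar>y\<bar>"] by (intro power_mono) (auto simp: abs_mult less_imp_le)
      finally show "cmod (of_real (c i) * (cis (y * dy i) - T (y * dy i))) \<le> \<bar>c i\<bar> * \<bar>y\<bar> ^ N"
        by (simp add: norm_mult mult_left_mono N')
    qed
    also have "\<dots> = C * \<bar>y\<bar> ^ N" by (simp add: C_def sum_distrib_right)
    finally show ?thesis .
  qed
  have "cmod (symb N c y) \<le> C * \<bar>y\<bar> powr \<theta>" for y
  proof (cases "\<bar>y\<bar> \<le> 1")
    case True
    have "\<bar>y\<bar> ^ N \<le> \<bar>y\<bar> powr \<theta>"
    proof (cases "y = 0")
      case False
      then have "\<bar>y\<bar> ^ N = \<bar>y\<bar> powr real N" by (simp add: powr_realpow)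
      also have "\<dots> \<le> \<bar>y\<bar> powr \<theta>" using True \<theta> by (intro powr_mono') auto
      finally show ?thesis .
    qed (use N in \<open>simp add: power_0_left\<close>)
    then show ?thesis using vanish[of y] C by (meson mult_left_mono order_trans)
  next
    case False
    then have "1 \<le> \<bar>y\<bar> powr \<theta>" using \<theta> by (intro ge_one_powr_ge_zero) auto
    then show ?thesis using bd[of y] C mult_left_mono[of 1 "\<bar>y\<bar> powr \<theta>" C] by simp
  qed
  then show ?thesis using C by blast
qed

text \<open>At \<open>y = 2 ^ N * x\<close> all frequencies are integers, so the symbol is a
  polynomial in \<open>cis x\<close> with exponents \<open>2 ^ (N - i)\<close>. The exponent 1
  occurs only for \<open>i = N\<close>, so the polynomial is nonzero and cannot vanish on an
  arc.\<close>

lemma symb_nonzero: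
  assumes "c N \<noteq> 0"
  shows "\<exists>y>0. symb N c y \<noteq> 0"
proof (rule ccontr)
  assume "\<not> ?thesis"
  then have z: "symb N c y = 0" if "y > 0" for y using that by blast
  define p :: "complex poly" where "p = (\<Sum>i\<le>N. monom (of_real (c i)) (2 ^ (N - i)))"
  have "poly p (cis x) = symb N c (x * 2 ^ N)" for x
  proof -
    have "2 ^ N * dy i = 2 ^ (N - i)" if "i \<le> N" for i
      using that by (simp add: dy_def power_divide power_diff)
    then have "cis x ^ (2 ^ (N - i)) = cis (x * 2 ^ N * dy i)" if "i \<le> N" for i
      using that Complex.DeMoivre[of x "2 ^ (N - i)"] by (simp add: mult_ac)
    then show ?thesis by (simp add: p_def symb_def poly_sum poly_monom)
  qed
  then have roots: "cis ` {0<..<1} \<subseteq> {w. poly p w = 0}" using z by auto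
  have "coeff p 1 = (\<Sum>i\<le>N. if i = N then of_real (c i) else 0)"
    unfolding p_def coeff_sum
  proof (intro sum.cong refl)
    fix i assume "i \<in> {..N}"
    then have "2 ^ (N - i) = (1::nat) \<longleftrightarrow> i = N" by auto
    then show "coeff (monom (of_real (c i) :: complex) (2 ^ (N - i))) 1 = (if i = N then of_real (c i) else 0)"
      by simp
  qed
  then have "coeff p 1 \<noteq> 0" using assms by simp
  then have "p \<noteq> 0" by auto
  then have "finite (cis ` {0<..<1})" using roots poly_roots_finite finite_subset by blast
  moreover have "inj_on cis {0<..<1}"
  proof (rule inj_onI)
    fix x y :: real assume xy: "x \<in> {0<..<1}" "y \<in> {0<..<1}" "cis x = cis y"
    have "cos x = cos y" using arg_cong[OF xy(3), of Re] by simp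
    moreover have "0 \<le> x" "x \<le> pi" "0 \<le> y" "y \<le> pi" using xy(1,2) pi_gt3 by auto
    ultimately show "x = y" using cos_inj_pi by blast
  qed
  ultimately have "finite {0<..<1::real}" by (simp add: finite_image_iff)
  then show False by (simp add: infinite_Ioo)
qed

lemma symb_lower_interval:
  assumes "c N \<noteq> 0"
  shows "\<exists>\<alpha> \<beta> m. 0 < \<alpha> \<and> \<alpha> < \<beta> \<and> 0 < m \<and> (\<forall>y\<in>{\<alpha>..\<beta>}. m \<le> cmod (symb N c y))"
proof -
  obtain y where y: "y > 0" "symb N c y \<noteq> 0" using symb_nonzero[of c N] assms by blast
  define m where "m = cmod (symb N c y) / 2"
  have m: "m > 0" "m < cmod (symb N c y)" using y by (auto simp: m_def)
  have "continuous_on UNIV (\<lambda>y. cmod (symb N c y))"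
    unfolding symb_def by (intro continuous_intros)
  then have "isCont (\<lambda>y. cmod (symb N c y)) y" by (simp add: continuous_on_eq_continuous_at)
  then have "((\<lambda>y. cmod (symb N c y)) \<longlongrightarrow> cmod (symb N c y)) (nhds y)"
    using tendsto_at_iff_tendsto_nhds[of "\<lambda>y. cmod (symb N c y)" y] by (simp add: isCont_def)
  then have "\<forall>\<^sub>F x in nhds y. m < cmod (symb N c x)" by (rule order_tendstoD(1)[OF _ m(2)])
  then obtain d where d: "d > 0" "\<And>x. dist x y < d \<Longrightarrow> m < cmod (symb N c x)"
    unfolding eventually_nhds_metric by blast
  show ?thesis
    using y m d by (intro exI[of _ y] exI[of _ "y + d / 2"] exI[of _ m]) (auto simp: dist_real_def intro!: less_imp_le)
qed

lemma finite_subset_cube: "finite F \<Longrightarrow> \<exists>K. F \<subseteq> cube K"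
proof (induction F rule: finite_induct)
  case empty show ?case by simp
next
  case (insert n F)
  then obtain K where K: "F \<subseteq> cube K" by blast
  define K' where "K' = K + nat (\<bar>n$1\<bar> + \<bar>n$2\<bar> + \<bar>n$3\<bar>)"
  have "n \<in> cube K'" unfolding cube_def K'_def by (simp add: forall_3)
  moreover have "F \<subseteq> cube K'" using K cube_mono[of K K'] by (auto simp: K'_def)
  ultimately show ?case by blast
qed

text \<open>Among the frequencies of size \<open>2^j\<close>, a proportion bounded below has
  \<open>n_1 * dy j\<close> in an interval where the symbol is at least \<open>m\<close>: about
  \<open>2^(3j)\<close> terms of size \<open>2^(-2 j s)\<close> each.\<close>

lemma variance_lower_bound:
  assumes c: "c N \<noteq> 0" and s: "s > 0"
  shows "\<exists>\<kappa>>0. \<forall>\<^sub>F j in sequentially. \<forall>\<^sub>F K in sequentially.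
    \<kappa> * dy j powr (2 * s - 3) \<le> (\<Sum>n\<in>cube K. (cmod (symb N c (real_of_int (n$1) * dy j)))\<^sup>2 * jbr n powr (- 2 * s))"
proof -
  let ?w = "\<lambda>j (n :: int^3). (cmod (symb N c (real_of_int (n$1) * dy j)))\<^sup>2 * jbr n powr (- 2 * s)"
  obtain \<alpha> \<beta> m where ab: "0 < \<alpha>" "\<alpha> < \<beta>" "0 < m" and m: "\<And>y. y \<in> {\<alpha>..\<beta>} \<Longrightarrow> m \<le> cmod (symb N c y)"
    using symb_lower_interval[of c N] c by blast
  \<comment> \<open>The factors are the symbol bound, the bound for \<open>jbr\<close> on the chosen
    frequencies, and half the density of admissible first components.\<close>
  define \<kappa> where "\<kappa> = m\<^sup>2 * (\<beta>\<^sup>2 + 3) powr (- s) * ((\<beta> - \<alpha>) / 2)"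
  have "\<beta>\<^sup>2 + 3 > 0" by (simp add: add_nonneg_pos)
  then have "\<kappa> > 0" unfolding \<kappa>_def using ab by (intro mult_pos_pos) auto
  moreover have "\<forall>\<^sub>F j in sequentially. \<forall>\<^sub>F K in sequentially.
    \<kappa> * dy j powr (2 * s - 3) \<le> (\<Sum>n\<in>cube K. ?w j n)"
  proof -
    have "(\<lambda>j. 2 * dy j) \<longlonglongrightarrow> 2 * 0" by (intro tendsto_intros dy_tendsto_0)
    then have "\<forall>\<^sub>F j in sequentially. 2 * dy j < \<beta> - \<alpha>" by (rule order_tendstoD) (use ab in auto)
    then show ?thesis
    proof (rule eventually_mono)
      fix j assume j: "2 * dy j < \<beta> - \<alpha>"
      define q where "q = (2::real) ^ j"
      have q: "q \<ge> 1" "dy j = 1 / q" by (auto simp: q_def dy_def power_divide)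
      have jq: "2 < (\<beta> - \<alpha>) * q" using j q by (simp add: field_simps)
      \<comment> \<open>First components run from \<open>L\<close> to \<open>L + R - 1\<close>;
        rounding costs at most 1, which is at most half of \<open>(\<beta> - \<alpha>) * q\<close>
        for the \<open>j\<close> considered.\<close>
      define L where "L = \<lceil>\<alpha> * q\<rceil>"
      define R where "R = nat \<lfloor>(\<beta> - \<alpha>) * q\<rfloor>"
      have R: "(\<beta> - \<alpha>) / 2 * q \<le> real R" "real R \<le> (\<beta> - \<alpha>) * q" unfolding R_def using jq by linarith+
      define V where "V = (\<lambda>(r, a, b). vector [L + int r, int a, int b] :: int^3)"
      define D where "D = {..<R} \<times> {..<2 ^ j::nat} \<times> {..<2 ^ j::nat}"
      have inj: "inj_on V D" unfolding V_def D_def inj_on_def by (auto simp: vec_eq_iff forall_3 vector_3)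
      have fin: "finite (V ` D)" by (simp add: D_def)
      have term_ge: "m\<^sup>2 * ((\<beta>\<^sup>2 + 3) * q\<^sup>2) powr (- s) \<le> ?w j n"
        if n: "n \<in> V ` D" for n
      proof -
        obtain r a b where rab: "n = vector [L + int r, int a, int b]" "r < R" "a < 2 ^ j" "b < 2 ^ j"
          using n by (auto simp: V_def D_def)
        have n1: "\<alpha> * q \<le> real_of_int (n$1)" "real_of_int (n$1) \<le> \<beta> * q"
        proof -
          show "\<alpha> * q \<le> real_of_int (n$1)" unfolding rab(1) vector_3 L_def by linarith
          have "real r + 1 \<le> (\<beta> - \<alpha>) * q" using rab(2) R(2) by linarith
          then show "real_of_int (n$1) \<le> \<beta> * q" unfolding rab(1) vector_3 L_def
            by (simp add: algebra_simps) linarith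
        qed
        have n2: "\<bar>real_of_int (n$2)\<bar> \<le> q" "\<bar>real_of_int (n$3)\<bar> \<le> q"
        proof -
          have "real a < real (2 ^ j)" "real b < real (2 ^ j)" using rab(3,4) by (simp_all only: of_nat_less_iff)
          then show "\<bar>real_of_int (n$2)\<bar> \<le> q" "\<bar>real_of_int (n$3)\<bar> \<le> q"
            unfolding rab(1) vector_3 q_def by simp_all
        qed
        have "real_of_int (n$1) * dy j \<in> {\<alpha>..\<beta>}"
          unfolding q(2) using n1 q(1) by (simp add: pos_le_divide_eq pos_divide_le_eq)
        then have 1: "m\<^sup>2 \<le> (cmod (symb N c (real_of_int (n$1) * dy j)))\<^sup>2" using m ab by (intro power_mono) auto
        have "(jbr n)\<^sup>2 = 1 + ((real_of_int (n$1))\<^sup>2 + (real_of_int (n$2))\<^sup>2 + (real_of_int (n$3))\<^sup>2)"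
          by (simp add: jbr_power2 sum_3)
        also have "\<dots> \<le> q\<^sup>2 + ((\<beta> * q)\<^sup>2 + q\<^sup>2 + q\<^sup>2)"
        proof (intro add_mono)
          show "1 \<le> q\<^sup>2" using q(1) by simp
          have "0 \<le> \<alpha> * q" using ab q by simp
          then show "(real_of_int (n$1))\<^sup>2 \<le> (\<beta> * q)\<^sup>2" using n1 by (intro power_mono) auto
          show "(real_of_int (n$2))\<^sup>2 \<le> q\<^sup>2" "(real_of_int (n$3))\<^sup>2 \<le> q\<^sup>2"
            using n2 q by (auto simp: abs_le_square_iff[symmetric])
        qed
        also have "\<dots> = (\<beta>\<^sup>2 + 3) * q\<^sup>2" by (simp add: algebra_simps power_mult_distrib)
        finally have "((\<beta>\<^sup>2 + 3) * q\<^sup>2) powr (- s) \<le> ((jbr n)\<^sup>2) powr (- s)"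
          using s jbr_pos[of n] by (intro powr_mono2') (auto simp del: jbr_pos)
        also have "(jbr n)\<^sup>2 = jbr n powr 2" using powr_realpow[of "jbr n" 2] by simp
        also have "(jbr n powr 2) powr (- s) = jbr n powr (- 2 * s)" by (simp only: powr_powr) simp
        finally have 2: "((\<beta>\<^sup>2 + 3) * q\<^sup>2) powr (- s) \<le> jbr n powr (- 2 * s)" .
        show ?thesis using 1 2 by (intro mult_mono) auto
      qed
      have "\<kappa> * dy j powr (2 * s - 3) = ((\<beta> - \<alpha>) / 2 * q) * q * q * (m\<^sup>2 * ((\<beta>\<^sup>2 + 3) * q\<^sup>2) powr (- s))"
      proof -
        have "dy j powr (2 * s - 3) = q powr (3 - 2 * s)"
          using q by (simp add: powr_divide powr_minus_divide[symmetric])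
        also have "\<dots> = q ^ 3 * q powr (- 2 * s)"
          using q by (simp add: powr_diff powr_minus_divide)
        also have "q powr (- 2 * s) = (q\<^sup>2) powr (- s)"
        proof -
          have "q\<^sup>2 = q powr 2" using powr_realpow[of q 2] q by simp
          then show ?thesis by (simp only: powr_powr) simp
        qed
        finally have "dy j powr (2 * s - 3) = q ^ 3 * (q\<^sup>2) powr (- s)" .
        moreover have "((\<beta>\<^sup>2 + 3) * q\<^sup>2) powr (- s) = (\<beta>\<^sup>2 + 3) powr (- s) * (q\<^sup>2) powr (- s)"
          by (rule powr_mult)
        ultimately show ?thesis unfolding \<kappa>_def by (simp only: power3_eq_cube mult_ac)
      qed
      also have "\<dots> \<le> real R * q * q * (m\<^sup>2 * ((\<beta>\<^sup>2 + 3) * q\<^sup>2) powr (- s))"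
        using R q by (intro mult_right_mono) auto
      also have "real R * q * q = real (card D)" by (simp add: D_def q_def card_cartesian_product)
      also have "real (card D) * (m\<^sup>2 * ((\<beta>\<^sup>2 + 3) * q\<^sup>2) powr (- s)) = (\<Sum>n\<in>V ` D. m\<^sup>2 * ((\<beta>\<^sup>2 + 3) * q\<^sup>2) powr (- s))"
        by (simp add: card_image[OF inj])
      also have "\<dots> \<le> (\<Sum>n\<in>V ` D. ?w j n)"
        by (intro sum_mono term_ge)
      finally have low: "\<kappa> * dy j powr (2 * s - 3) \<le> (\<Sum>n\<in>V ` D. ?w j n)" .
      have "\<exists>K. V ` D \<subseteq> cube K" by (rule finite_subset_cube[OF fin])
      then obtain K0 where K0: "V ` D \<subseteq> cube K0" by blast
      show "\<forall>\<^sub>F K in sequentially. \<kappa> * dy j powr (2 * s - 3) \<le> (\<Sum>n\<in>cube K. ?w j n)"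
        unfolding eventually_sequentially
      proof (intro exI allI impI)
        fix K assume "K \<ge> K0"
        then have "V ` D \<subseteq> cube K" using K0 cube_mono by blast
        then have "(\<Sum>n\<in>V ` D. ?w j n)
          \<le> (\<Sum>n\<in>cube K. ?w j n)"
          by (intro sum_mono2) auto
        with low show "\<kappa> * dy j powr (2 * s - 3) \<le> (\<Sum>n\<in>cube K. ?w j n)"
          by linarith
      qed
    qed
  qed
  ultimately show ?thesis by blast
qed

section \<open>The random fields along dyadic points\<close>

context gaussian_family
begin

definition coef :: "real \<Rightarrow> real^3 \<Rightarrow> int^3 \<Rightarrow> complex" where
  "coef \<sigma> x n = cis (lat_ip n x) / complex_of_real (jbr n powr \<sigma>)"

text \<open>Used with \<open>\<sigma> = s + 1\<close> for \<open>u\<close> and with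
  \<open>\<sigma> = s\<close> for \<open>v\<close>.\<close>

definition fld :: "real \<Rightarrow> real^3 \<Rightarrow> 'w \<Rightarrow> real" where
  "fld \<sigma> x \<omega> = fourier_sum (\<lambda>n. \<gamma> n \<omega> / complex_of_real (jbr n powr \<sigma>)) x"

lemma herm_coef: "herm (coef \<sigma> x)"
  by (simp add: herm_def coef_def lat_ip_minus cis_cnj)

lemma cmod_coef: "cmod (coef \<sigma> x n) = jbr n powr (- \<sigma>)"
  by (simp add: coef_def norm_divide powr_minus_divide)

text \<open>Terms at \<open>n\<close> and \<open>- n\<close> are conjugate, so the partial sums are
  real and taking \<open>Re\<close> of the limit loses nothing.\<close>

lemma fourier_partial_sum:
  "(\<Sum>n\<in>cube N. \<gamma> n \<omega> / complex_of_real (jbr n powr \<sigma>) * cis (lat_ip n x)) =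
    complex_of_real (gsum (coef \<sigma> x) N \<omega>)"
proof -
  let ?f = "\<lambda>n. \<gamma> n \<omega> / complex_of_real (jbr n powr \<sigma>) * cis (lat_ip n x)"
  have f_eq: "?f n = coef \<sigma> x n * \<gamma> n \<omega>" for n by (simp add: coef_def)
  have "(\<Sum>n\<in>cube N. Im (?f n)) = (\<Sum>n\<in>cube N. Im (?f (- n)))"
    by (rule sum.reindex_bij_witness[where i = uminus and j = uminus]) auto
  also have "\<dots> = - (\<Sum>n\<in>cube N. Im (?f n))"
    unfolding sum_negf[symmetric]
  proof (intro sum.cong refl)
    fix n
    have "?f (- n) = cnj (?f n)" by (simp add: conj_sym lat_ip_minus cis_cnj)
    then show "Im (?f (- n)) = - Im (?f n)" by (simp only: cnj.simps)
  qed
  finally have "(\<Sum>n\<in>cube N. Im (?f n)) = 0" by simp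
  then show ?thesis
    by (simp only: complex_eq_iff Re_sum Im_sum Re_complex_of_real Im_complex_of_real gsum_def f_eq)
qed

lemma fld_measurable [measurable]: "fld \<sigma> x \<in> borel_measurable M"
proof -
  have "(\<lambda>\<omega>. lim (\<lambda>N. \<Sum>n\<in>cube N. \<gamma> n \<omega> / complex_of_real (jbr n powr \<sigma>) * cis (lat_ip n x))) \<in> borel_measurable M"
    by (intro borel_measurable_lim_metric) measurable
  then show ?thesis unfolding fld_def[abs_def] fourier_sum_def by measurable
qed

lemma jbr_weight: "(jbr n)\<^sup>2 * (cmod (coef \<sigma> x n))\<^sup>2 = jbr n powr (- (2 * \<sigma> - 2))"
proof -
  have "(jbr n)\<^sup>2 = jbr n powr 2" using powr_realpow[of "jbr n" 2] by simp
  moreover have "(cmod (coef \<sigma> x n))\<^sup>2 = jbr n powr (- (2 * \<sigma>))"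
    by (simp add: cmod_coef power2_eq_square flip: powr_add)
  ultimately show ?thesis by (simp flip: powr_add)
qed

text \<open>\<open>lim\<close> has a meaning only where the partial sums converge. The condition on
  \<open>\<sigma>\<close> says \<open>2 * \<sigma> - 2 > 3\<close>, which is the summability of
  \<open>jbr n ^ 2\<close> times the squared coefficients.\<close>

lemma fld_limit:
  assumes "\<sigma> > 5/2"
  shows "AE \<omega> in M. (\<lambda>N. gsum (coef \<sigma> x) N \<omega>) \<longlonglongrightarrow> fld \<sigma> x \<omega>"
proof -
  obtain C where "\<And>N. (\<Sum>n\<in>cube N. jbr n powr (- (2 * \<sigma> - 2))) \<le> C"
    using jbr_powr_sum_bounded[of "2 * \<sigma> - 2"] assms by auto
  then have "\<And>N. (\<Sum>n\<in>cube N. (jbr n)\<^sup>2 * (cmod (coef \<sigma> x n))\<^sup>2) \<le> C" by (simp add: jbr_weight)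
  from gsum_converges[OF herm_coef this] show ?thesis
  proof eventually_elim
    case (elim \<omega>)
    then obtain l where l: "(\<lambda>N. gsum (coef \<sigma> x) N \<omega>) \<longlonglongrightarrow> l" by (auto simp: convergent_def)
    then have "(\<lambda>N. complex_of_real (gsum (coef \<sigma> x) N \<omega>)) \<longlonglongrightarrow> complex_of_real l" by (rule tendsto_of_real)
    then have "lim (\<lambda>N. complex_of_real (gsum (coef \<sigma> x) N \<omega>)) = complex_of_real l" by (rule limI)
    then have "fld \<sigma> x \<omega> = l" by (simp only: fld_def fourier_sum_def fourier_partial_sum Re_complex_of_real)
    with l show ?case by simp
  qed
qed

definition lincomb :: "real \<Rightarrow> nat set \<Rightarrow> (nat \<Rightarrow> real) \<Rightarrow> (nat \<Rightarrow> real^3) \<Rightarrow> int^3 \<Rightarrow> complex" where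
  "lincomb \<sigma> I c x n = (\<Sum>i\<in>I. of_real (c i) * coef \<sigma> (x i) n)"

lemma herm_lincomb: "herm (lincomb \<sigma> I c x)"
  using herm_coef by (simp add: herm_def lincomb_def)

lemma gsum_lincomb:
  "gsum (lincomb \<sigma> I c x) N \<omega> = (\<Sum>i\<in>I. c i * gsum (coef \<sigma> (x i)) N \<omega>)"
proof -
  have "Re (lincomb \<sigma> I c x n * \<gamma> n \<omega>) = (\<Sum>i\<in>I. c i * Re (coef \<sigma> (x i) n * \<gamma> n \<omega>))" for n
  proof -
    have "lincomb \<sigma> I c x n * \<gamma> n \<omega> = (\<Sum>i\<in>I. of_real (c i) * (coef \<sigma> (x i) n * \<gamma> n \<omega>))"
      by (simp add: lincomb_def sum_distrib_right mult.assoc)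
    then show ?thesis by (simp only: Re_sum) simp
  qed
  then show ?thesis unfolding gsum_def by (simp only: sum_distrib_left) (rule sum.swap)
qed

lemma lincomb_limit:
  assumes "\<sigma> > 5/2"
  shows "AE \<omega> in M. (\<lambda>N. gsum (lincomb \<sigma> I c x) N \<omega>) \<longlonglongrightarrow> (\<Sum>i\<in>I. c i * fld \<sigma> (x i) \<omega>)"
proof -
  have "AE \<omega> in M. \<forall>i. (\<lambda>N. gsum (coef \<sigma> (x i)) N \<omega>) \<longlonglongrightarrow> fld \<sigma> (x i) \<omega>"
    unfolding AE_all_countable using fld_limit[OF assms] by blast
  then show ?thesis
    unfolding gsum_lincomb by eventually_elim (intro tendsto_intros, blast)
qed

lemma lincomb_xp:
  "lincomb \<sigma> {..N} c (\<lambda>i. xp (j + i)) n = symb N c (real_of_int (n$1) * dy j) / of_real (jbr n powr \<sigma>)"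
  by (simp add: lincomb_def coef_def symb_def lat_ip_xp dy_add sum_divide_distrib mult.assoc)

lemma cmod_lincomb_xp:
  "(cmod (lincomb \<sigma> {..N} c (\<lambda>i. xp (j + i)) n))\<^sup>2 =
    (cmod (symb N c (real_of_int (n$1) * dy j)))\<^sup>2 * jbr n powr (- 2 * \<sigma>)"
proof -
  have "(jbr n powr \<sigma>)\<^sup>2 = jbr n powr (2 * \<sigma>)" by (simp add: power2_eq_square flip: powr_add)
  then show ?thesis by (simp add: lincomb_xp norm_divide power_divide powr_minus_divide)
qed

text \<open>The symbol bound of order \<open>\<theta>'\<close> extracts
  \<open>dy j powr (2 * \<theta>')\<close> from the variance at the cost of
  \<open>jbr n powr (2 * \<theta>')\<close>, and the remaining series converges because
  \<open>2 * \<sigma> - 2 * \<theta>' > 3\<close>.\<close>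

lemma fld_dd_regular:
  assumes \<sigma>: "\<sigma> > 5/2" and \<theta>: "\<theta> < \<theta>'" "0 \<le> \<theta>'" "\<theta>' \<le> real N" "2 * \<theta>' < 2 * \<sigma> - 3" and N: "N \<ge> 1"
  shows "AE \<omega> in M. dd N (\<lambda>j. fld \<sigma> (xp j) \<omega>) \<in> ody \<theta>"
proof -
  obtain c where c: "\<And>w j. dd N w j = (\<Sum>i\<le>N. c i * w (j + i))" using dd_coefficients by blast
  obtain B where B: "B \<ge> 0" "\<And>y. cmod (symb N c y) \<le> B * \<bar>y\<bar> powr \<theta>'"
    using symb_bound[OF c N \<theta>(2,3)] by blast
  obtain C where C: "\<And>K. (\<Sum>n\<in>cube K. jbr n powr (- (2 * \<sigma> - 2 * \<theta>'))) \<le> C"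
    using jbr_powr_sum_bounded[of "2 * \<sigma> - 2 * \<theta>'"] \<theta> by auto
  have "C \<ge> 0" using C[of 0] sum_nonneg[of "cube 0" "\<lambda>n. jbr n powr (- (2 * \<sigma> - 2 * \<theta>'))"] by (simp add: order_trans)
  have "AE \<omega> in M. (\<lambda>j. dd N (\<lambda>j. fld \<sigma> (xp j) \<omega>) j) \<in> ody \<theta>"
  proof (rule AE_bigo_of_second_moments[OF _ _ \<theta>(1)])
    show "(\<lambda>\<omega>. dd N (\<lambda>j. fld \<sigma> (xp j) \<omega>) j) \<in> borel_measurable M" for j
      unfolding c by measurable
    show "(\<integral>\<^sup>+\<omega>. ennreal ((dd N (\<lambda>j. fld \<sigma> (xp j) \<omega>) j)\<^sup>2) \<partial>M) \<le> ennreal ((B\<^sup>2 * C) * dy j powr (2 * \<theta>'))" for j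
    proof (rule limit_second_moment[OF herm_lincomb[of \<sigma> "{..N}" c "\<lambda>i. xp (j + i)"]])
      show "(\<lambda>\<omega>. dd N (\<lambda>j. fld \<sigma> (xp j) \<omega>) j) \<in> borel_measurable M" unfolding c by measurable
      show "AE \<omega> in M. (\<lambda>K. gsum (lincomb \<sigma> {..N} c (\<lambda>i. xp (j + i))) K \<omega>) \<longlonglongrightarrow> dd N (\<lambda>j. fld \<sigma> (xp j) \<omega>) j"
        unfolding c by (rule lincomb_limit[OF \<sigma>])
      fix K
      have "(\<Sum>n\<in>cube K. (cmod (lincomb \<sigma> {..N} c (\<lambda>i. xp (j + i)) n))\<^sup>2) \<le>
          (\<Sum>n\<in>cube K. B\<^sup>2 * dy j powr (2 * \<theta>') * jbr n powr (- (2 * \<sigma> - 2 * \<theta>')))"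
      proof (rule sum_mono)
        fix n :: "int^3"
        have "cmod (symb N c (real_of_int (n$1) * dy j)) \<le> B * \<bar>real_of_int (n$1) * dy j\<bar> powr \<theta>'" by (rule B)
        also have "\<dots> \<le> B * (jbr n * dy j) powr \<theta>'"
        proof (intro mult_left_mono powr_mono2)
          show "\<bar>real_of_int (n$1) * dy j\<bar> \<le> jbr n * dy j"
            unfolding abs_mult using abs_component_le_jbr[of n 1] dy_pos[of j] by (intro mult_mono) (auto simp: less_imp_le)
        qed (use \<theta> B in auto)
        also have "\<dots> = B * (jbr n powr \<theta>' * dy j powr \<theta>')" by (simp add: powr_mult)
        finally have "(cmod (symb N c (real_of_int (n$1) * dy j)))\<^sup>2 \<le> (B * (jbr n powr \<theta>' * dy j powr \<theta>'))\<^sup>2"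
          by (intro power_mono) auto
        also have "\<dots> = B\<^sup>2 * dy j powr (2 * \<theta>') * jbr n powr (2 * \<theta>')"
          by (simp add: power_mult_distrib power2_eq_square powr_add[symmetric] mult_ac)
        finally have "(cmod (symb N c (real_of_int (n$1) * dy j)))\<^sup>2 * jbr n powr (- 2 * \<sigma>) \<le>
            B\<^sup>2 * dy j powr (2 * \<theta>') * jbr n powr (2 * \<theta>') * jbr n powr (- 2 * \<sigma>)"
          by (intro mult_right_mono) auto
        also have "\<dots> = B\<^sup>2 * dy j powr (2 * \<theta>') * jbr n powr (- (2 * \<sigma> - 2 * \<theta>'))"
          by (simp add: mult.assoc flip: powr_add)
        finally show "(cmod (lincomb \<sigma> {..N} c (\<lambda>i. xp (j + i)) n))\<^sup>2 \<le>
            B\<^sup>2 * dy j powr (2 * \<theta>') * jbr n powr (- (2 * \<sigma> - 2 * \<theta>'))"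
          unfolding cmod_lincomb_xp .
      qed
      also have "\<dots> = B\<^sup>2 * dy j powr (2 * \<theta>') * (\<Sum>n\<in>cube K. jbr n powr (- (2 * \<sigma> - 2 * \<theta>')))"
        by (rule sum_distrib_left[symmetric])
      also have "\<dots> \<le> B\<^sup>2 * dy j powr (2 * \<theta>') * C" by (intro mult_left_mono C) auto
      finally show "(\<Sum>n\<in>cube K. (cmod (lincomb \<sigma> {..N} c (\<lambda>i. xp (j + i)) n))\<^sup>2) \<le> (B\<^sup>2 * C) * dy j powr (2 * \<theta>')"
        by (simp add: mult_ac)
    qed
    show "0 \<le> B\<^sup>2 * C" using \<open>C \<ge> 0\<close> by simp
  qed
  then show ?thesis .
qed

text \<open>The a priori order from which the bootstrap starts. The bound
  \<open>|exp (i x) - 1| \<le> |x|\<close> yields second moments of order \<open>dy j ^ 2\<close>;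
  the almost sure statement needs some loss, and 1/2 leaves room for it.\<close>

lemma fld_half_regular:
  assumes \<sigma>: "\<sigma> > 5/2"
  shows "AE \<omega> in M. (\<lambda>j. fld \<sigma> (xp j) \<omega> - fld \<sigma> 0 \<omega>) \<in> ody (1/2)"
proof -
  obtain C where C: "\<And>K. (\<Sum>n\<in>cube K. jbr n powr (- (2 * \<sigma> - 2))) \<le> C"
    using jbr_powr_sum_bounded[of "2 * \<sigma> - 2"] \<sigma> by auto
  have "C \<ge> 0" using C[of 0] sum_nonneg[of "cube 0" "\<lambda>n. jbr n powr (- (2 * \<sigma> - 2))"] by (simp add: order_trans)
  \<comment> \<open>The increment is a combination of the field at two points, so the facts about
    \<open>lincomb\<close> apply.\<close>
  define c :: "nat \<Rightarrow> real" where "c i = (if i = 0 then 1 else - 1)" for i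
  define x :: "nat \<Rightarrow> nat \<Rightarrow> real^3" where "x j i = (if i = 0 then xp j else 0)" for j i
  have eq: "fld \<sigma> (xp j) \<omega> - fld \<sigma> 0 \<omega> = (\<Sum>i\<in>{0,1}. c i * fld \<sigma> (x j i) \<omega>)" for j \<omega>
    by (simp add: c_def x_def)
  show ?thesis
  proof (rule AE_bigo_of_second_moments[where \<theta>' = 1 and C = C])
    show "(\<integral>\<^sup>+\<omega>. ennreal ((fld \<sigma> (xp j) \<omega> - fld \<sigma> 0 \<omega>)\<^sup>2) \<partial>M) \<le> ennreal (C * dy j powr (2 * 1))" for j
    proof (rule limit_second_moment[OF herm_lincomb[of \<sigma> "{0,1}" c "x j"]])
      show "AE \<omega> in M. (\<lambda>K. gsum (lincomb \<sigma> {0,1} c (x j)) K \<omega>) \<longlonglongrightarrow> fld \<sigma> (xp j) \<omega> - fld \<sigma> 0 \<omega>"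
        unfolding eq by (rule lincomb_limit[OF \<sigma>])
      fix K
      have "(\<Sum>n\<in>cube K. (cmod (lincomb \<sigma> {0,1} c (x j) n))\<^sup>2) \<le>
          (\<Sum>n\<in>cube K. (dy j)\<^sup>2 * jbr n powr (- (2 * \<sigma> - 2)))"
      proof (rule sum_mono)
        fix n :: "int^3"
        have "lincomb \<sigma> {0,1} c (x j) n = (cis (real_of_int (n$1) * dy j) - 1) * coef \<sigma> 0 n"
          by (simp add: lincomb_def c_def x_def coef_def lat_ip_xp diff_divide_distrib)
        then have "cmod (lincomb \<sigma> {0,1} c (x j) n) = cmod (cis (real_of_int (n$1) * dy j) - 1) * cmod (coef \<sigma> 0 n)"
          by (simp add: norm_mult)
        also have "cmod (cis (real_of_int (n$1) * dy j) - 1) \<le> \<bar>real_of_int (n$1) * dy j\<bar>"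
          using iexp_approx1[of "real_of_int (n$1) * dy j" 0] by (simp add: cis_conv_exp)
        also have "\<dots> \<le> dy j * jbr n"
          unfolding abs_mult using abs_component_le_jbr[of n 1] dy_pos[of j]
          by (subst mult.commute, intro mult_mono) (auto simp: less_imp_le)
        finally have "cmod (lincomb \<sigma> {0,1} c (x j) n) \<le> dy j * jbr n * cmod (coef \<sigma> 0 n)"
          by (simp add: mult_right_mono)
        then have "(cmod (lincomb \<sigma> {0,1} c (x j) n))\<^sup>2 \<le> (dy j * jbr n * cmod (coef \<sigma> 0 n))\<^sup>2"
          by (intro power_mono) auto
        also have "\<dots> = (dy j)\<^sup>2 * ((jbr n)\<^sup>2 * (cmod (coef \<sigma> 0 n))\<^sup>2)" by (simp add: power_mult_distrib)
        finally show "(cmod (lincomb \<sigma> {0,1} c (x j) n))\<^sup>2 \<le> (dy j)\<^sup>2 * jbr n powr (- (2 * \<sigma> - 2))"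
          unfolding jbr_weight .
      qed
      also have "\<dots> = (dy j)\<^sup>2 * (\<Sum>n\<in>cube K. jbr n powr (- (2 * \<sigma> - 2)))" by (rule sum_distrib_left[symmetric])
      also have "\<dots> \<le> (dy j)\<^sup>2 * C" by (intro mult_left_mono C) auto
      also have "(dy j)\<^sup>2 = dy j powr (2 * 1)" using powr_realpow[of "dy j" 2] by simp
      finally show "(\<Sum>n\<in>cube K. (cmod (lincomb \<sigma> {0,1} c (x j) n))\<^sup>2) \<le> C * dy j powr (2 * 1)"
        by (simp add: mult.commute)
    qed measurable
  qed (use \<open>C \<ge> 0\<close> in auto)
qed

text \<open>For a fixed constant, the bound at a single large \<open>j\<close> has probability at
  most a multiple of \<open>dy j powr (\<theta> - (\<sigma> - 3/2))\<close>, which tends to 0. So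
  the bound at all \<open>j\<close> is a null event, and there are only countably many
  constants.\<close>

lemma fld_dd_irregular:
  assumes \<sigma>: "\<sigma> > 5/2" and \<theta>: "\<theta> > \<sigma> - 3/2"
  shows "AE \<omega> in M. dd N (\<lambda>j. fld \<sigma> (xp j) \<omega>) \<notin> ody \<theta>"
proof -
  obtain c where c: "\<And>w j. dd N w j = (\<Sum>i\<le>N. c i * w (j + i))" "c N \<noteq> 0" using dd_coefficients by blast
  obtain \<kappa> where \<kappa>: "\<kappa> > 0" and low: "\<forall>\<^sub>F j in sequentially. \<forall>\<^sub>F K in sequentially.
    \<kappa> * dy j powr (2 * \<sigma> - 3) \<le> (\<Sum>n\<in>cube K. (cmod (symb N c (real_of_int (n$1) * dy j)))\<^sup>2 * jbr n powr (- 2 * \<sigma>))"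
    using variance_lower_bound[of c N \<sigma>] c(2) \<sigma> by auto
  define X where "X j \<omega> = dd N (\<lambda>j. fld \<sigma> (xp j) \<omega>) j" for j \<omega>
  have [measurable]: "X j \<in> borel_measurable M" for j unfolding X_def c by measurable
  have null: "AE \<omega> in M. \<not> (\<forall>j. \<bar>X j \<omega>\<bar> \<le> real C * dy j powr \<theta>)" for C :: nat
  proof -
    \<comment> \<open>Shifted by 1 because \<open>limit_anticoncentration\<close> requires a
      positive threshold, also when \<open>C = 0\<close>.\<close>
    define K where "K = real C + 1"
    have K: "K > 0" by (simp add: K_def)
    let ?E = "{\<omega> \<in> space M. \<forall>j. \<bar>X j \<omega>\<bar> \<le> K * dy j powr \<theta>}"
    have [measurable]: "?E \<in> sets M" by measurable
    have "\<forall>\<^sub>F j in sequentially. emeasure M ?E \<le> ennreal (4 * K / sqrt \<kappa> * dy j powr (\<theta> - (\<sigma> - 3/2)))"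
      using low
    proof (rule eventually_mono)
      fix j assume ev: "\<forall>\<^sub>F L in sequentially.
        \<kappa> * dy j powr (2 * \<sigma> - 3) \<le> (\<Sum>n\<in>cube L. (cmod (symb N c (real_of_int (n$1) * dy j)))\<^sup>2 * jbr n powr (- 2 * \<sigma>))"
      define \<tau> where "\<tau> = sqrt \<kappa> * dy j powr (\<sigma> - 3/2)"
      have \<tau>: "\<tau> > 0" using \<kappa> by (simp add: \<tau>_def)
      have "2 * \<sigma> - 3 = (\<sigma> - 3/2) + (\<sigma> - 3/2)" by simp
      then have \<tau>2: "\<tau>\<^sup>2 = \<kappa> * dy j powr (2 * \<sigma> - 3)"
        using \<kappa> by (simp only: \<tau>_def power_mult_distrib powr_add) (simp add: power2_eq_square)
      have "emeasure M ?E \<le> emeasure M {\<omega> \<in> space M. \<bar>X j \<omega>\<bar> \<le> K * dy j powr \<theta>}"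
        by (intro emeasure_mono) auto
      also have "\<dots> \<le> ennreal (4 * (K * dy j powr \<theta>) / \<tau>)"
      proof (rule limit_anticoncentration[OF herm_lincomb[of \<sigma> "{..N}" c "\<lambda>i. xp (j + i)"] _ _ \<tau>])
        show "AE \<omega> in M. (\<lambda>K. gsum (lincomb \<sigma> {..N} c (\<lambda>i. xp (j + i))) K \<omega>) \<longlonglongrightarrow> X j \<omega>"
          unfolding X_def c by (rule lincomb_limit[OF \<sigma>])
        show "\<forall>\<^sub>F L in sequentially. \<tau>\<^sup>2 \<le> (\<Sum>n\<in>cube L. (cmod (lincomb \<sigma> {..N} c (\<lambda>i. xp (j + i)) n))\<^sup>2)"
          using ev unfolding \<tau>2 cmod_lincomb_xp .
        show "0 < K * dy j powr \<theta>" using K by simp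
      qed measurable
      also have "4 * (K * dy j powr \<theta>) / \<tau> = 4 * K / sqrt \<kappa> * dy j powr (\<theta> - (\<sigma> - 3/2))"
        by (simp add: \<tau>_def powr_diff)
      finally show "emeasure M ?E \<le> ennreal (4 * K / sqrt \<kappa> * dy j powr (\<theta> - (\<sigma> - 3/2)))" .
    qed
    moreover have "(\<lambda>j. ennreal (4 * K / sqrt \<kappa> * dy j powr (\<theta> - (\<sigma> - 3/2)))) \<longlonglongrightarrow> ennreal (4 * K / sqrt \<kappa> * 0 powr (\<theta> - (\<sigma> - 3/2)))"
      using \<theta> by (intro tendsto_ennrealI tendsto_mult tendsto_const tendsto_powr' dy_tendsto_0) (auto simp: less_imp_le)
    ultimately have "emeasure M ?E \<le> ennreal (4 * K / sqrt \<kappa> * 0 powr (\<theta> - (\<sigma> - 3/2)))"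
      by (intro tendsto_lowerbound[of _ _ sequentially]) auto
    then have "emeasure M ?E = 0" by simp
    then have "AE \<omega> in M. \<omega> \<notin> ?E" by (intro AE_not_in null_setsI) auto
    with AE_space show ?thesis
    proof eventually_elim
      case (elim \<omega>)
      then obtain j where "\<bar>X j \<omega>\<bar> > K * dy j powr \<theta>" by (auto simp: not_le)
      moreover have "K * dy j powr \<theta> \<ge> real C * dy j powr \<theta>" by (intro mult_right_mono) (auto simp: K_def)
      ultimately have "\<not> \<bar>X j \<omega>\<bar> \<le> real C * dy j powr \<theta>" by linarith
      then show ?case by blast
    qed
  qed
  then have "AE \<omega> in M. \<forall>C. \<not> (\<forall>j. \<bar>X j \<omega>\<bar> \<le> real C * dy j powr \<theta>)"
    unfolding AE_all_countable by blast
  then show ?thesis unfolding bigo_dy_iff X_def by simp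
qed

end

section \<open>Non-absolute continuity\<close>

context gaussian_family
begin

text \<open>The variances stay in \<open>[1, T]\<close>, so the densities have a common positive
  lower bound on the interval.\<close>

lemma gsum_box_lower_bound:
  assumes a: "herm a" and l: "\<And>N. 1 \<le> (\<Sum>n\<in>cube N. (cmod (a n))\<^sup>2)"
    and u: "\<And>N. (\<Sum>n\<in>cube N. (cmod (a n))\<^sup>2) \<le> T" and xy: "x < y"
  shows "\<exists>p>0. \<forall>N. p \<le> prob (gsum a N -` {x..y} \<inter> space M)"
proof -
  define R where "R = max \<bar>x\<bar> \<bar>y\<bar>"
  \<comment> \<open>The prefactor is smallest at variance \<open>T\<close>, the exponential at
    variance 1.\<close>
  define d where "d = 1 / sqrt (2 * pi * T) * exp (- R\<^sup>2 / 2)"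
  have T: "T \<ge> 1" using l[of 0] u[of 0] by simp
  have d: "d > 0" using T by (simp add: d_def)
  have "d * (y - x) \<le> prob (gsum a N -` {x..y} \<inter> space M)" for N
  proof -
    define V where "V = (\<Sum>n\<in>cube N. (cmod (a n))\<^sup>2)"
    have V: "1 \<le> V" "V \<le> T" using l[of N] u[of N] by (auto simp: V_def)
    have D: "distributed M lborel (gsum a N) (normal_density 0 (sqrt V))"
      unfolding gsum_def[abs_def] V_def
      by (rule symmetric_sum_normal) (use a V in \<open>auto simp: V_def\<close>)
    have "ennreal (d * (y - x)) = (\<integral>\<^sup>+z. ennreal d * indicator {x..y} z \<partial>lborel)"
      using xy d by (subst nn_integral_cmult_indicator) (auto simp: ennreal_mult')
    also have "\<dots> \<le> (\<integral>\<^sup>+z. ennreal (normal_density 0 (sqrt V) z) * indicator {x..y} z \<partial>lborel)"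
    proof (intro nn_integral_mono)
      fix z :: real
      show "ennreal d * indicator {x..y} z \<le> ennreal (normal_density 0 (sqrt V) z) * indicator {x..y} z"
      proof (cases "z \<in> {x..y}")
        case True
        have "\<bar>z\<bar> \<le> \<bar>R\<bar>" using True by (auto simp: R_def)
        then have "z\<^sup>2 \<le> R\<^sup>2" by (simp add: abs_le_square_iff)
        have "z\<^sup>2 / (2 * V) \<le> z\<^sup>2 / 2" using V by (intro divide_left_mono) auto
        also have "\<dots> \<le> R\<^sup>2 / 2" using \<open>z\<^sup>2 \<le> R\<^sup>2\<close> by simp
        finally have "exp (- R\<^sup>2 / 2) \<le> exp (- (z\<^sup>2 / (2 * V)))" by simp
        moreover have "1 / sqrt (2 * pi * T) \<le> 1 / sqrt (2 * pi * V)"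
          using V by (intro divide_left_mono) auto
        ultimately have "d \<le> 1 / sqrt (2 * pi * V) * exp (- (z\<^sup>2 / (2 * V)))"
          unfolding d_def using V by (intro mult_mono) auto
        then have "d \<le> normal_density 0 (sqrt V) z" using V by (simp add: normal_density_def)
        then show ?thesis using True by (simp add: ennreal_leI)
      qed simp
    qed
    also have "\<dots> = emeasure M (gsum a N -` {x..y} \<inter> space M)"
      using distributed_emeasure[OF D, of "{x..y}"] by simp
    finally show ?thesis by (simp add: emeasure_eq_measure)
  qed
  then show ?thesis using d xy by (intro exI[of _ "d * (y - x)"]) auto
qed

lemma coef_0_variance:
  assumes "\<sigma> > 5/2"
  shows "1 \<le> (\<Sum>n\<in>cube N. (cmod (coef \<sigma> 0 n))\<^sup>2)"
    and "\<exists>T. \<forall>N. (\<Sum>n\<in>cube N. (cmod (coef \<sigma> 0 n))\<^sup>2) \<le> T"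
proof -
  have "(cmod (coef \<sigma> 0 0))\<^sup>2 = 1" by (simp add: cmod_coef jbr_def)
  moreover have "(0::int^3) \<in> cube N" by (simp add: cube_def)
  ultimately show "1 \<le> (\<Sum>n\<in>cube N. (cmod (coef \<sigma> 0 n))\<^sup>2)"
    using member_le_sum[of 0 "cube N" "\<lambda>n. (cmod (coef \<sigma> 0 n))\<^sup>2"] by simp
  have "(cmod (coef \<sigma> 0 n))\<^sup>2 = jbr n powr (- (2 * \<sigma>))" for n
    by (simp add: cmod_coef power2_eq_square flip: powr_add)
  then show "\<exists>T. \<forall>N. (\<Sum>n\<in>cube N. (cmod (coef \<sigma> 0 n))\<^sup>2) \<le> T"
    using jbr_powr_sum_bounded[of "2 * \<sigma>"] assms by simp
qed

end

text \<open>Independence is used for the partial sums, where it gives box probability at least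
  \<open>p * q\<close> uniformly in \<open>N\<close>. If the limits avoided the closed box almost
  surely, the partial sums would eventually leave it, and Fatou would push the probabilities of the
  complements to 1.\<close>

lemma joint_box_positive:
  fixes M :: "'w measure" and g h :: "int^3 \<Rightarrow> 'w \<Rightarrow> complex"
  assumes g: "gaussian_family M g" and h: "gaussian_family M h"
    and ind: "prob_space.indep_vars M (\<lambda>_. borel) (\<lambda>(b, n). if b then g n else h n)
           (UNIV \<times> ({0} \<union> {n. lex_pos n}))"
    and \<sigma>: "\<sigma> > 5/2" "\<sigma>' > 5/2" and xy: "x < y" "x' < y'"
  shows "\<not> (AE \<omega> in M. \<not> (gaussian_family.fld g \<sigma> 0 \<omega> \<in> {x..y} \<and> gaussian_family.fld h \<sigma>' 0 \<omega> \<in> {x'..y'}))"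
proof
  interpret G: gaussian_family M g by fact
  interpret H: gaussian_family M h by fact
  assume AE0: "AE \<omega> in M. \<not> (G.fld \<sigma> 0 \<omega> \<in> {x..y} \<and> H.fld \<sigma>' 0 \<omega> \<in> {x'..y'})"
  let ?a = "G.coef \<sigma> 0" and ?b = "H.coef \<sigma>' 0"
  let ?L = "{0} \<union> {n. lex_pos n}"
  obtain p where p: "p > 0" "\<And>N. p \<le> G.prob (G.gsum ?a N -` {x..y} \<inter> space M)"
    using G.gsum_box_lower_bound[OF G.herm_coef G.coef_0_variance(1)[OF \<sigma>(1)] _ xy(1)]
      G.coef_0_variance(2)[OF \<sigma>(1)] by blast
  obtain q where q: "q > 0" "\<And>N. q \<le> G.prob (H.gsum ?b N -` {x'..y'} \<inter> space M)"
    using H.gsum_box_lower_bound[OF H.herm_coef H.coef_0_variance(1)[OF \<sigma>(2)] _ xy(2)]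
      H.coef_0_variance(2)[OF \<sigma>(2)] by blast
  have indep: "G.indep_var borel (G.gsum ?a N) borel (H.gsum ?b N)" for N
  proof -
    let ?X = "\<lambda>(b, n). if b then g n else h n"
    let ?A = "{True} \<times> ?L" and ?B = "{False} \<times> ?L"
    \<comment> \<open>The partial sum as a function of the half-lattice coordinates with label
      \<open>b\<close>, so that the two sums depend on disjoint blocks of the independent
      family.\<close>
    define F where "F a b r = (\<Sum>n\<in>cube N \<inter> ?L. if n = 0 then Re (a n * r (b, n)) else 2 * Re (a n * r (b, n)))"
      for a :: "int^3 \<Rightarrow> complex" and b :: bool and r :: "bool \<times> (int^3) \<Rightarrow> complex"
    have Fm: "F a b \<in> borel_measurable (PiM ({b} \<times> ?L) (\<lambda>_. borel))" for a b
    proof -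
      have "(\<lambda>r. if n = 0 then Re (a n * r (b, n)) else 2 * Re (a n * r (b, n))) \<in> borel_measurable (PiM ({b} \<times> ?L) (\<lambda>_. borel))"
        if "n \<in> ?L" for n
      proof -
        have [measurable]: "(\<lambda>r. r (b, n)) \<in> measurable (PiM ({b} \<times> ?L) (\<lambda>_. borel)) (borel :: complex measure)"
          using that by (intro measurable_component_singleton) auto
        show ?thesis by measurable
      qed
      then show ?thesis unfolding F_def[abs_def] by (intro borel_measurable_sum) auto
    qed
    have "G.indep_var (PiM ?A (\<lambda>_. borel)) (\<lambda>\<omega>. restrict (\<lambda>i. ?X i \<omega>) ?A) (PiM ?B (\<lambda>_. borel)) (\<lambda>\<omega>. restrict (\<lambda>i. ?X i \<omega>) ?B)"
      by (rule G.indep_var_restrict[OF ind]) auto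
    from G.indep_var_compose[OF this Fm Fm]
    have "G.indep_var borel (F ?a True \<circ> (\<lambda>\<omega>. restrict (\<lambda>i. ?X i \<omega>) ?A)) borel (F ?b False \<circ> (\<lambda>\<omega>. restrict (\<lambda>i. ?X i \<omega>) ?B))" .
    moreover have "F ?a True \<circ> (\<lambda>\<omega>. restrict (\<lambda>i. ?X i \<omega>) ?A) = G.gsum ?a N"
    proof
      fix \<omega>
      have "G.gsum ?a N \<omega> = (\<Sum>n\<in>cube N \<inter> ?L. G.gpart ?a n \<omega>)"
        unfolding G.gsum_def by (rule G.sum_eq_gpart) (use G.herm_coef in auto)
      also have "\<dots> = F ?a True (restrict (\<lambda>i. ?X i \<omega>) ?A)"
        unfolding F_def by (intro sum.cong) (auto simp: G.gpart_def)
      finally show "(F ?a True \<circ> (\<lambda>\<omega>. restrict (\<lambda>i. ?X i \<omega>) ?A)) \<omega> = G.gsum ?a N \<omega>" by simp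
    qed
    moreover have "F ?b False \<circ> (\<lambda>\<omega>. restrict (\<lambda>i. ?X i \<omega>) ?B) = H.gsum ?b N"
    proof
      fix \<omega>
      have "H.gsum ?b N \<omega> = (\<Sum>n\<in>cube N \<inter> ?L. H.gpart ?b n \<omega>)"
        unfolding H.gsum_def by (rule H.sum_eq_gpart) (use H.herm_coef in auto)
      also have "\<dots> = F ?b False (restrict (\<lambda>i. ?X i \<omega>) ?B)"
        unfolding F_def by (intro sum.cong) (auto simp: H.gpart_def)
      finally show "(F ?b False \<circ> (\<lambda>\<omega>. restrict (\<lambda>i. ?X i \<omega>) ?B)) \<omega> = H.gsum ?b N \<omega>" by simp
    qed
    ultimately show ?thesis by simp
  qed
  define E where "E N = {\<omega> \<in> space M. \<not> (G.gsum ?a N \<omega> \<in> {x..y} \<and> H.gsum ?b N \<omega> \<in> {x'..y'})}" for N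
  have [measurable]: "E N \<in> sets M" for N unfolding E_def by measurable
  have EN: "emeasure M (E N) \<le> ennreal (1 - p * q)" for N
  proof -
    let ?S = "(\<lambda>\<omega>. (G.gsum ?a N \<omega>, H.gsum ?b N \<omega>)) -` ({x..y} \<times> {x'..y'}) \<inter> space M"
    have "p * q \<le> G.prob (G.gsum ?a N -` {x..y} \<inter> space M) * G.prob (H.gsum ?b N -` {x'..y'} \<inter> space M)"
      using p q by (intro mult_mono) (auto simp: less_imp_le)
    also have "\<dots> = G.prob ?S" using G.indep_varD[OF indep, of "{x..y}" "{x'..y'}" N] by simp
    finally have 1: "p * q \<le> G.prob ?S" .
    have S: "?S \<in> sets M" by (rule measurable_sets[of _ M "borel \<Otimes>\<^sub>M borel"]) auto
    have "E N = space M - ?S" by (auto simp: E_def)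
    then have "G.prob (E N) \<le> 1 - p * q" using G.prob_compl[OF S] 1 by simp
    then show ?thesis by (simp add: G.emeasure_eq_measure ennreal_leI)
  qed
  have "ennreal 1 = (\<integral>\<^sup>+\<omega>. 1 \<partial>M)" by (simp add: G.emeasure_space_1)
  also have "\<dots> \<le> (\<integral>\<^sup>+\<omega>. liminf (\<lambda>N. indicator (E N) \<omega>) \<partial>M)"
  proof (rule nn_integral_mono_AE, use AE0 G.fld_limit[OF \<sigma>(1), of 0] H.fld_limit[OF \<sigma>(2), of 0] AE_space in eventually_elim)
    case (elim \<omega>)
    have "\<forall>\<^sub>F N in sequentially. \<not> (G.gsum ?a N \<omega> \<in> {x..y} \<and> H.gsum ?b N \<omega> \<in> {x'..y'})"
    proof -
      have "G.fld \<sigma> 0 \<omega> \<in> - {x..y} \<or> H.fld \<sigma>' 0 \<omega> \<in> - {x'..y'}" using elim(1) by simp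
      then show ?thesis
      proof
        assume "G.fld \<sigma> 0 \<omega> \<in> - {x..y}"
        from topological_tendstoD[OF elim(2) _ this] have "\<forall>\<^sub>F N in sequentially. G.gsum ?a N \<omega> \<in> - {x..y}" by auto
        then show ?thesis by (rule eventually_mono) auto
      next
        assume "H.fld \<sigma>' 0 \<omega> \<in> - {x'..y'}"
        from topological_tendstoD[OF elim(3) _ this] have "\<forall>\<^sub>F N in sequentially. H.gsum ?b N \<omega> \<in> - {x'..y'}" by auto
        then show ?thesis by (rule eventually_mono) auto
      qed
    qed
    then have "\<forall>\<^sub>F N in sequentially. (1::ennreal) \<le> indicator (E N) \<omega>"
      by (rule eventually_mono) (use elim(4) in \<open>auto simp: E_def\<close>)
    then show "1 \<le> liminf (\<lambda>N. indicator (E N) \<omega> :: ennreal)" by (rule Liminf_bounded)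
  qed
  also have "\<dots> \<le> liminf (\<lambda>N. \<integral>\<^sup>+\<omega>. indicator (E N) \<omega> \<partial>M)"
    by (rule nn_integral_liminf) measurable
  also have "\<dots> \<le> ennreal (1 - p * q)"
    by (rule Liminf_le) (use EN in auto)
  finally have "1 \<le> 1 - p * q \<or> 1 \<le> (0::real)" by (simp add: ennreal_le_iff2)
  moreover have "p * q > 0" using p q by simp
  ultimately show False by simp
qed

text \<open>Extracts \<open>g\<close> alone or \<open>h\<close> alone from the family indexed by
  label and frequency.\<close>

lemma (in prob_space) indep_vars_reindex_inj:
  assumes ind: "indep_vars (\<lambda>_. N) X I" and f: "inj_on f J" "f ` J \<subseteq> I"
  shows "indep_vars (\<lambda>_. N) (\<lambda>j. X (f j)) J"
proof -
  have "indep_vars (\<lambda>j. PiM {f j} (\<lambda>_. N)) (\<lambda>j \<omega>. restrict (\<lambda>i. X i \<omega>) {f j}) J"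
    using f by (intro indep_vars_restrict[OF ind]) (auto simp: disjoint_family_on_def inj_on_def)
  from indep_vars_compose2[OF this, of "\<lambda>j r. r (f j)" "\<lambda>_. N"]
  show ?thesis by (simp add: measurable_component_singleton)
qed

text \<open>With velocity of size \<open>\<epsilon>\<close> and position at most
  \<open>\<epsilon>\<close> the energy is of order \<open>\<epsilon>^2\<close>, so the left side of
  the defining inequality is of order \<open>\<epsilon>^(2k)\<close>, against
  \<open>\<epsilon>^(k + 1)\<close> on the right.\<close>

lemma rise_region_box:
  assumes k: "k \<ge> 3" and t: "t > 0"
  shows "\<exists>\<epsilon>>0. \<forall>u\<in>{\<epsilon> / 2..\<epsilon>}. \<forall>v\<in>{\<epsilon>..2 * \<epsilon>}. (u, v) \<in> rise_region k t"
proof -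
  \<comment> \<open>\<open>2 * k + 3 = 1 + (k + 1) / 2 * 4\<close> bounds the energy in units of
    \<open>\<epsilon>\<^sup>2\<close>.\<close>
  define Q where "Q = t ^ (k + 1) * (2 * real k + 3) ^ k"
  have Q: "Q > 0" using t by (simp add: Q_def)
  define \<epsilon> where "\<epsilon> = 1 / (1 + Q)"
  have \<epsilon>: "\<epsilon> > 0" "\<epsilon> \<le> 1" "Q * \<epsilon> < 1" using Q by (auto simp: \<epsilon>_def field_simps)
  have "(u, v) \<in> rise_region k t" if u: "u \<in> {\<epsilon> / 2..\<epsilon>}" and v: "v \<in> {\<epsilon>..2 * \<epsilon>}" for u v
  proof -
    have pos: "u > 0" "v > 0" using u v \<epsilon> by auto
    have "energy k (u, v) = u ^ (k + 1) + (real k + 1) / 2 * v\<^sup>2" by (simp add: energy_def)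
    also have "\<dots> \<le> \<epsilon>\<^sup>2 + (real k + 1) / 2 * (2 * \<epsilon>)\<^sup>2"
    proof (intro add_mono mult_left_mono)
      have "u ^ (k + 1) \<le> \<epsilon> ^ (k + 1)" using u pos by (intro power_mono) auto
      also have "\<dots> \<le> \<epsilon>\<^sup>2" using \<epsilon> k by (intro power_decreasing) auto
      finally show "u ^ (k + 1) \<le> \<epsilon>\<^sup>2" .
      show "v\<^sup>2 \<le> (2 * \<epsilon>)\<^sup>2" using v pos by (intro power_mono) auto
    qed auto
    also have "\<dots> = (2 * real k + 3) * \<epsilon>\<^sup>2" by (simp add: algebra_simps power_mult_distrib)
    finally have e: "energy k (u, v) \<le> (2 * real k + 3) * \<epsilon>\<^sup>2" .
    have e0: "energy k (u, v) \<ge> 0" using pos by (simp add: energy_def)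
    have "t ^ (k + 1) * energy k (u, v) ^ k \<le> t ^ (k + 1) * ((2 * real k + 3) * \<epsilon>\<^sup>2) ^ k"
      using t e e0 by (intro mult_left_mono power_mono) auto
    also have "\<dots> = (Q * \<epsilon> ^ (k - 1)) * \<epsilon> ^ (k + 1)"
    proof -
      have "(\<epsilon>\<^sup>2) ^ k = \<epsilon> ^ (k - 1) * \<epsilon> ^ (k + 1)"
        unfolding power_mult[symmetric] power_add[symmetric] using k by (intro arg_cong[where f = "power \<epsilon>"]) simp
      then show ?thesis by (simp only: Q_def power_mult_distrib mult_ac)
    qed
    also have "\<dots> < 1 * \<epsilon> ^ (k + 1)"
    proof (rule mult_strict_right_mono)
      have "\<epsilon> ^ (k - 1) \<le> \<epsilon> ^ 1" using \<epsilon> k by (intro power_decreasing) auto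
      then have "Q * \<epsilon> ^ (k - 1) \<le> Q * \<epsilon>" using Q by simp
      then show "Q * \<epsilon> ^ (k - 1) < 1" using \<epsilon> by linarith
    qed (use \<epsilon> in simp)
    also have "1 * \<epsilon> ^ (k + 1) \<le> v ^ (k + 1)" using v \<epsilon> by (simp only: mult_1) (intro power_mono, auto)
    finally show ?thesis using pos by (simp add: rise_region_def)
  qed
  then show ?thesis using \<epsilon> by blast
qed

lemma noninteger_between: "\<exists>\<theta>. a < \<theta> \<and> \<theta> < a + 1 \<and> \<theta> \<notin> (\<nat> :: real set)"
proof (cases "a + 1/2 \<in> \<nat>")
  case True
  then obtain m where m: "a + 1/2 = real m" by (auto elim: Nats_cases)
  have "a + 3/4 \<notin> \<nat>"
  proof
    assume "a + 3/4 \<in> \<nat>"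
    then obtain l where l: "a + 3/4 = real l" by (auto elim: Nats_cases)
    have "real l = real m + 1/4" using l m by simp
    then have "real (4 * l) = real (4 * m + 1)" by simp
    then have "4 * l = 4 * m + 1" by (simp only: of_nat_eq_iff)
    then show False by presburger
  qed
  then show ?thesis by (intro exI[of _ "a + 3/4"]) auto
next
  case False
  then show ?thesis by (intro exI[of _ "a + 1/2"]) auto
qed

theorem theorem1p3:
  fixes M :: "'w measure" and g h :: "int^3 \<Rightarrow> 'w \<Rightarrow> complex"
    and k :: nat and s t :: real
  assumes "prob_space M"
    and "odd k" and "k \<ge> 3" and "s > 5/2" and "t > 0"
    and "prob_space.indep_vars M (\<lambda>_. borel) (\<lambda>(b, n). if b then g n else h n)
           (UNIV \<times> ({0} \<union> {n. lex_pos n}))"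
    and "\<forall>n. lex_pos n \<longrightarrow> std_complex_gaussian M (g n) \<and> std_complex_gaussian M (h n)"
    and "std_real_gaussian M (g 0)" and "std_real_gaussian M (h 0)"
    and "\<forall>n \<omega>. g (- n) \<omega> = cnj (g n \<omega>) \<and> h (- n) \<omega> = cnj (h n \<omega>)"
  shows "\<not> absolutely_continuous
            (distr M fun_pair_space (\<lambda>\<omega>. (rand_u s g \<omega>, rand_v s h \<omega>)))
            (distr M fun_pair_space (\<lambda>\<omega>.
               ((\<lambda>x. fst (ode_flow k (rand_u s g \<omega> x, rand_v s h \<omega> x) t)),
                (\<lambda>x. snd (ode_flow k (rand_u s g \<omega> x, rand_v s h \<omega> x) t)))))"
  proof
  let ?f0 = "\<lambda>\<omega>. (rand_u s g \<omega>, rand_v s h \<omega>)"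
  let ?ft = "\<lambda>\<omega>. ((\<lambda>x. fst (ode_flow k (rand_u s g \<omega> x, rand_v s h \<omega> x) t)),
                (\<lambda>x. snd (ode_flow k (rand_u s g \<omega> x, rand_v s h \<omega> x) t)))"
  assume ac: "absolutely_continuous (distr M fun_pair_space ?f0) (distr M fun_pair_space ?ft)"
  interpret prob_space M by fact
  have indep_g: "indep_vars (\<lambda>_. borel) g ({0} \<union> {n. lex_pos n})"
    using indep_vars_reindex_inj[OF assms(6), of "\<lambda>n. (True, n)" "{0} \<union> {n. lex_pos n}"]
    by (auto simp: inj_on_def)
  have indep_h: "indep_vars (\<lambda>_. borel) h ({0} \<union> {n. lex_pos n})"
    using indep_vars_reindex_inj[OF assms(6), of "\<lambda>n. (False, n)" "{0} \<union> {n. lex_pos n}"]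
    by (auto simp: inj_on_def)
  interpret G: gaussian_family M g
    by unfold_locales (use indep_g assms(7-10) in auto)
  interpret H: gaussian_family M h
    by unfold_locales (use indep_h assms(7-10) in auto)
  define U where "U x \<omega> = G.fld (s + 1) x \<omega>" for x \<omega>
  define V where "V x \<omega> = H.fld s x \<omega>" for x \<omega>
  have U_eq: "rand_u s g \<omega> x = U x \<omega>" and V_eq: "rand_v s h \<omega> x = V x \<omega>" for x \<omega>
    by (simp_all add: U_def V_def rand_u_def rand_v_def G.fld_def H.fld_def)
  define W where "W x \<omega> = fst (ode_flow k (U x \<omega>, V x \<omega>) t)" for x \<omega>
  have [measurable]: "U x \<in> borel_measurable M" "V x \<in> borel_measurable M" for x
    unfolding U_def[abs_def] V_def[abs_def] by simp_all
  have flow[measurable]: "(\<lambda>\<omega>. ode_flow k (U x \<omega>, V x \<omega>) t) \<in> borel_measurable M" for x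
  proof -
    have "(\<lambda>p. ode_flow k p t) \<in> borel_measurable borel"
      using assms(2,5) by (intro borel_measurable_continuous_onI continuous_on_ode_flow) auto
    moreover have "(\<lambda>\<omega>. (U x \<omega>, V x \<omega>)) \<in> borel_measurable M"
      by (intro borel_measurable_Pair) auto
    ultimately show ?thesis by (rule measurable_compose[rotated])
  qed
  have f0_meas: "?f0 \<in> measurable M fun_pair_space"
    unfolding fun_pair_space_def
  proof (rule measurable_Pair)
    show "(\<lambda>\<omega>. rand_u s g \<omega>) \<in> measurable M (\<Pi>\<^sub>M x\<in>UNIV. borel)"
      by (rule measurable_PiM_single') (simp_all add: U_eq)
    show "(\<lambda>\<omega>. rand_v s h \<omega>) \<in> measurable M (\<Pi>\<^sub>M x\<in>UNIV. borel)"
      by (rule measurable_PiM_single') (simp_all add: V_eq)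
  qed
  have ft_meas: "?ft \<in> measurable M fun_pair_space"
    unfolding fun_pair_space_def U_eq V_eq
  proof (rule measurable_Pair)
    show "(\<lambda>\<omega> x. fst (ode_flow k (U x \<omega>, V x \<omega>) t)) \<in> measurable M (\<Pi>\<^sub>M x\<in>UNIV. borel)"
      by (rule measurable_PiM_single') (auto intro!: measurable_compose[OF flow] borel_measurable_continuous_onI continuous_intros)
    show "(\<lambda>\<omega> x. snd (ode_flow k (U x \<omega>, V x \<omega>) t)) \<in> measurable M (\<Pi>\<^sub>M x\<in>UNIV. borel)"
      by (rule measurable_PiM_single') (auto intro!: measurable_compose[OF flow] borel_measurable_continuous_onI continuous_intros)
  qed
  obtain \<theta> where \<theta>: "s - 3/2 < \<theta>" "\<theta> < s - 3/2 + 1" "\<theta> \<notin> \<nat>" using noninteger_between by blast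
  \<comment> \<open>An intermediate order for the second moments of \<open>u\<close>, below its
    threshold \<open>s + 1 - 3/2\<close>; the gap to \<open>\<theta>\<close> pays for the almost
    sure statement.\<close>
  define \<theta>' where "\<theta>' = (\<theta> + (s - 1/2)) / 2"
  have \<theta>': "\<theta> < \<theta>'" "\<theta>' < s - 1/2" using \<theta> by (auto simp: \<theta>'_def)
  \<comment> \<open>Large enough that \<open>dd N\<close> kills every power of \<open>dy j\<close>
    below the orders \<open>\<theta>\<close> and \<open>\<theta>'\<close>.\<close>
  define N where "N = nat \<lceil>s\<rceil>"
  have N: "N \<ge> 1" "s \<le> real N" using assms(4) unfolding N_def by linarith+
  have pos: "0 \<le> \<theta>'" "1/2 \<le> \<theta>" "\<theta> \<le> real N" "\<theta>' \<le> real N" using \<theta> \<theta>' N assms(4) by auto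
  \<comment> \<open>Pairs whose first component is not regular at the dyadic points, written with
    countably many conditions so as to be an event.\<close>
  define bad where "bad = {p \<in> space fun_pair_space. \<forall>C::nat. \<not> (\<forall>j. \<bar>dd N (\<lambda>j. fst p (xp j)) j\<bar> \<le> real C * dy j powr \<theta>)}"
  obtain c where c: "\<And>w j. dd N w j = (\<Sum>i\<le>N. c i * w (j + i))" using dd_coefficients by blast
  have [measurable]: "(\<lambda>p. fst p x) \<in> borel_measurable fun_pair_space" for x
    unfolding fun_pair_space_def
    by (rule measurable_compose[OF measurable_fst measurable_component_singleton]) simp
  have bad_sets: "bad \<in> sets fun_pair_space" unfolding bad_def c by measurable
  have bad_iff: "p \<in> bad \<longleftrightarrow> dd N (\<lambda>j. fst p (xp j)) \<notin> ody \<theta>" if "p \<in> space fun_pair_space" for p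
    using that unfolding bad_def bigo_dy_iff by simp
  have U_reg: "AE \<omega> in M. dd N (\<lambda>j. U (xp j) \<omega>) \<in> ody \<theta>"
    unfolding U_def by (rule G.fld_dd_regular[OF _ \<theta>'(1) pos(1,4) _ N(1)]) (use assms(4) \<theta>' in auto)
  have "bad \<in> null_sets (distr M fun_pair_space ?f0)"
  proof (subst null_sets_distr_iff[OF f0_meas], intro conjI bad_sets)
    have "AE \<omega> in M. \<omega> \<notin> ?f0 -` bad \<inter> space M"
      using U_reg AE_space
    proof eventually_elim
      case (elim \<omega>)
      then show ?case using bad_iff[OF measurable_space[OF f0_meas elim(2)]] by (simp add: U_eq)
    qed
    then show "?f0 -` bad \<inter> space M \<in> null_sets M"
      using measurable_sets[OF f0_meas bad_sets] by (subst AE_iff_null_sets) auto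
  qed
  \<comment> \<open>By convention, null sets of the first argument of
    \<open>absolutely_continuous\<close> are null sets of the second.\<close>
  then have "bad \<in> null_sets (distr M fun_pair_space ?ft)"
    using ac unfolding absolutely_continuous_def by blast
  then have "?ft -` bad \<inter> space M \<in> null_sets M" by (simp add: null_sets_distr_iff[OF ft_meas])
  then have "AE \<omega> in M. \<omega> \<notin> ?ft -` bad \<inter> space M" by (rule AE_not_in)
  with AE_space have W_reg: "AE \<omega> in M. dd N (\<lambda>j. W (xp j) \<omega>) \<in> ody \<theta>"
  proof eventually_elim
    case (elim \<omega>)
    then have "?ft \<omega> \<notin> bad" by simp
    then show ?case using bad_iff[OF measurable_space[OF ft_meas elim(1)]] by (simp add: U_eq V_eq W_def)
  qed
  have U_half: "AE \<omega> in M. (\<lambda>j. U (xp j) \<omega> - U 0 \<omega>) \<in> ody (1/2)"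
    unfolding U_def by (rule G.fld_half_regular) (use assms(4) in simp)
  have V_half: "AE \<omega> in M. (\<lambda>j. V (xp j) \<omega> - V 0 \<omega>) \<in> ody (1/2)"
    unfolding V_def by (rule H.fld_half_regular) (use assms(4) in simp)
  have V_irreg: "AE \<omega> in M. dd N (\<lambda>j. V (xp j) \<omega>) \<notin> ody \<theta>"
    unfolding V_def by (rule H.fld_dd_irregular) (use assms(4) \<theta> in auto)
  obtain \<epsilon> where \<epsilon>: "\<epsilon> > 0" and box: "\<And>u v. u \<in> {\<epsilon> / 2..\<epsilon>} \<Longrightarrow> v \<in> {\<epsilon>..2 * \<epsilon>} \<Longrightarrow> (u, v) \<in> rise_region k t"
    using rise_region_box[OF assms(3,5)] by blast
  \<comment> \<open>On the box event all inputs of \<open>polyasym_velocity\<close> are available,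
    and its conclusion contradicts the irregularity of \<open>V\<close>; so that event would be
    null.\<close>
  have "AE \<omega> in M. \<not> (U 0 \<omega> \<in> {\<epsilon> / 2..\<epsilon>} \<and> V 0 \<omega> \<in> {\<epsilon>..2 * \<epsilon>})"
    using U_reg W_reg U_half V_half V_irreg
  proof eventually_elim
    case (elim \<omega>)
    show ?case
    proof
      assume "U 0 \<omega> \<in> {\<epsilon> / 2..\<epsilon>} \<and> V 0 \<omega> \<in> {\<epsilon>..2 * \<epsilon>}"
      then have "(U 0 \<omega>, V 0 \<omega>) \<in> rise_region k t" using box by blast
      moreover have "polyasym \<theta> (\<lambda>j. U (xp j) \<omega>)" "polyasym \<theta> (\<lambda>j. W (xp j) \<omega>)"
        using elim \<theta> by (auto intro: dd_bigo_imp_polyasym)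
      ultimately have "polyasym \<theta> (\<lambda>j. V (xp j) \<omega>)"
        using polyasym_velocity[OF assms(2,3,5) pos(2) _ elim(3) _ elim(4)] unfolding W_def by blast
      then have "dd N (\<lambda>j. V (xp j) \<omega>) \<in> ody \<theta>" by (rule polyasym_imp_dd_bigo[OF _ pos(3)])
      with elim(5) show False by blast
    qed
  qed
  moreover have "\<not> (AE \<omega> in M. \<not> (U 0 \<omega> \<in> {\<epsilon> / 2..\<epsilon>} \<and> V 0 \<omega> \<in> {\<epsilon>..2 * \<epsilon>}))"
    unfolding U_def V_def
    by (rule joint_box_positive[OF G.gaussian_family_axioms H.gaussian_family_axioms assms(6)])
      (use assms(4) \<epsilon> in auto)
  ultimately show False by blast
qed

end
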